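(* The isomorphism problem is undecidable for word-hyperbolic semigroups. That is, there is no algorithm that takes as input two interpreted word-hyperbolic structures $\Sigma_1$ and $\Sigma_2$ for semigroups $S_1$ and $S_2$, respectively, and decides whether $S_1$ and $S_2$ are isomorphic.
   Context: Maps are written on the right. For a word $u=a_1\cdots a_n$, $u^{\mathrm{rev}}=a_n\cdots a_1$ is its reversal, and for a language $L$, $L^{\mathrm{rev}}=\{w^{\mathrm{rev}} : w\in L\}$. $A^+$ is the set of non-empty words over $A$ (the free semigroup on $A$). A pre-word-hyperbolic structure $\Sigma$ consists of: a finite alphabet $A(\Sigma)$; a regular language $L(\Sigma)$ over $A(\Sigma)$ not containing the empty word; and a context-free language $M(\Sigma)$ over $A(\Sigma)\cup\{\#_1,\#_2\}$, where $\#_1,\#_2$ are new symbols not in $A(\Sigma)$, such that $M(\Sigma)\subseteq L(\Sigma)\#_1L(\Sigma)\#_2L(\Sigma)^{\mathrm{rev}}$. An interpretation of $\Sigma$ with respect to a semigroup $S$ is a homomorphism $\phi:A(\Sigma)^+\to S$ such that $\phi|_{A(\Sigma)}$ is injective, $(L(\Sigma))\phi=S$, and $M(\Sigma)=\{u\#_1v\#_2w^{\mathrm{rev}} : u,v,w\in L(\Sigma),\ (u\phi)(v\phi)=w\phi\}$. If $\Sigma$ admits an interpretation with respect to $S$, then $\Sigma$ is a word-hyperbolic structure for $S$. (A word-hyperbolic structure describes a unique semigroup up to isomorphism.) An assignment of generators for a word-hyperbolic structure $\Sigma$ is a map $\alpha:A(\Sigma)\to L(\Sigma)$ such that there is some interpretation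 $\phi$ of $\Sigma$ with $a\alpha\phi=a\phi$ for all $a\in A(\Sigma)$ (such $\phi$ is said to be consistent with $\alpha$). An interpreted word-hyperbolic structure is a word-hyperbolic structure equipped with an assignment of generators; by convention it is assumed that $A(\Sigma)\subseteq L(\Sigma)$ and that the assignment of generators is the embedding map $A(\Sigma)\to L(\Sigma)$. As algorithmic input, such a structure is given by the alphabet, a finite automaton for $L(\Sigma)$, and a context-free grammar for $M(\Sigma)$ (the input is guaranteed to be a word-hyperbolic structure). *)

theory Defs
  imports "HOL-Algebra.Group" "HOL-Library.Nat_Bijection"
begin

section \<open>Semigroups\<close>

text \<open>
  Semigroups use the records of \<^theory>\<open>HOL-Algebra.Group\<close>, so that \<^const>\<open>hom\<close> and
  \<^const>\<open>is_iso\<close> are available; neither of these refers to the field \<^const>\<open>one\<close>,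
  which is an arbitrary value here and need not be an identity.
\<close>

definition semigroup_struct :: "('s, 'm) monoid_scheme \<Rightarrow> bool" where
  "semigroup_struct S \<longleftrightarrow>
     carrier S \<noteq> {} \<and>
     (\<forall>x\<in>carrier S. \<forall>y\<in>carrier S. x \<otimes>\<^bsub>S\<^esub> y \<in> carrier S) \<and>
     (\<forall>x\<in>carrier S. \<forall>y\<in>carrier S. \<forall>z\<in>carrier S.
        (x \<otimes>\<^bsub>S\<^esub> y) \<otimes>\<^bsub>S\<^esub> z = x \<otimes>\<^bsub>S\<^esub> (y \<otimes>\<^bsub>S\<^esub> z))"

definition free_semigroup :: "'a set \<Rightarrow> 'a list monoid" where
  "free_semigroup A = \<lparr>carrier = {w \<in> lists A. w \<noteq> []}, mult = (@), one = []\<rparr>"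


section \<open>Regular and context-free languages\<close>

text \<open>
  Automata are nondeterministic, without empty transitions; all components are lists, so that
  automata and grammars are finite objects that can serve as input of an algorithm.
\<close>

record 'a nfa =
  initial :: "nat list"
  transitions :: "(nat \<times> 'a \<times> nat) list"
  final :: "nat list"

primrec nfa_run :: "'a nfa \<Rightarrow> nat \<Rightarrow> 'a list \<Rightarrow> nat \<Rightarrow> bool" where
  "nfa_run N p [] q \<longleftrightarrow> p = q"
| "nfa_run N p (a # w) q \<longleftrightarrow> (\<exists>r. (p, a, r) \<in> set (transitions N) \<and> nfa_run N r w q)"

definition nfa_lang :: "'a nfa \<Rightarrow> 'a list set" where
  "nfa_lang N = {w. \<exists>p \<in> set (initial N). \<exists>q \<in> set (final N). nfa_run N p w q}"

definition nfa_over :: "'a set \<Rightarrow> 'a nfa \<Rightarrow> bool" where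
  "nfa_over A N \<longleftrightarrow> (\<forall>(p, a, q) \<in> set (transitions N). a \<in> A)"

definition regular_over :: "'a set \<Rightarrow> 'a list set \<Rightarrow> bool" where
  "regular_over A L \<longleftrightarrow> (\<exists>N. nfa_over A N \<and> L = nfa_lang N)"

text \<open>In a sentential form, \<^const>\<open>Inl\<close> marks nonterminals and \<^const>\<open>Inr\<close> terminals.\<close>

record 't cfg =
  start :: nat
  productions :: "(nat \<times> (nat + 't) list) list"

definition cfg_step :: "'t cfg \<Rightarrow> ((nat + 't) list \<times> (nat + 't) list) set" where
  "cfg_step G = {(u @ [Inl X] @ v, u @ w @ v) | u X v w. (X, w) \<in> set (productions G)}"

definition cfg_lang :: "'t cfg \<Rightarrow> 't list set" where
  "cfg_lang G = {w. ([Inl (start G)], map Inr w) \<in> (cfg_step G)\<^sup>*}"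

definition cfg_over :: "'t set \<Rightarrow> 't cfg \<Rightarrow> bool" where
  "cfg_over T G \<longleftrightarrow> (\<forall>(X, w) \<in> set (productions G). \<forall>t. Inr t \<in> set w \<longrightarrow> t \<in> T)"

definition context_free_over :: "'t set \<Rightarrow> 't list set \<Rightarrow> bool" where
  "context_free_over T M \<longleftrightarrow> (\<exists>G. cfg_over T G \<and> M = cfg_lang G)"


section \<open>Word-hyperbolic structures\<close>

datatype 'a msym = Letter 'a | Hash1 | Hash2

abbreviation msyms :: "'a set \<Rightarrow> 'a msym set" where
  "msyms A \<equiv> Letter ` A \<union> {Hash1, Hash2}"

definition mult_word :: "'a list \<Rightarrow> 'a list \<Rightarrow> 'a list \<Rightarrow> 'a msym list" where
  "mult_word u v w =
     map Letter u @ [Hash1] @ map Letter v @ [Hash2] @ map Letter (rev w)"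

record 'a wh_structure =
  alphabet :: "'a set"
  repr_lang :: "'a list set"
  mult_lang :: "'a msym list set"

definition pre_word_hyperbolic :: "'a wh_structure \<Rightarrow> bool" where
  "pre_word_hyperbolic \<Sigma> \<longleftrightarrow>
     finite (alphabet \<Sigma>) \<and>
     regular_over (alphabet \<Sigma>) (repr_lang \<Sigma>) \<and> [] \<notin> repr_lang \<Sigma> \<and>
     context_free_over (msyms (alphabet \<Sigma>)) (mult_lang \<Sigma>) \<and>
     mult_lang \<Sigma> \<subseteq>
       {mult_word u v w | u v w.
          u \<in> repr_lang \<Sigma> \<and> v \<in> repr_lang \<Sigma> \<and> w \<in> repr_lang \<Sigma>}"

definition interpretation_wrt ::
    "'a wh_structure \<Rightarrow> 's monoid \<Rightarrow> ('a list \<Rightarrow> 's) \<Rightarrow> bool" where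
  "interpretation_wrt \<Sigma> S \<phi> \<longleftrightarrow>
     \<phi> \<in> hom (free_semigroup (alphabet \<Sigma>)) S \<and>
     inj_on (\<lambda>a. \<phi> [a]) (alphabet \<Sigma>) \<and>
     \<phi> ` repr_lang \<Sigma> = carrier S \<and>
     mult_lang \<Sigma> =
       {mult_word u v w | u v w.
          u \<in> repr_lang \<Sigma> \<and> v \<in> repr_lang \<Sigma> \<and> w \<in> repr_lang \<Sigma> \<and>
          \<phi> u \<otimes>\<^bsub>S\<^esub> \<phi> v = \<phi> w}"

definition word_hyperbolic_structure_for :: "'a wh_structure \<Rightarrow> 's monoid \<Rightarrow> bool" where
  "word_hyperbolic_structure_for \<Sigma> S \<longleftrightarrow>
     semigroup_struct S \<and> pre_word_hyperbolic \<Sigma> \<and> (\<exists>\<phi>. interpretation_wrt \<Sigma> S \<phi>)"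

definition assignment_of_generators ::
    "'a wh_structure \<Rightarrow> 's monoid \<Rightarrow> ('a \<Rightarrow> 'a list) \<Rightarrow> bool" where
  "assignment_of_generators \<Sigma> S \<alpha> \<longleftrightarrow>
     \<alpha> ` alphabet \<Sigma> \<subseteq> repr_lang \<Sigma> \<and>
     (\<exists>\<phi>. interpretation_wrt \<Sigma> S \<phi> \<and> (\<forall>a\<in>alphabet \<Sigma>. \<phi> (\<alpha> a) = \<phi> [a]))"

text \<open>
  By convention, the assignment of generators of an interpreted structure is the embedding of
  the alphabet as one-letter words; in particular these words belong to \<^term>\<open>repr_lang \<Sigma>\<close>.
\<close>

definition interpreted_wh_structure_for :: "'a wh_structure \<Rightarrow> 's monoid \<Rightarrow> bool" where
  "interpreted_wh_structure_for \<Sigma> S \<longleftrightarrow>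
     word_hyperbolic_structure_for \<Sigma> S \<and> assignment_of_generators \<Sigma> S (\<lambda>a. [a])"


section \<open>Presentations of structures as algorithmic input\<close>

record 'a wh_input =
  letters :: "'a list"
  automaton :: "'a nfa"
  grammar :: "'a msym cfg"

definition wf_input :: "'a wh_input \<Rightarrow> bool" where
  "wf_input P \<longleftrightarrow>
     nfa_over (set (letters P)) (automaton P) \<and> cfg_over (msyms (set (letters P))) (grammar P)"

definition structure_of :: "'a wh_input \<Rightarrow> 'a wh_structure" where
  "structure_of P =
     \<lparr>alphabet = set (letters P),
      repr_lang = nfa_lang (automaton P),
      mult_lang = cfg_lang (grammar P)\<rparr>"

definition presents_interpreted :: "'a wh_input \<Rightarrow> 's monoid \<Rightarrow> bool" where
  "presents_interpreted P S \<longleftrightarrow>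
     wf_input P \<and> interpreted_wh_structure_for (structure_of P) S"

text \<open>
  An algorithm receives inputs whose letters are natural numbers, in the following numerical
  encoding.
\<close>

primrec msym_encode :: "nat msym \<Rightarrow> nat" where
  "msym_encode Hash1 = 0"
| "msym_encode Hash2 = 1"
| "msym_encode (Letter a) = a + 2"

definition nfa_encode :: "nat nfa \<Rightarrow> nat" where
  "nfa_encode N =
     prod_encode (list_encode (initial N),
       prod_encode
         (list_encode (map (\<lambda>(p, a, q). prod_encode (p, prod_encode (a, q))) (transitions N)),
          list_encode (final N)))"

definition production_encode :: "nat \<times> (nat + nat msym) list \<Rightarrow> nat" where
  "production_encode =
     (\<lambda>(X, w). prod_encode
        (X, list_encode (map (\<lambda>s. sum_encode (map_sum id msym_encode s)) w)))"

definition cfg_encode :: "nat msym cfg \<Rightarrow> nat" where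
  "cfg_encode G =
     prod_encode (start G, list_encode (map production_encode (productions G)))"

definition input_encode :: "nat wh_input \<Rightarrow> nat" where
  "input_encode P =
     prod_encode (list_encode (letters P),
       prod_encode (nfa_encode (automaton P), cfg_encode (grammar P)))"

lemma inj_msym_encode: "inj msym_encode"
proof (rule injI)
  fix x y assume "msym_encode x = msym_encode y"
  then show "x = y" by (cases x; cases y) auto
qed

lemma inj_production_encode: "inj production_encode"
proof -
  have "inj (\<lambda>s :: nat + nat msym. sum_encode (map_sum id msym_encode s))"
    by (intro inj_compose[OF inj_sum_encode, unfolded comp_def] sum.inj_map inj_msym_encode) simp
  note map_eq = inj_map_eq_map[OF this]
  show ?thesis
    by (rule injI) (clarsimp simp: production_encode_def list_encode_eq map_eq)
qed

lemma inj_nfa_encode: "inj nfa_encode"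
proof -
  have "inj (\<lambda>(p, a, q). prod_encode (p, prod_encode (a, q)))"
    by (auto intro!: injI)
  note map_eq = inj_map_eq_map[OF this]
  show ?thesis
    by (rule injI, rule nfa.equality)
       (simp_all add: nfa_encode_def list_encode_eq map_eq)
qed

lemma inj_cfg_encode: "inj cfg_encode"
  by (rule injI, rule cfg.equality)
     (simp_all add: cfg_encode_def list_encode_eq inj_map_eq_map[OF inj_production_encode])

lemma inj_input_encode: "inj input_encode"
  by (rule injI, rule wh_input.equality)
     (simp_all add: input_encode_def list_encode_eq
       inj_eq[OF inj_nfa_encode] inj_eq[OF inj_cfg_encode])


section \<open>Algorithms: partial recursive functions\<close>

datatype recf =
    Zero
  | Succ
  | Proj nat
  | Comp recf "recf list"
  | PrimRec recf recf
  | Mu recf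

text \<open>
  \<^term>\<open>computes f xs y\<close> means that \<^term>\<open>f\<close> halts on the arguments \<^term>\<open>xs\<close> with output
  \<^term>\<open>y\<close>. The recursion and search variable is the first argument.
\<close>

inductive computes :: "recf \<Rightarrow> nat list \<Rightarrow> nat \<Rightarrow> bool" where
  Zero: "computes Zero xs 0"
| Succ: "computes Succ [x] (Suc x)"
| Proj: "i < length xs \<Longrightarrow> computes (Proj i) xs (xs ! i)"
| Comp: "length ys = length gs \<Longrightarrow> (\<forall>i < length gs. computes (gs ! i) xs (ys ! i)) \<Longrightarrow>
         computes f ys z \<Longrightarrow> computes (Comp f gs) xs z"
| PrimRec_0: "computes f xs y \<Longrightarrow> computes (PrimRec f g) (0 # xs) y"
| PrimRec_Suc: "computes (PrimRec f g) (n # xs) r \<Longrightarrow> computes g (n # r # xs) y \<Longrightarrow>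
         computes (PrimRec f g) (Suc n # xs) y"
| Mu: "computes f (n # xs) 0 \<Longrightarrow> (\<forall>m < n. \<exists>k. computes f (m # xs) (Suc k)) \<Longrightarrow>
         computes (Mu f) xs n"

inductive_cases computes_ZeroE: "computes Zero xs y"
inductive_cases computes_SuccE: "computes Succ xs y"
inductive_cases computes_ProjE: "computes (Proj i) xs y"
inductive_cases computes_CompE: "computes (Comp f gs) xs y"
inductive_cases computes_PrimRec_0E: "computes (PrimRec f g) (0 # xs) y"
inductive_cases computes_PrimRec_SucE: "computes (PrimRec f g) (Suc n # xs) y"
inductive_cases computes_MuE: "computes (Mu f) xs y"

lemma computes_deterministic: "computes f xs y \<Longrightarrow> computes f xs z \<Longrightarrow> y = z"
proof (induction arbitrary: z rule: computes.induct)
  case (Zero xs)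
  then show ?case by (blast elim: computes_ZeroE)
next
  case (Succ x)
  then show ?case by (auto elim: computes_SuccE)
next
  case (Proj i xs)
  then show ?case by (blast elim: computes_ProjE)
next
  case (Comp ys gs xs f y)
  from Comp.prems obtain zs where zs: "length zs = length gs"
    "\<forall>i < length gs. computes (gs ! i) xs (zs ! i)" "computes f zs z"
    by (rule computes_CompE)
  have "ys = zs"
    by (rule nth_equalityI) (use Comp.hyps Comp.IH zs in simp_all)
  then show ?case using Comp.IH(2) zs(3) by blast
next
  case (PrimRec_0 f xs y g)
  then show ?case by (blast elim: computes_PrimRec_0E)
next
  case (PrimRec_Suc f g n xs r y)
  from PrimRec_Suc.prems obtain r' where
    r': "computes (PrimRec f g) (n # xs) r'" "computes g (n # r' # xs) z"
    by (rule computes_PrimRec_SucE)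
  have "r = r'" by (rule PrimRec_Suc.IH(1)) (rule r'(1))
  with r'(2) show ?case by (intro PrimRec_Suc.IH(2)) simp
next
  case (Mu f n xs)
  from Mu.prems have z: "computes f (z # xs) 0" "\<forall>m < z. \<exists>k. computes f (m # xs) (Suc k)"
    by (blast elim: computes_MuE)+
  show ?case
  proof (rule linorder_cases[of n z])
    assume "n < z"
    then obtain k where "computes f (n # xs) (Suc k)" using z(2) by blast
    then have "0 = Suc k" by (rule Mu.IH(1))
    then show ?thesis by simp
  next
    assume "z < n"
    then obtain k where "\<forall>y. computes f (z # xs) y \<longrightarrow> Suc k = y" using Mu.IH(2) by blast
    then show ?thesis using z(1) by blast
  qed
qed

end

theory Submission
  imports Defs "HOL-Library.Countable"
begin

text \<open>
  If \<open>I\<close> is a context-free ideal of the free semigroup over \<open>{0, 1, 2}\<close>, then the Rees quotient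
  by \<open>I\<close> is word-hyperbolic, with all non-empty words as representatives: \<open>u v = w\<close> holds in it if
  and only if it holds in the free semigroup or both \<open>u v\<close> and \<open>w\<close> lie in \<open>I\<close>. An isomorphism
  between two such quotients permutes the letters, so quotients by ideals \<open>I \<subseteq> J\<close> are isomorphic
  only if \<open>I = J\<close>: both ideals contain the same number of words of each length. Taking the ideals
  generated by the words \<open>2 w 2\<close> for \<open>w\<close> in context-free languages over \<open>{0, 1}\<close>, the isomorphism
  problem becomes inclusion of context-free languages.

  Words over \<open>{0, 1}\<close> that end in 0 are lists of numbers in unary. By induction on a partial
  recursive function, its halting computations are the lists in the difference of two context-free
  languages, namely well-formed and faulty certificates. The diagonal argument needs no universal
  function: a hypothetical decision procedure is turned into a function whose argument \<open>n\<close> codes the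
  productions of a grammar, and which halts on \<open>n\<close> if and only if the two semigroups that are
  presented by this grammar for the input \<open>n\<close> are isomorphic. The grammar is chosen such that they
  are isomorphic if and only if the function does not halt on \<open>n\<close>.
\<close>

section \<open>Context-free expressions\<close>

text \<open>Two obstacles shape the construction. A context-free language can detect that one chosen
  pair of unary numbers is unequal, but it cannot check many equalities at once. Hence correctness
  appears only as the absence of faults, and halting becomes the failure of an inclusion of
  well-formed certificates in faulty ones. Moreover, a multiplication language contains every
  splitting of a word of the ideal into two factors, so the marker \<open>Hash1\<close> has to be
  inserted at arbitrary places. This is unproblematic for fixed expressions, but not within the
  number \<open>n\<close>, which enters the grammar only through the two productions of
  \<open>input_prods\<close>; the tested number is therefore written twice in each word.
  Self-reference is cheap: \<open>base_prods\<close> does not depend on \<open>n\<close>, both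
  presentations share it and differ in the start symbol alone, and the full list of productions
  arises by putting two easily computed entries in front of it. So \<open>n\<close> can be the code
  of \<open>base_prods\<close> itself, without a fixed-point theorem for recursive
  functions.\<close>

definition conc :: "'a list set \<Rightarrow> 'a list set \<Rightarrow> 'a list set" (infixr "\<cdot>" 75) where
  "A \<cdot> B = {u @ v | u v. u \<in> A \<and> v \<in> B}"

lemma concI: "u \<in> A \<Longrightarrow> v \<in> B \<Longrightarrow> u @ v \<in> A \<cdot> B"
  by (auto simp: conc_def)

lemma concE:
  assumes "w \<in> A \<cdot> B"
  obtains u v where "w = u @ v" "u \<in> A" "v \<in> B"
  using assms by (auto simp: conc_def)

lemma conc_mono: "A \<subseteq> A' \<Longrightarrow> B \<subseteq> B' \<Longrightarrow> A \<cdot> B \<subseteq> A' \<cdot> B'"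
  by (auto simp: conc_def)

lemma conc_assoc: "(A \<cdot> B) \<cdot> C = A \<cdot> B \<cdot> C"
  unfolding conc_def by (auto, metis append_assoc, metis append_assoc)

lemma conc_Nil [simp]: "{[]} \<cdot> A = A" "A \<cdot> {[]} = A"
  by (auto simp: conc_def)

text \<open>The least solution of \<open>X = A \<union> P \<cdot> X \<cdot> Q\<close>. It yields
  stars when \<open>A\<close> and \<open>Q\<close> are \<open>{[]}\<close>, matched counting when
  \<open>P\<close> and \<open>Q\<close> are single letters, and nested certificates.\<close>

inductive_set lin :: "'a list set \<Rightarrow> 'a list set \<Rightarrow> 'a list set \<Rightarrow> 'a list set" for A P Q where
  base: "x \<in> A \<Longrightarrow> x \<in> lin A P Q"
| step: "p \<in> P \<Longrightarrow> x \<in> lin A P Q \<Longrightarrow> q \<in> Q \<Longrightarrow> p @ x @ q \<in> lin A P Q"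

instance msym :: (countable) countable
  by countable_datatype

text \<open>
  \<open>Hole False\<close> and \<open>Hole True\<close> stand for the two nonterminals whose single production depends on
  the number against which the input of a computation is compared.
\<close>

datatype lexp =
    Word "nat msym list"
  | Alt lexp lexp
  | Cat lexp lexp
  | Lin lexp lexp lexp
  | Mirror lexp
  | Hole bool

instance lexp :: countable
  by countable_datatype

definition ltrs :: "nat msym list" where
  "ltrs = [Letter 0, Letter 1, Letter 2]"

primrec lang :: "nat \<Rightarrow> lexp \<Rightarrow> nat msym list set" where
  "lang n (Word w) = {w}"
| "lang n (Alt a b) = lang n a \<union> lang n b"
| "lang n (Cat a b) = lang n a \<cdot> lang n b"
| "lang n (Lin a p q) = lin (lang n a) (lang n p) (lang n q)"
| "lang n (Mirror a) = {u @ x @ rev u | u x. u \<in> lists (set ltrs) \<and> x \<in> lang n a}"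
| "lang n (Hole b) =
     (if b then {replicate n (Letter 1)} else {replicate k (Letter 1) | k. k \<le> n})"

text \<open>
  The nonterminals 0 and 1 are start symbols, 2 and 3 are the holes, and 4 derives at most one tally.
\<close>

fun nonterm :: "lexp \<Rightarrow> nat" where
  "nonterm (Hole b) = (if b then 3 else 2)"
| "nonterm e = to_nat e + 5"

text \<open>Holes receive no productions here. Theirs come from \<open>input_prods\<close>, the only
  part of the grammar that depends on \<open>n\<close>.\<close>

primrec prods :: "lexp \<Rightarrow> (nat \<times> (nat + nat msym) list) list" where
  "prods (Word w) = [(nonterm (Word w), map Inr w)]"
| "prods (Alt a b) =
     [(nonterm (Alt a b), [Inl (nonterm a)]), (nonterm (Alt a b), [Inl (nonterm b)])]
     @ prods a @ prods b"
| "prods (Cat a b) =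
     (nonterm (Cat a b), [Inl (nonterm a), Inl (nonterm b)]) # prods a @ prods b"
| "prods (Lin a p q) =
     [(nonterm (Lin a p q), [Inl (nonterm a)]),
      (nonterm (Lin a p q),
         [Inl (nonterm p), Inl (nonterm (Lin a p q)), Inl (nonterm q)])]
     @ prods a @ prods p @ prods q"
| "prods (Mirror a) =
     (nonterm (Mirror a), [Inl (nonterm a)]) #
     map (\<lambda>c. (nonterm (Mirror a), [Inr c, Inl (nonterm (Mirror a)), Inr c])) ltrs
     @ prods a"
| "prods (Hole b) = []"

definition input_prods :: "nat \<Rightarrow> (nat \<times> (nat + nat msym) list) list" where
  "input_prods n = [(2, replicate n (Inl 4)), (3, replicate n (Inr (Letter 1)))]"

definition base_prods :: "lexp \<Rightarrow> lexp \<Rightarrow> (nat \<times> (nat + nat msym) list) list" where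
  "base_prods e e' =
     [(0, [Inl (nonterm e)]), (1, [Inl (nonterm e')]), (4, [Inr (Letter 1)]), (4, [])]
     @ prods e @ prods e'"

definition lexp_cfg :: "nat \<Rightarrow> lexp \<Rightarrow> lexp \<Rightarrow> nat \<Rightarrow> nat msym cfg" where
  "lexp_cfg s e e' n = \<lparr>start = s, productions = input_prods n @ base_prods e e'\<rparr>"

section \<open>Correctness of the grammar of an expression\<close>

primrec form_lang :: "(nat \<Rightarrow> 't list set) \<Rightarrow> (nat + 't) list \<Rightarrow> 't list set" where
  "form_lang V [] = {[]}"
| "form_lang V (s # ss) = (case s of Inl X \<Rightarrow> V X | Inr t \<Rightarrow> {[t]}) \<cdot> form_lang V ss"

lemma form_lang_append: "form_lang V (s @ t) = form_lang V s \<cdot> form_lang V t"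
  by (induction s) (simp_all add: conc_assoc)

lemma form_lang_terminals: "form_lang V (map Inr w) = {w}"
  by (induction w) (auto simp: conc_def)

text \<open>When \<open>V\<close> is closed under the productions, each derivation step can only
  shrink the language denoted by the sentential form, and a terminal word denotes just
  itself.\<close>

lemma cfg_sound:
  assumes "\<And>X w. (X, w) \<in> set (productions G) \<Longrightarrow> form_lang V w \<subseteq> V X"
  shows "cfg_lang G \<subseteq> V (start G)"
proof
  fix w assume "w \<in> cfg_lang G"
  then have "([Inl (start G)], map Inr w) \<in> (cfg_step G)\<^sup>*"
    by (simp add: cfg_lang_def)
  then have "form_lang V (map Inr w) \<subseteq> form_lang V [Inl (start G)]"
  proof (induction rule: rtrancl_induct)
    case (step y z)
    from step.hyps(2) obtain u X v r where
      "y = u @ [Inl X] @ v" "z = u @ r @ v" "(X, r) \<in> set (productions G)"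
      by (auto simp: cfg_step_def)
    moreover from this have "form_lang V r \<subseteq> form_lang V [Inl X]"
      using assms by simp
    ultimately have "form_lang V z \<subseteq> form_lang V y"
      by (simp only: form_lang_append) (intro conc_mono order_refl)
    then show ?case using step.IH by blast
  qed simp
  then show "w \<in> V (start G)"
    by (simp add: form_lang_terminals)
qed

lemma cfg_step_context: "(s, t) \<in> cfg_step G \<Longrightarrow> (a @ s @ b, a @ t @ b) \<in> cfg_step G"
  unfolding cfg_step_def by clarsimp (metis append.assoc append_Cons)

lemma derives_context:
  "(s, t) \<in> (cfg_step G)\<^sup>* \<Longrightarrow> (a @ s @ b, a @ t @ b) \<in> (cfg_step G)\<^sup>*"
  by (induction rule: rtrancl_induct) (auto intro: rtrancl_into_rtrancl cfg_step_context)

lemma derives_append: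
  assumes "(s, t) \<in> (cfg_step G)\<^sup>*" "(s', t') \<in> (cfg_step G)\<^sup>*"
  shows "(s @ s', t @ t') \<in> (cfg_step G)\<^sup>*"
  using derives_context[OF assms(1), of "[]" s'] derives_context[OF assms(2), of t "[]"] by simp

lemma derives_Cons:
  "([s], t) \<in> (cfg_step G)\<^sup>* \<Longrightarrow> (s', t') \<in> (cfg_step G)\<^sup>* \<Longrightarrow> (s # s', t @ t') \<in> (cfg_step G)\<^sup>*"
  using derives_append[of "[s]"] by simp

lemma derives_prod:
  "(X, r) \<in> set (productions G) \<Longrightarrow> (r, t) \<in> (cfg_step G)\<^sup>* \<Longrightarrow> ([Inl X], t) \<in> (cfg_step G)\<^sup>*"
proof -
  assume "(X, r) \<in> set (productions G)" "(r, t) \<in> (cfg_step G)\<^sup>*"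
  moreover from this(1) have "([Inl X], r) \<in> cfg_step G"
    by (force simp: cfg_step_def intro: exI[of _ "[]"])
  ultimately show ?thesis by (simp add: converse_rtrancl_into_rtrancl)
qed

text \<open>Numbering by \<open>to_nat\<close> ties a nonterminal to one expression, so
  \<open>from_nat\<close> recovers its meaning, and a subexpression common to \<open>e\<close> and
  \<open>e'\<close> can safely share its nonterminal.\<close>

definition lexp_val :: "lexp \<Rightarrow> lexp \<Rightarrow> nat \<Rightarrow> nat \<Rightarrow> nat msym list set" where
  "lexp_val e e' n X =
     (if X = 0 then lang n e else if X = 1 then lang n e'
      else if X = 2 then lang n (Hole False) else if X = 3 then lang n (Hole True)
      else if X = 4 then {[], [Letter 1]} else lang n (from_nat (X - 5)))"

lemma lexp_val_nonterm [simp]: "lexp_val e e' n (nonterm a) = lang n a"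
  by (cases a) (simp_all add: lexp_val_def)

lemma Mirror_step: "c \<in> set ltrs \<Longrightarrow> w \<in> lang n (Mirror a) \<Longrightarrow> c # w @ [c] \<in> lang n (Mirror a)"
proof -
  assume c: "c \<in> set ltrs" and "w \<in> lang n (Mirror a)"
  then obtain u x where "w = u @ x @ rev u" "u \<in> lists (set ltrs)" "x \<in> lang n a" by auto
  with c have "c # w @ [c] = (c # u) @ x @ rev (c # u)" "c # u \<in> lists (set ltrs)" by auto
  with \<open>x \<in> lang n a\<close> show ?thesis unfolding lang.simps by blast
qed

lemma Mirror_base: "w \<in> lang n a \<Longrightarrow> w \<in> lang n (Mirror a)"
  unfolding lang.simps by (rule CollectI, rule exI[of _ "[]"], rule exI[of _ w]) simp

lemma prods_sound:
  "(X, w) \<in> set (prods a) \<Longrightarrow> form_lang (lexp_val e e' n) w \<subseteq> lexp_val e e' n X"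
proof (induction a)
  case (Lin a1 a2 a3)
  then show ?case
    by (auto simp del: nonterm.simps simp: conc_def intro: lin.intros)
next
  case (Mirror a)
  then consider "X = nonterm (Mirror a)" "w = [Inl (nonterm a)]"
    | c where "c \<in> set ltrs" "X = nonterm (Mirror a)" "w = [Inr c, Inl (nonterm (Mirror a)), Inr c]"
    | "(X, w) \<in> set (prods a)"
    by (auto simp del: nonterm.simps)
  then show ?case
  proof cases
    case 1
    then show ?thesis by (auto simp del: nonterm.simps lang.simps intro: Mirror_base)
  next
    case 2
    then show ?thesis
      by (auto simp del: nonterm.simps lang.simps simp: conc_def intro: Mirror_step)
  next
    case 3
    then show ?thesis by (rule Mirror.IH)
  qed
qed (auto simp del: nonterm.simps simp: conc_def form_lang_terminals)

lemma form_lang_replicate_word: "form_lang V (replicate n (Inr t)) = {replicate n t}"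
  using form_lang_terminals[of V "replicate n t"] by simp

lemma form_lang_replicate:
  assumes "V X = {[], [t]}"
  shows "form_lang V (replicate n (Inl X)) = {replicate k t | k. k \<le> n}"
proof (induction n)
  case (Suc n)
  have "{[], [t]} \<cdot> {replicate k t | k. k \<le> n} = {replicate k t | k. k \<le> Suc n}"
  proof (intro equalityI subsetI)
    fix x assume "x \<in> {[], [t]} \<cdot> {replicate k t | k. k \<le> n}"
    then obtain k where "k \<le> n" "x = replicate k t \<or> x = replicate (Suc k) t"
      by (auto simp: conc_def)
    then show "x \<in> {replicate k t | k. k \<le> Suc n}"
      by (metis (mono_tags, lifting) Suc_le_mono le_SucI mem_Collect_eq)
  next
    fix x assume "x \<in> {replicate k t | k. k \<le> Suc n}"
    then obtain k where k: "k \<le> Suc n" "x = replicate k t" by blast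
    show "x \<in> {[], [t]} \<cdot> {replicate k t | k. k \<le> n}"
    proof (cases k)
      case 0
      then show ?thesis using k by (auto simp: conc_def intro!: exI[of _ "[]"])
    next
      case (Suc j)
      then have "x = [t] @ replicate j t" "j \<le> n" using k by auto
      then show ?thesis by (simp only:) (intro concI; blast)
    qed
  qed
  then show ?case using Suc assms by simp
qed simp

lemma lexp_cfg_sound: "cfg_lang (lexp_cfg s e e' n) \<subseteq> lexp_val e e' n s"
proof -
  have "form_lang (lexp_val e e' n) w \<subseteq> lexp_val e e' n X"
    if Xw: "(X, w) \<in> set (input_prods n @ base_prods e e')" for X w
  proof (cases "(X, w) \<in> set (prods e @ prods e')")
    case True
    then show ?thesis
      using prods_sound[of X w e e e' n] prods_sound[of X w e' e e' n] by auto
  next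
    case False
    have "form_lang (lexp_val e e' n) (replicate n (Inl 4)) = {replicate k (Letter 1) | k. k \<le> n}"
      by (rule form_lang_replicate) (simp add: lexp_val_def)
    moreover have
      "form_lang (lexp_val e e' n) (replicate n (Inr (Letter 1))) = {replicate n (Letter 1)}"
      by (rule form_lang_replicate_word)
    moreover have "lexp_val e e' n 0 = lang n e" "lexp_val e e' n 1 = lang n e'"
      "lexp_val e e' n 2 = {replicate k (Letter 1) | k. k \<le> n}"
      "lexp_val e e' n 3 = {replicate n (Letter 1)}" "lexp_val e e' n 4 = {[], [Letter 1]}"
      by (auto simp: lexp_val_def)
    ultimately show ?thesis
      using Xw False
      by (auto simp: input_prods_def base_prods_def simp del: nonterm.simps One_nat_def)
  qed
  then have "cfg_lang (lexp_cfg s e e' n) \<subseteq> lexp_val e e' n (start (lexp_cfg s e e' n))"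
    by (intro cfg_sound) (simp add: lexp_cfg_def)
  then show ?thesis by (simp add: lexp_cfg_def)
qed

lemma derives_Hole:
  assumes "set (input_prods n) \<subseteq> set (productions G)"
    "(4, [Inr (Letter 1)]) \<in> set (productions G)" "(4, []) \<in> set (productions G)"
    "w \<in> lang n (Hole b)"
  shows "([Inl (nonterm (Hole b))], map Inr w) \<in> (cfg_step G)\<^sup>*"
proof (cases b)
  case True
  then show ?thesis using assms(1,4)
    by (intro derives_prod[where r = "replicate n (Inr (Letter 1))"]) (auto simp: input_prods_def)
next
  case False
  with assms(4) obtain k where k: "k \<le> n" "w = replicate k (Letter 1)" by auto
  have eps: "([Inl 4], []) \<in> (cfg_step G)\<^sup>*" by (rule derives_prod[OF assms(3)]) simp
  have one: "([Inl 4], [Inr (Letter 1)]) \<in> (cfg_step G)\<^sup>*"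
    by (rule derives_prod[OF assms(2)]) simp
  have "(replicate m (Inl 4), []) \<in> (cfg_step G)\<^sup>*" for m
    by (induction m) (use derives_Cons[OF eps] in auto)
  moreover have "(replicate k (Inl 4), replicate k (Inr (Letter 1))) \<in> (cfg_step G)\<^sup>*"
    by (induction k) (use derives_Cons[OF one] in auto)
  \<comment> \<open>Of the \<open>n\<close> copies of the nonterminal 4, the first \<open>k\<close>
    produce one tally each and the other \<open>n - k\<close> are erased.\<close>
  ultimately have "(replicate k (Inl 4) @ replicate (n - k) (Inl 4),
      replicate k (Inr (Letter 1)) @ []) \<in> (cfg_step G)\<^sup>*"
    by (intro derives_append)
  then have "(replicate n (Inl 4), map Inr w) \<in> (cfg_step G)\<^sup>*"
    using k by (simp add: replicate_add[symmetric])
  then show ?thesis using assms(1) False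
    by (intro derives_prod[where r = "replicate n (Inl 4)"]) (auto simp: input_prods_def)
qed

lemma derives_lexp:
  assumes "set (input_prods n) \<subseteq> set (productions G)"
    "(4, [Inr (Letter 1)]) \<in> set (productions G)" "(4, []) \<in> set (productions G)"
  shows "set (prods a) \<subseteq> set (productions G) \<Longrightarrow> w \<in> lang n a \<Longrightarrow>
    ([Inl (nonterm a)], map Inr w) \<in> (cfg_step G)\<^sup>*"
proof (induction a arbitrary: w)
  case (Word v)
  then show ?case by (auto intro: derives_prod)
next
  case (Alt a b)
  then show ?case
    by (auto simp del: nonterm.simps intro: derives_prod)
next
  case (Cat a b)
  then obtain u v where "w = u @ v" "u \<in> lang n a" "v \<in> lang n b" by (auto simp: conc_def)
  with Cat have "([Inl (nonterm a)] @ [Inl (nonterm b)], map Inr u @ map Inr v)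
      \<in> (cfg_step G)\<^sup>*"
    by (intro derives_append) auto
  with Cat.prems \<open>w = u @ v\<close> show ?case
    by (auto simp del: nonterm.simps intro: derives_prod)
next
  case (Lin a p q)
  from Lin.prems(2) have "w \<in> lin (lang n a) (lang n p) (lang n q)" by simp
  then show ?case
  proof induction
    case (base x)
    with Lin.IH(1)[of x] Lin.prems(1) show ?case
      by (auto simp del: nonterm.simps intro: derives_prod)
  next
    case (step u x v)
    have "([Inl (nonterm p)], map Inr u) \<in> (cfg_step G)\<^sup>*"
      "([Inl (nonterm q)], map Inr v) \<in> (cfg_step G)\<^sup>*"
      using Lin.IH(2)[of u] Lin.IH(3)[of v] Lin.prems(1) step.hyps by auto
    then have "([Inl (nonterm p)] @ [Inl (nonterm (Lin a p q))] @ [Inl (nonterm q)],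
      map Inr u @ map Inr x @ map Inr v) \<in> (cfg_step G)\<^sup>*"
      by (intro derives_append step.IH)
    with Lin.prems(1) show ?case
      by (auto simp del: nonterm.simps intro: derives_prod)
  qed
next
  case (Mirror a)
  from Mirror.prems(2) obtain u x where
    w: "w = u @ x @ rev u" "u \<in> lists (set ltrs)" "x \<in> lang n a" by auto
  from w(2) have "([Inl (nonterm (Mirror a))], map Inr (u @ x @ rev u)) \<in> (cfg_step G)\<^sup>*"
  proof induction
    case Nil
    with Mirror.IH[of x] Mirror.prems(1) w(3) show ?case
      by (auto simp del: nonterm.simps intro: derives_prod)
  next
    case (Cons c u)
    have "([Inr c] @ [Inl (nonterm (Mirror a))] @ [Inr c],
      [Inr c] @ map Inr (u @ x @ rev u) @ [Inr c]) \<in> (cfg_step G)\<^sup>*"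
      by (intro derives_append Cons.IH) auto
    moreover have "(nonterm (Mirror a), [Inr c, Inl (nonterm (Mirror a)), Inr c])
        \<in> set (productions G)"
      using Mirror.prems(1) Cons.hyps(1) by (auto simp del: nonterm.simps)
    ultimately show ?case by (simp add: derives_prod del: nonterm.simps)
  qed
  then show ?case using w(1) by simp
next
  case (Hole b)
  with derives_Hole[OF assms] show ?case by blast
qed

theorem lexp_cfg_lang:
  "cfg_lang (lexp_cfg 0 e e' n) = lang n e" "cfg_lang (lexp_cfg 1 e e' n) = lang n e'"
proof -
  have *: "([Inl (nonterm a)], map Inr w) \<in> (cfg_step (lexp_cfg s e e' n))\<^sup>*"
    if "a = e \<or> a = e'" "w \<in> lang n a" for a w s
    by (rule derives_lexp[OF _ _ _ _ that(2)])
       (use that(1) in \<open>auto simp: lexp_cfg_def base_prods_def\<close>)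
  have "lang n e \<subseteq> cfg_lang (lexp_cfg 0 e e' n)" "lang n e' \<subseteq> cfg_lang (lexp_cfg 1 e e' n)"
    unfolding cfg_lang_def
    using derives_prod[OF _ *[of e _ 0], of 0] derives_prod[OF _ *[of e' _ 1], of 1]
    by (auto simp: lexp_cfg_def base_prods_def simp del: nonterm.simps)
  then show "cfg_lang (lexp_cfg 0 e e' n) = lang n e"
    "cfg_lang (lexp_cfg 1 e e' n) = lang n e'"
    using lexp_cfg_sound[of 0 e e' n] lexp_cfg_sound[of 1 e e' n] by (auto simp: lexp_val_def)
qed

section \<open>Languages of lists of natural numbers\<close>

definition tally :: "nat \<Rightarrow> nat msym list" where
  "tally x = replicate x (Letter 1) @ [Letter 0]"

definition tallies :: "nat list \<Rightarrow> nat msym list" where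
  "tallies ns = concat (map tally ns)"

lemma tallies_simps [simp]: "tallies [] = []" "tallies (x # xs) = tally x @ tallies xs" "tallies (xs @ ys) = tallies xs @ tallies ys"
  by (simp_all add: tallies_def)

lemma tally_append_eq: "tally x @ u = tally y @ v \<Longrightarrow> x = y \<and> u = v"
proof (induction x arbitrary: y)
  case 0
  then show ?case by (cases y) (auto simp: tally_def)
next
  case (Suc x)
  then show ?case by (cases y) (auto simp: tally_def)
qed

lemma inj_tallies: "inj tallies"
proof (rule injI)
  show "tallies xs = tallies ys \<Longrightarrow> xs = ys" for xs ys
  proof (induction xs arbitrary: ys)
    case Nil
    then show ?case by (cases ys) (auto simp: tally_def)
  next
    case (Cons x xs)
    then obtain y zs where "ys = y # zs" by (cases ys) (auto simp: tally_def)
    with Cons tally_append_eq[of x "tallies xs" y "tallies zs"] show ?case by auto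
  qed
qed

lemma set_tallies: "set (tallies ns) \<subseteq> {Letter 0, Letter 1}"
  by (induction ns) (auto simp: tally_def)

text \<open>\<open>tallies\<close> is a homomorphism for concatenation, so languages of lists can be
  combined before they are encoded.\<close>

lemma tallies_conc: "tallies ` (A \<cdot> B) = tallies ` A \<cdot> tallies ` B"
proof (intro equalityI subsetI)
  fix w assume "w \<in> tallies ` (A \<cdot> B)"
  then obtain u v where "w = tallies u @ tallies v" "u \<in> A" "v \<in> B" by (auto simp: conc_def)
  then show "w \<in> tallies ` A \<cdot> tallies ` B" by (simp add: concI)
next
  fix w assume "w \<in> tallies ` A \<cdot> tallies ` B"
  then obtain u v where "w = tallies (u @ v)" "u \<in> A" "v \<in> B" by (auto simp: conc_def)
  then show "w \<in> tallies ` (A \<cdot> B)" by (simp only:) (intro imageI concI)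
qed

lemma tallies_lin: "tallies ` lin A P Q = lin (tallies ` A) (tallies ` P) (tallies ` Q)"
proof (intro equalityI subsetI)
  fix w assume "w \<in> tallies ` lin A P Q"
  then obtain x where "x \<in> lin A P Q" "w = tallies x" by blast
  then show "w \<in> lin (tallies ` A) (tallies ` P) (tallies ` Q)"
  proof (induction arbitrary: w)
    case (step p x q)
    then show ?case
      using lin.step[of "tallies p" "tallies ` P" "tallies x" "tallies ` A" "tallies ` Q" "tallies q"] by simp
  qed (auto intro: lin.base)
next
  fix w assume "w \<in> lin (tallies ` A) (tallies ` P) (tallies ` Q)"
  then show "w \<in> tallies ` lin A P Q"
  proof induction
    case (step p x q)
    then obtain p' x' q' where
      "p' \<in> P" "x' \<in> lin A P Q" "q' \<in> Q" "p @ x @ q = tallies (p' @ x' @ q')" by auto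
    then show ?case by (simp only:) (intro imageI lin.step)
  qed (auto intro: lin.base)
qed

text \<open>Excluding \<open>Hole\<close> makes the language independent of \<open>n\<close>;
  without \<open>Hole\<close> and \<open>Mirror\<close>, \<open>ins_lexp\<close> is able to insert
  the marker.\<close>

primrec bits :: "lexp \<Rightarrow> bool" where
  "bits (Word w) \<longleftrightarrow> set w \<subseteq> {Letter 0, Letter 1}"
| "bits (Alt a b) \<longleftrightarrow> bits a \<and> bits b"
| "bits (Cat a b) \<longleftrightarrow> bits a \<and> bits b"
| "bits (Lin a p q) \<longleftrightarrow> bits a \<and> bits p \<and> bits q"
| "bits (Mirror a) \<longleftrightarrow> False"
| "bits (Hole b) \<longleftrightarrow> False"

text \<open>Every expression denotes a non-empty language, so the empty set never qualifies. This
  explains why some constructions below enlarge a given language instead of producing a possibly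
  empty one.\<close>

definition cf_lists :: "nat list set \<Rightarrow> bool" where
  "cf_lists L \<longleftrightarrow> (\<exists>e. bits e \<and> (\<forall>n. lang n e = tallies ` L))"

lemma cf_lists_single: "cf_lists {ns}"
  unfolding cf_lists_def using set_tallies by (intro exI[of _ "Word (tallies ns)"]) simp

lemma cf_listsI: "bits e \<Longrightarrow> (\<And>n. lang n e = tallies ` L) \<Longrightarrow> cf_lists L"
  by (auto simp: cf_lists_def)

lemma cf_lists_Un: assumes "cf_lists A" "cf_lists B" shows "cf_lists (A \<union> B)"
proof -
  obtain a where a: "bits a" "\<forall>n. lang n a = tallies ` A"
    using assms(1) unfolding cf_lists_def by blast
  obtain b where b: "bits b" "\<forall>n. lang n b = tallies ` B"
    using assms(2) unfolding cf_lists_def by blast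
  show ?thesis by (rule cf_listsI[of "Alt a b"]) (simp_all add: a b image_Un)
qed

lemma cf_lists_conc: assumes "cf_lists A" "cf_lists B" shows "cf_lists (A \<cdot> B)"
proof -
  obtain a where a: "bits a" "\<forall>n. lang n a = tallies ` A"
    using assms(1) unfolding cf_lists_def by blast
  obtain b where b: "bits b" "\<forall>n. lang n b = tallies ` B"
    using assms(2) unfolding cf_lists_def by blast
  show ?thesis by (rule cf_listsI[of "Cat a b"]) (simp_all add: a b tallies_conc)
qed

lemma cf_lists_lin: assumes "cf_lists A" "cf_lists P" "cf_lists Q" shows "cf_lists (lin A P Q)"
proof -
  obtain a where a: "bits a" "\<forall>n. lang n a = tallies ` A"
    using assms(1) unfolding cf_lists_def by blast
  obtain p where p: "bits p" "\<forall>n. lang n p = tallies ` P"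
    using assms(2) unfolding cf_lists_def by blast
  obtain q where q: "bits q" "\<forall>n. lang n q = tallies ` Q"
    using assms(3) unfolding cf_lists_def by blast
  show ?thesis by (rule cf_listsI[of "Lin a p q"]) (simp_all add: a p q tallies_lin)
qed

definition ones :: lexp where
  "ones = Lin (Word []) (Word [Letter 1]) (Word [])"

section \<open>Context-free comparison of unary numbers\<close>

lemma lin_singletons: "lin A {[c]} {[d]} = {replicate k c @ a @ replicate k d | k a. a \<in> A}"
proof (intro equalityI subsetI)
  fix w assume "w \<in> lin A {[c]} {[d]}"
  then show "w \<in> {replicate k c @ a @ replicate k d | k a. a \<in> A}"
  proof induction
    case (base x)
    then have "x = replicate 0 c @ x @ replicate 0 d" by simp
    with base show ?case by blast
  next
    case (step p x q)
    then obtain k a where "x = replicate k c @ a @ replicate k d" "a \<in> A" by blast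
    moreover from this step have
      "p @ x @ q = replicate (Suc k) c @ a @ replicate (Suc k) d"
      by (simp add: replicate_append_same)
    ultimately show ?case by blast
  qed
next
  fix w assume "w \<in> {replicate k c @ a @ replicate k d | k a. a \<in> A}"
  then obtain k a where a: "a \<in> A" and "w = replicate k c @ a @ replicate k d" by blast
  then show "w \<in> lin A {[c]} {[d]}"
  proof (induction k arbitrary: w)
    case (Suc k)
    then have "replicate k c @ a @ replicate k d \<in> lin A {[c]} {[d]}" by blast
    then have "[c] @ (replicate k c @ a @ replicate k d) @ [d] \<in> lin A {[c]} {[d]}"
      by (rule lin.step[rotated]) auto
    moreover have "w = [c] @ (replicate k c @ a @ replicate k d) @ [d]"
      using Suc.prems by (simp add: replicate_append_same)
    ultimately show ?case by (simp only:)
  qed (auto intro: lin.base)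
qed

lemma lin_star: "lin {[]} {[c]} {[]} = range (\<lambda>k. replicate k c)"
proof (intro equalityI subsetI)
  fix w assume "w \<in> lin {[]} {[c]} {[]}"
  then show "w \<in> range (\<lambda>k. replicate k c)"
  proof induction
    case (step p x q)
    then obtain k where "p @ x @ q = replicate (Suc k) c" by auto
    then show ?case by blast
  qed (auto intro: image_eqI[of _ _ 0])
next
  fix w assume "w \<in> range (\<lambda>k. replicate k c)"
  then obtain k where "w = replicate k c" by blast
  then show "w \<in> lin {[]} {[c]} {[]}"
  proof (induction k arbitrary: w)
    case (Suc k)
    then have "[c] @ replicate k c @ [] \<in> lin {[]} {[c]} {[]}"
      by (intro lin.step) auto
    with Suc.prems show ?case by simp
  qed (auto intro: lin.base)
qed

lemma ones [simp]: "bits ones" "lang n ones = range (\<lambda>k. replicate k (Letter 1))"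
  by (simp_all add: ones_def lin_star)

lemma cf_lists_block: "cf_lists {[x] | x. True}"
  unfolding cf_lists_def
  by (rule exI[of _ "Cat ones (Word [Letter 0])"]) (auto simp: conc_def tally_def image_def)

lemma cf_lists_pos_block: "cf_lists {[x] | x. x > 0}"
  unfolding cf_lists_def
proof (intro exI conjI allI)
  fix n
  have "{[x] | x :: nat. x > 0} = range (\<lambda>x. [Suc x])"
    by (auto simp: gr0_conv_Suc)
  then show "lang n (Cat (Word [Letter 1]) (Cat ones (Word [Letter 0]))) = tallies ` {[x] | x. x > 0}"
    by (auto simp: conc_def tally_def image_image)
qed simp

lemma cf_lists_length: "cf_lists {us. length us = N}"
proof (induction N)
  case 0
  then show ?case using cf_lists_single[of "[]"] by simp
next
  case (Suc N)
  have "{us. length us = Suc N} = {[x] | x. True} \<cdot> {us :: nat list. length us = N}"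
    by (auto simp: conc_def length_Suc_conv) (metis append_Cons append_Nil)
  then show ?case using cf_lists_conc[OF cf_lists_block Suc] by simp
qed

lemma cf_lists_UNIV: "cf_lists UNIV"
proof -
  have "us \<in> lin {[]} {[x :: nat] | x. True} {[]}" for us
  proof (induction us)
    case (Cons x us)
    then have "[x] @ us @ [] \<in> lin {[]} {[x :: nat] | x. True} {[]}"
      by (intro lin.step) auto
    then show ?case by simp
  qed (auto intro: lin.base)
  then have "lin {[]} {[x :: nat] | x. True} {[]} = UNIV" by blast
  with cf_lists_lin[OF cf_lists_single[of "[]"] cf_lists_block cf_lists_single[of "[]"]] show ?thesis by simp
qed

text \<open>Cancelling equally many tallies on both sides leaves a surplus on exactly one side.\<close>

lemma lin_unbalanced:
  "lin ({replicate (Suc j) c @ t | j t. t \<in> T} \<union> {t @ replicate (Suc j) c | j t. t \<in> T}) {[c]} {[c]}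
   = {replicate x c @ t @ replicate y c | x y t. x \<noteq> y \<and> t \<in> T}" (is "?L = ?R")
proof (intro equalityI subsetI)
  fix w assume "w \<in> ?L"
  then obtain k j t where t: "t \<in> T" and
    "w = replicate k c @ (replicate (Suc j) c @ t) @ replicate k c \<or>
     w = replicate k c @ (t @ replicate (Suc j) c) @ replicate k c"
    unfolding lin_singletons by blast
  then have "w = replicate (k + Suc j) c @ t @ replicate k c \<or>
     w = replicate k c @ t @ replicate (Suc j + k) c"
    by (simp only: replicate_add append_assoc)
  moreover have "k + Suc j \<noteq> k" "k \<noteq> Suc j + k" by auto
  ultimately show "w \<in> ?R" using t by blast
next
  fix w assume "w \<in> ?R"
  then obtain x y t where w: "w = replicate x c @ t @ replicate y c" "x \<noteq> y" "t \<in> T" by blast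
  show "w \<in> ?L"
  proof (cases "y < x")
    case True
    then obtain j where "x = y + Suc j" by (metis add_Suc_right less_iff_Suc_add)
    with w have "w = replicate y c @ (replicate (Suc j) c @ t) @ replicate y c"
      by (auto simp: replicate_add replicate_app_Cons_same replicate_append_same)
    with w(3) show ?thesis unfolding lin_singletons by blast
  next
    case False
    with w(2) obtain j where "y = Suc j + x"
      by (metis add.commute add_Suc_right less_iff_Suc_add nat_neq_iff)
    with w have "w = replicate x c @ (t @ replicate (Suc j) c) @ replicate x c"
      by (auto simp: replicate_add replicate_app_Cons_same replicate_append_same)
    with w(3) show ?thesis unfolding lin_singletons by blast
  qed
qed

text \<open>The letter 0 that closes the tally of \<open>x\<close> is moved to the middle part
  \<open>m\<close>. The word then has the shape of unequal blocks of 1 on both sides of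
  \<open>m\<close>, as in \<open>lin_unbalanced\<close>, followed by the 0 that closes the tally of
  \<open>y\<close>.\<close>

lemma cf_lists_neq:
  assumes "cf_lists T"
  shows "cf_lists {x # t @ [y] | x y t. x \<noteq> y \<and> t \<in> T}"
proof -
  obtain e where e: "bits e" "\<forall>n. lang n e = tallies ` T"
    using assms unfolding cf_lists_def by blast
  define m where "m = Cat (Word [Letter 0]) e"
  define p where "p = Cat (Word [Letter 1]) ones"
  define X where "X = Lin (Alt (Cat p m) (Cat m p)) (Word [Letter 1]) (Word [Letter 1])"
  have m: "lang n m = {Letter 0 # tallies t | t. t \<in> T}" for n by (auto simp: m_def e conc_def)
  have p: "lang n p = {replicate (Suc k) (Letter 1) | k. True}" for n
    by (auto simp: p_def conc_def)
  have "lang n X = {replicate x (Letter 1) @ t @ replicate y (Letter 1) | x y t.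
      x \<noteq> y \<and> t \<in> lang n m}" for n
  proof -
    have "lang n (Cat p m) = {replicate (Suc j) (Letter 1) @ t | j t. t \<in> lang n m}"
      "lang n (Cat m p) = {t @ replicate (Suc j) (Letter 1) | j t. t \<in> lang n m}"
      unfolding lang.simps p conc_def by blast+
    then show ?thesis using lin_unbalanced[of "Letter 1" "lang n m"] by (simp add: X_def)
  qed
  then have "lang n (Cat X (Word [Letter 0])) = tallies ` {x # t @ [y] | x y t. x \<noteq> y \<and> t \<in> T}" for n
  proof (intro equalityI subsetI)
    fix w assume X: "lang n X = {replicate x (Letter 1) @ t @ replicate y (Letter 1) | x y t.
      x \<noteq> y \<and> t \<in> lang n m}" for n
    {
      assume "w \<in> lang n (Cat X (Word [Letter 0]))"
      then obtain x y t where "w = tallies (x # t @ [y])" "x \<noteq> y" "t \<in> T"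
        by (auto simp: X m conc_def tally_def)
      then show "w \<in> tallies ` {x # t @ [y] | x y t. x \<noteq> y \<and> t \<in> T}" by blast
    next
      assume "w \<in> tallies ` {x # t @ [y] | x y t. x \<noteq> y \<and> t \<in> T}"
      then obtain x y t where "w = tallies (x # t @ [y])" "x \<noteq> y" "t \<in> T" by blast
      then have "w = (replicate x (Letter 1) @ (Letter 0 # tallies t) @ replicate y (Letter 1)) @ [Letter 0]"
        "Letter 0 # tallies t \<in> lang n m"
        by (auto simp: tally_def m)
      with \<open>x \<noteq> y\<close> show "w \<in> lang n (Cat X (Word [Letter 0]))"
        unfolding lang.simps X by (simp only:) (rule concI; blast)
    }
  qed
  moreover have "bits (Cat X (Word [Letter 0]))" using e by (simp add: X_def m_def p_def)
  ultimately show ?thesis by (intro cf_listsI)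
qed

text \<open>Cancelling tallies pairwise around the separating 0 leaves at least two tallies on the
  left, or none on the left and any number on the right. The excluded remainder, exactly one on the
  left, is the case \<open>a = Suc b\<close>.\<close>

lemma cf_lists_not_Suc: "cf_lists {[a, b] | a b. a \<noteq> Suc b}"
proof -
  define A where "A = Alt (Cat (Word [Letter 1, Letter 1]) (Cat ones (Word [Letter 0])))
    (Cat (Word [Letter 0]) ones)"
  define e where "e = Cat (Lin A (Word [Letter 1]) (Word [Letter 1])) (Word [Letter 0])"
  have A: "lang n A = {replicate (Suc (Suc j)) (Letter 1) @ [Letter 0] | j. True} \<union>
      {Letter 0 # replicate j (Letter 1) | j. True}" for n
    by (auto simp: A_def conc_def)
  have e: "lang n e = {w @ [Letter 0] | w. w \<in> lin (lang n A) {[Letter 1]} {[Letter 1]}}" for n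
    by (auto simp: e_def conc_def)
  have "lang n e = tallies ` {[a, b] | a b. a \<noteq> Suc b}" for n
  proof (intro equalityI subsetI)
    fix w assume "w \<in> lang n e"
    then obtain k a where "w = (replicate k (Letter 1) @ a @ replicate k (Letter 1)) @ [Letter 0]"
      "a \<in> lang n A"
      unfolding e lin_singletons by blast
    then obtain j where "w = replicate k (Letter 1) @
          (replicate (Suc (Suc j)) (Letter 1) @ [Letter 0]) @ replicate k (Letter 1) @ [Letter 0] \<or>
        w = replicate k (Letter 1) @ (Letter 0 # replicate j (Letter 1)) @ replicate k (Letter 1)
          @ [Letter 0]"
      unfolding A by auto
    then have "w = tallies [k + Suc (Suc j), k] \<or> w = tallies [k, j + k]"
      by (auto simp: tally_def replicate_add replicate_app_Cons_same replicate_append_same)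
    moreover have "k + Suc (Suc j) \<noteq> Suc k" "k \<noteq> Suc (j + k)" by auto
    ultimately show "w \<in> tallies ` {[a, b] | a b. a \<noteq> Suc b}" by blast
  next
    fix w assume "w \<in> tallies ` {[a, b] | a b. a \<noteq> Suc b}"
    then obtain a b where w: "w = tallies [a, b]" "a \<noteq> Suc b" by blast
    show "w \<in> lang n e"
    proof (cases "Suc b < a")
      case True
      then obtain j where "a = b + Suc (Suc j)"
        using less_imp_Suc_add[of "Suc b" a] by auto
      with w have "w = (replicate b (Letter 1) @ (replicate (Suc (Suc j)) (Letter 1) @ [Letter 0])
          @ replicate b (Letter 1)) @ [Letter 0]"
        by (auto simp: tally_def replicate_add replicate_app_Cons_same replicate_append_same)
      then show ?thesis unfolding e lin_singletons A by blast
    next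
      case False
      with w(2) obtain j where "b = j + a" using le_Suc_ex[of a b] by auto
      with w have "w = (replicate a (Letter 1) @ (Letter 0 # replicate j (Letter 1))
          @ replicate a (Letter 1)) @ [Letter 0]"
        by (auto simp: tally_def replicate_add replicate_app_Cons_same replicate_append_same)
      then show ?thesis unfolding e lin_singletons A by blast
    qed
  qed
  moreover have "bits e" by (simp add: e_def A_def)
  ultimately show ?thesis by (intro cf_listsI)
qed

section \<open>Certifiable relations\<close>

text \<open>Certificates are concatenated without separators; this property makes the decomposition
  unique.\<close>

definition prefix_code :: "'a list set \<Rightarrow> bool" where
  "prefix_code J \<longleftrightarrow> (\<forall>u\<in>J. \<forall>u'\<in>J. \<forall>v v'. u @ v = u' @ v' \<longrightarrow> u = u')"

lemma prefix_codeD: "prefix_code J \<Longrightarrow> u @ v = u' @ v' \<Longrightarrow> u \<in> J \<Longrightarrow> u' \<in> J \<Longrightarrow> u = u' \<and> v = v'"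
  unfolding prefix_code_def by (metis same_append_eq)

definition right_ideal :: "'a list set \<Rightarrow> bool" where
  "right_ideal K \<longleftrightarrow> (\<forall>w\<in>K. \<forall>v. w @ v \<in> K)"

lemma right_idealD: "right_ideal K \<Longrightarrow> w \<in> K \<Longrightarrow> w @ v \<in> K"
  by (simp add: right_ideal_def)

text \<open>The last condition makes the verdict on a well-formed certificate stable: text that
  follows it cannot make it faulty. Together with prefix-freeness this permits certificates inside
  larger certificates. The length bound leaves room for the tag and \<open>m\<close>
  arguments.\<close>

definition checker :: "nat \<Rightarrow> nat list set \<Rightarrow> nat list set \<Rightarrow> bool" where
  "checker m J K \<longleftrightarrow> cf_lists J \<and> cf_lists K \<and> prefix_code J \<and> right_ideal K \<and>
     (\<forall>t\<in>J. m < length t \<and> (\<forall>w. t @ w \<in> K \<longrightarrow> t \<in> K))"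

text \<open>
  A certificate is a list consisting of a tag, the arguments and evidence. Well-formed ones
  constitute \<open>J\<close> and faulty ones are recognised by \<open>K\<close>, so that no complements are needed. Since
  \<open>K\<close> is a right ideal, a grammar for it need not generate the structure that follows an error.
\<close>

definition certifiable :: "nat \<Rightarrow> nat list set \<Rightarrow> bool" where
  "certifiable m R \<longleftrightarrow>
     (\<exists>J K. checker m J K \<and>
        (\<forall>zs. length zs = m \<longrightarrow> (zs \<in> R \<longleftrightarrow> (\<exists>g c. g # zs @ c \<in> J - K))))"

lemma certifiable_cong:
  "certifiable m R \<Longrightarrow> (\<And>zs. length zs = m \<Longrightarrow> zs \<in> R \<longleftrightarrow> zs \<in> R') \<Longrightarrow> certifiable m R'"
  unfolding certifiable_def by (elim exE) (intro exI, auto)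

text \<open>The same two languages serve: the last \<open>k\<close> arguments are reread as the
  beginning of the evidence.\<close>

lemma certifiable_proj:
  assumes "certifiable (m + k) R"
  shows "certifiable m {zs. \<exists>ys. length ys = k \<and> zs @ ys \<in> R}"
proof -
  obtain J K where JK: "checker (m + k) J K"
    "\<And>zs. length zs = m + k \<Longrightarrow> zs \<in> R \<longleftrightarrow> (\<exists>g c. g # zs @ c \<in> J - K)"
    using assms unfolding certifiable_def by blast
  have "(\<exists>ys. length ys = k \<and> zs @ ys \<in> R) \<longleftrightarrow> (\<exists>g c. g # zs @ c \<in> J - K)"
    if "length zs = m" for zs
  proof
    assume "\<exists>ys. length ys = k \<and> zs @ ys \<in> R"
    then show "\<exists>g c. g # zs @ c \<in> J - K" using JK(2) that by force
  next
    assume "\<exists>g c. g # zs @ c \<in> J - K"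
    then obtain g c where gc: "g # zs @ c \<in> J - K" by blast
    with JK(1) that have "k \<le> length c" unfolding checker_def by force
    then have "g # (zs @ take k c) @ drop k c \<in> J - K" and l: "length (take k c) = k"
      using gc by auto
    then have "zs @ take k c \<in> R"
      using JK(2)[of "zs @ take k c"] that by (simp only: length_append) blast
    with l show "\<exists>ys. length ys = k \<and> zs @ ys \<in> R" by blast
  qed
  moreover have "checker m J K" using JK(1) unfolding checker_def by force
  ultimately show ?thesis unfolding certifiable_def by blast
qed

section \<open>Argument frames and the detection of mismatched arguments\<close>

lemma frame_conc:
  "{g # us @ t | us t. length us = N \<and> t \<in> T} = {[g]} \<cdot> {us. length us = N} \<cdot> T"
  (is "?L = ?R")
proof (intro equalityI subsetI)
  fix z assume "z \<in> ?L"
  then obtain us t where z: "z = [g] @ us @ t" "length us = N" "t \<in> T" by auto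
  show "z \<in> ?R" unfolding z(1) by (rule concI[OF singletonI concI[OF _ z(3)]]) (simp add: z(2))
next
  fix z assume "z \<in> ?R"
  then obtain us t where "z = g # us @ t" "length us = N" "t \<in> T" by (auto elim!: concE)
  then show "z \<in> ?L" by blast
qed

lemma frame_conc2:
  "{g # us @ t @ w | us t w. length us = N \<and> t \<in> T \<and> w \<in> K} =
    {[g]} \<cdot> {us. length us = N} \<cdot> T \<cdot> K"
  using frame_conc[of g N "T \<cdot> K"] by (auto simp: conc_def)

text \<open>The length \<open>N\<close> determines where the arguments end, so only the remainder
  \<open>z\<close> can be split in several ways.\<close>

lemma frame_mem:
  assumes "length us = N"
  shows "h # us @ z \<in> {g # us @ t @ w | us t w. length us = N \<and> t \<in> T \<and> Q us w} \<longleftrightarrow>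
    h = g \<and> (\<exists>t\<in>T. \<exists>w. z = t @ w \<and> Q us w)"
proof
  assume "h # us @ z \<in> {g # us @ t @ w | us t w. length us = N \<and> t \<in> T \<and> Q us w}"
  then obtain us' t w where
    *: "h = g" "us @ z = us' @ t @ w" "length us' = N" "t \<in> T" "Q us' w" by auto
  then have "us' = us" "z = t @ w" using assms by auto
  with * show "h = g \<and> (\<exists>t\<in>T. \<exists>w. z = t @ w \<and> Q us w)" by blast
qed (use assms in blast)

text \<open>
  Here \<open>w\<close> is meant to be a certificate for the arguments \<open>map ((!) us) as\<close>, which start at position 1
  because of the tag.
\<close>

definition mismatch :: "nat list \<Rightarrow> nat list \<Rightarrow> nat list \<Rightarrow> bool" where
  "mismatch as us w \<longleftrightarrow> (\<exists>j<length as. Suc j < length w \<and> w ! Suc j \<noteq> us ! (as ! j))"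

definition faulty :: "nat list \<Rightarrow> nat list set \<Rightarrow> nat list \<Rightarrow> nat list \<Rightarrow> bool" where
  "faulty as K us w \<longleftrightarrow> w \<in> K \<or> mismatch as us w"

lemma mismatch_append: "length as < length t \<Longrightarrow> mismatch as us (t @ w) \<longleftrightarrow> mismatch as us t"
  unfolding mismatch_def by (intro ex_cong) (auto simp: nth_append)

lemma mismatch_ext: "mismatch as us w \<Longrightarrow> mismatch as us (w @ v)"
  unfolding mismatch_def by (auto simp: nth_append)

lemma not_mismatch_iff:
  assumes "length as < length t"
  shows "\<not> mismatch as us t \<longleftrightarrow> (\<exists>g c. t = g # map ((!) us) as @ c)"
proof
  assume n: "\<not> mismatch as us t"
  have "take (length as) (tl t) = map ((!) us) as"
    by (rule nth_equalityI) (use assms n in \<open>auto simp: mismatch_def nth_tl\<close>)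
  then have "t = hd t # map ((!) us) as @ drop (length as) (tl t)"
    using assms by (metis append_take_drop_id length_greater_0_conv less_nat_zero_code
        list.collapse list.size(3))
  then show "\<exists>g c. t = g # map ((!) us) as @ c" by blast
qed (auto simp: mismatch_def nth_append)

text \<open>For fixed positions this is one inequality between two entries of the list, to which
  \<open>cf_lists_neq\<close> applies.\<close>

lemma cf_lists_mismatch_single:
  assumes "cf_lists T" "i < N"
  shows "cf_lists {g # us @ t @ w | us t w. length us = N \<and> t \<in> T \<and> j < length w \<and> w ! j \<noteq> us ! i}"
proof -
  \<comment> \<open>\<open>M\<close> is what lies strictly between the two compared numbers: the
    arguments after position \<open>i\<close>, a word of \<open>T\<close>, and the first
    \<open>j\<close> entries of \<open>w\<close>.\<close>
  define M where "M = {b. length b = N - Suc i} \<cdot> T \<cdot> {p. length p = j}"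
  have M: "cf_lists M" by (simp add: M_def cf_lists_conc cf_lists_length assms(1))
  define E where "E = {x # t @ [y] | x y t. x \<noteq> y \<and> t \<in> M}"
  have "cf_lists ({[g]} \<cdot> {a. length a = i} \<cdot> E \<cdot> UNIV)"
    by (intro cf_lists_conc cf_lists_single cf_lists_length cf_lists_UNIV) (simp add: E_def cf_lists_neq M)
  also have "{[g]} \<cdot> {a. length a = i} \<cdot> E \<cdot> UNIV =
    {g # us @ t @ w | us t w. length us = N \<and> t \<in> T \<and> j < length w \<and> w ! j \<noteq> us ! i}"
    (is "?L = ?R")
  proof (intro equalityI subsetI)
    fix z assume "z \<in> ?L"
    then obtain a e s where aes: "z = [g] @ a @ e @ s" "length a = i" "e \<in> E"
      by (auto elim!: concE)
    then obtain x m y where xmy: "e = x # m @ [y]" "x \<noteq> y" "m \<in> M"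
      unfolding E_def by blast
    then obtain b t p where "m = b @ t @ p" "length b = N - Suc i" "t \<in> T" "length p = j"
      unfolding M_def by (auto elim!: concE)
    note z = aes(1,2) xmy(1,2) this
    then have "z = g # (a @ x # b) @ t @ (p @ y # s)" "length (a @ x # b) = N"
      "j < length (p @ y # s)" "(p @ y # s) ! j \<noteq> (a @ x # b) ! i"
      using assms(2) by (auto simp: nth_append)
    with z(7) show "z \<in> ?R" by blast
  next
    fix z assume "z \<in> ?R"
    then obtain us t w where z: "z = g # us @ t @ w" "length us = N" "t \<in> T" "j < length w"
      "w ! j \<noteq> us ! i" by blast
    define m where "m = drop (Suc i) us @ t @ take j w"
    have "length (drop (Suc i) us) = N - Suc i" "length (take j w) = j" using z by auto
    then have m: "m \<in> M" unfolding M_def m_def using z(3) by (intro concI) auto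
    have "us ! i # m @ [w ! j] \<in> E"
      unfolding E_def by (intro CollectI exI conjI, rule refl) (use m z(5) in auto)
    moreover have "take i us \<in> {a. length a = i}" using z(2) assms(2) by simp
    ultimately have "[g] @ take i us @ (us ! i # m @ [w ! j]) @ drop (Suc j) w \<in> ?L"
      by (intro concI[OF singletonI] concI[OF _ concI[OF _ UNIV_I]])
    also have "[g] @ take i us @ (us ! i # m @ [w ! j]) @ drop (Suc j) w =
      g # (take i us @ us ! i # drop (Suc i) us) @ t @ (take j w @ w ! j # drop (Suc j) w)"
      by (simp add: m_def)
    also have "\<dots> = z"
      using z(1,2,4) assms(2) id_take_nth_drop[of i us] id_take_nth_drop[of j w] by simp
    finally show "z \<in> ?L" .
  qed
  finally show ?thesis .
qed

text \<open>A finite union with one inequality for each position. It starts from \<open>B\<close>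
  because for empty \<open>as\<close> there is no mismatch at all, and the empty set is not covered
  by \<open>cf_lists\<close>.\<close>

lemma cf_lists_mismatch:
  assumes "cf_lists B" "cf_lists T" "set as \<subseteq> {..<N}"
  shows "cf_lists (B \<union> {g # us @ t @ w | us t w. length us = N \<and> t \<in> T \<and> mismatch as us w})"
proof -
  define F where "F j = {g # us @ t @ w | us t w.
    length us = N \<and> t \<in> T \<and> Suc j < length w \<and> w ! Suc j \<noteq> us ! (as ! j)}" for j
  have "n \<le> length as \<Longrightarrow> cf_lists (B \<union> (\<Union>j<n. F j))" for n
  proof (induction n)
    case (Suc n)
    then have "as ! n \<in> set as" by simp
    then have "as ! n < N" using assms(3) by blast
    then have "cf_lists (F n)" unfolding F_def using assms(2) by (rule cf_lists_mismatch_single[rotated])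
    with Suc have "cf_lists ((B \<union> (\<Union>j<n. F j)) \<union> F n)" by (simp add: cf_lists_Un[of "B \<union> _"])
    then show ?case by (simp add: lessThan_Suc Un_ac)
  qed (simp add: assms(1))
  then have "cf_lists (B \<union> (\<Union>j<length as. F j))" by blast
  also have "(\<Union>j<length as. F j) =
    {g # us @ t @ w | us t w. length us = N \<and> t \<in> T \<and> mismatch as us w}"
    unfolding F_def mismatch_def by blast
  finally show ?thesis .
qed

lemma cf_lists_faulty:
  assumes "cf_lists K" "cf_lists T" "set as \<subseteq> {..<N}"
  shows "cf_lists {g # us @ t @ w | us t w. length us = N \<and> t \<in> T \<and> faulty as K us w}"
proof -
  have "cf_lists {g # us @ t @ w | us t w. length us = N \<and> t \<in> T \<and> w \<in> K}"
    unfolding frame_conc2 using assms by (simp add: cf_lists_conc cf_lists_single cf_lists_length)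
  from cf_lists_mismatch[OF this assms(2,3)] show ?thesis
    by (rule back_subst[of cf_lists]) (auto simp: faulty_def)
qed

lemma faulty_append:
  assumes "right_ideal K" "length as < length t" "\<forall>w. t @ w \<in> K \<longrightarrow> t \<in> K"
  shows "faulty as K us (t @ w) \<longleftrightarrow> faulty as K us t"
  using assms mismatch_append[OF assms(2)] by (auto simp: faulty_def right_idealD)

lemma faulty_ext: "right_ideal K \<Longrightarrow> faulty as K us w \<Longrightarrow> faulty as K us (w @ v)"
  by (auto simp: faulty_def right_idealD mismatch_ext)

text \<open>Absence of a mismatch means that the certificate carries precisely the selected
  arguments, and absence from \<open>K\<close> that it is valid for them.\<close>

lemma ex_not_faulty_iff:
  assumes "\<forall>t\<in>J. length as < length t"
  shows "(\<exists>t\<in>J. \<not> faulty as K us t) \<longleftrightarrow> (\<exists>g c. g # map ((!) us) as @ c \<in> J - K)"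
  using assms not_mismatch_iff[of as _ us] unfolding faulty_def by blast

text \<open>The new certificate lists \<open>us\<close> and then one certificate for each conjunct.
  As the index lists may permute, repeat and omit positions, the lemma provides conjunction and
  substitution of variables at the same time.\<close>

lemma certifiable_query:
  assumes "certifiable m R" "certifiable m' R'" and len: "length as = m" "length bs = m'"
    and sub: "set as \<subseteq> {..<N}" "set bs \<subseteq> {..<N}"
  shows "certifiable N {us. map ((!) us) as \<in> R \<and> map ((!) us) bs \<in> R'}"
proof -
  obtain J K where JK: "checker (length as) J K"
    "\<And>zs. length zs = length as \<Longrightarrow> zs \<in> R \<longleftrightarrow> (\<exists>g c. g # zs @ c \<in> J - K)"
    using assms(1) unfolding len(1)[symmetric] certifiable_def by blast
  obtain J' K' where JK': "checker (length bs) J' K'"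
    "\<And>zs. length zs = length bs \<Longrightarrow> zs \<in> R' \<longleftrightarrow> (\<exists>g c. g # zs @ c \<in> J' - K')"
    using assms(2) unfolding len(2)[symmetric] certifiable_def by blast
  note c = JK(1)[unfolded checker_def] and c' = JK'(1)[unfolded checker_def]
  define G where "G = {0 # us @ t @ t' | us t t'. length us = N \<and> t \<in> J \<and> t' \<in> J'}"
  \<comment> \<open>A fault of the first subcertificate is sought right after the arguments, with
    arbitrary text behind it; a fault of the second one after a complete word of \<open>J\<close>
    has been skipped.\<close>
  define H where "H = {0 # us @ v @ w | us v w. length us = N \<and> v \<in> {[]} \<and> faulty as K us w} \<union>
    {0 # us @ t @ w | us t w. length us = N \<and> t \<in> J \<and> faulty bs K' us w}"
  have nlG: "cf_lists G" unfolding G_def frame_conc2 using c c' by (simp add: cf_lists_conc cf_lists_single cf_lists_length)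
  have nlH: "cf_lists H"
    unfolding H_def using c c' sub by (intro cf_lists_Un cf_lists_faulty cf_lists_single) auto
  have pc: "prefix_code G"
    unfolding prefix_code_def
  proof (intro ballI allI impI)
    fix u u' v v' assume "u \<in> G" "u' \<in> G" and e: "u @ v = u' @ v'"
    then obtain us t s us' t' s' where *: "u = 0 # us @ t @ s" "length us = N" "t \<in> J" "s \<in> J'"
      "u' = 0 # us' @ t' @ s'" "length us' = N" "t' \<in> J" "s' \<in> J'"
      unfolding G_def by blast
    with e have "us = us'" "t @ s @ v = t' @ s' @ v'" by auto
    with * c c' show "u = u'" using prefix_codeD by metis
  qed
  have mem: "0 # us @ z \<in> H \<longleftrightarrow>
      faulty as K us z \<or> (\<exists>t\<in>J. \<exists>w. z = t @ w \<and> faulty bs K' us w)"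
    if "length us = N" for us z
    unfolding H_def Un_iff frame_mem[OF that] by simp
  have iff: "0 # us @ t @ s @ w \<in> H \<longleftrightarrow> faulty as K us t \<or> faulty bs K' us s"
    if l: "length us = N" "t \<in> J" "s \<in> J'" for us t s w
  proof
    assume "0 # us @ t @ s @ w \<in> H"
    then consider "faulty as K us (t @ s @ w)"
      | t' w' where "t @ s @ w = t' @ w'" "t' \<in> J" "faulty bs K' us w'"
      unfolding mem[OF l(1)] by blast
    then show "faulty as K us t \<or> faulty bs K' us s"
    proof cases
      case 1
      then show ?thesis using faulty_append[of K as t us "s @ w"] c l by auto
    next
      case 2
      then have "w' = s @ w" using prefix_codeD[of J] c l by metis
      with 2 show ?thesis using faulty_append[of K' bs s us w] c' l by auto
    qed
  next
    assume "faulty as K us t \<or> faulty bs K' us s"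
    then have "faulty as K us (t @ s @ w) \<or> faulty bs K' us (s @ w)"
      using faulty_ext c c' by blast
    then show "0 # us @ t @ s @ w \<in> H"
      unfolding mem[OF l(1)] using l(2) by blast
  qed
  have ri: "right_ideal H"
    unfolding right_ideal_def
  proof (intro ballI allI)
    fix w v assume "w \<in> H"
    then obtain us t x where *: "w = 0 # us @ t @ x" "length us = N"
      "t = [] \<and> faulty as K us x \<or> t \<in> J \<and> faulty bs K' us x"
      unfolding H_def by blast
    then have "w @ v = 0 # us @ t @ (x @ v)"
      "t = [] \<and> faulty as K us (x @ v) \<or> t \<in> J \<and> faulty bs K' us (x @ v)"
      using faulty_ext c c' by auto
    with *(2) show "w @ v \<in> H" unfolding H_def by blast
  qed
  have "N < length t \<and> (\<forall>w. t @ w \<in> H \<longrightarrow> t \<in> H)" if "t \<in> G" for t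
  proof -
    from that obtain us u s where *: "t = 0 # us @ u @ s" "length us = N" "u \<in> J" "s \<in> J'"
      unfolding G_def by blast
    then show ?thesis using iff[OF *(2-4)] iff[OF *(2-4), of "[]"] by auto
  qed
  with nlG nlH pc ri have "checker N G H" unfolding checker_def by blast
  moreover have "us \<in> {us. map ((!) us) as \<in> R \<and> map ((!) us) bs \<in> R'} \<longleftrightarrow>
      (\<exists>g x. g # us @ x \<in> G - H)" if us: "length us = N" for us
  proof -
    have "(\<exists>g x. g # us @ x \<in> G - H) \<longleftrightarrow>
        (\<exists>t\<in>J. \<exists>s\<in>J'. \<not> faulty as K us t \<and> \<not> faulty bs K' us s)"
    proof
      assume "\<exists>g x. g # us @ x \<in> G - H"
      then obtain t s where "t \<in> J" "s \<in> J'" "0 # us @ t @ s \<notin> H"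
        using us unfolding G_def by auto
      then show "\<exists>t\<in>J. \<exists>s\<in>J'. \<not> faulty as K us t \<and> \<not> faulty bs K' us s"
        using iff[OF us, of t s "[]"] by auto
    next
      assume "\<exists>t\<in>J. \<exists>s\<in>J'. \<not> faulty as K us t \<and> \<not> faulty bs K' us s"
      then obtain t s where *: "t \<in> J" "s \<in> J'" "\<not> faulty as K us t" "\<not> faulty bs K' us s" by blast
      then have "0 # us @ t @ s \<in> G - H" using iff[OF us, of t s "[]"] us
        unfolding G_def by auto
      then show "\<exists>g x. g # us @ x \<in> G - H" by blast
    qed
    also have "\<dots> \<longleftrightarrow> (\<exists>t\<in>J. \<not> faulty as K us t) \<and> (\<exists>s\<in>J'. \<not> faulty bs K' us s)" by blast
    also have "\<dots> \<longleftrightarrow> map ((!) us) as \<in> R \<and> map ((!) us) bs \<in> R'"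
      using ex_not_faulty_iff[of J as K us] ex_not_faulty_iff[of J' bs K' us] c c' JK(2) JK'(2)
      by simp
    finally show ?thesis by simp
  qed
  ultimately show ?thesis unfolding certifiable_def by blast
qed

section \<open>Certificates for iteration\<close>

inductive_set reach :: "nat \<Rightarrow> nat \<Rightarrow> nat list \<Rightarrow> nat list set \<Rightarrow> nat list set \<Rightarrow> nat list set"
  for k m as B S where
  base: "length zs = k \<Longrightarrow> zs \<in> B \<Longrightarrow> zs \<in> reach k m as B S"
| step: "length zs = k \<Longrightarrow> length ys = m \<Longrightarrow> zs @ ys \<in> S \<Longrightarrow>
    map ((!) (zs @ ys)) as \<in> reach k m as B S \<Longrightarrow> zs \<in> reach k m as B S"

lemma map_nth_id: "length us = n \<Longrightarrow> map ((!) us) [0..<n] = us"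
  using map_nth by blast

text \<open>The fixed block length makes the outermost block of a word of \<open>lin\<close>
  recognisable: the word is in the core, or its first block can be stripped.\<close>

lemma lin_frame:
  assumes "length us = N"
  shows "h # us @ w \<in> lin A {g # us | us. length us = N} {[]} \<longleftrightarrow>
    h # us @ w \<in> A \<or> h = g \<and> w \<in> lin A {g # us | us. length us = N} {[]}" (is "?l \<longleftrightarrow> ?r")
proof
  assume ?l
  then show ?r
  proof (cases rule: lin.cases)
    case (step p x q)
    then obtain us' where "h = g" "us @ w = us' @ x" "length us' = N" by auto
    with step assms show ?thesis by auto
  qed simp
next
  assume ?r
  then show ?l
    using lin.step[of "g # us" "{g # us | us. length us = N}" w A "{[]}" "[]"] assms
    by (auto intro: lin.base)
qed

text \<open>A run is certified by nesting. A step consists of the tag 1, the state with its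
  auxiliary values, the certificate of the next state, and the evidence for the step; the innermost
  certificate has the tag 0 and is for \<open>B\<close>.\<close>

lemma certifiable_reach:
  assumes "certifiable k B" "certifiable (k + m) S" "length as = k" "set as \<subseteq> {..<k + m}"
  shows "certifiable k (reach k m as B S)"
proof -
  obtain JB KB where B: "checker k JB KB"
    "\<And>zs. length zs = k \<Longrightarrow> zs \<in> B \<longleftrightarrow> (\<exists>g c. g # zs @ c \<in> JB - KB)"
    using assms(1) unfolding certifiable_def by blast
  obtain JS KS where S: "checker (k + m) JS KS"
    "\<And>zs. length zs = k + m \<Longrightarrow> zs \<in> S \<longleftrightarrow> (\<exists>g c. g # zs @ c \<in> JS - KS)"
    using assms(2) unfolding certifiable_def by blast
  note b = B(1)[unfolded checker_def] and s = S(1)[unfolded checker_def]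
  define P where "P = {1 # us | us :: nat list. length us = k + m}"
  define G where "G = lin {0 # us @ t | us t. length us = k \<and> t \<in> JB} P JS"
  \<comment> \<open>A fault is reached by passing step frames: it lies in the base case, in the
    evidence of a step behind a complete \<open>q\<close>, or in a mismatch between consecutive
    states. The evidence closing the outer steps is not generated, whence \<open>{[]}\<close> as the
    last argument of \<open>lin\<close>.\<close>
  define H where "H = lin ({0 # us @ v @ w | us v w.
        length us = k \<and> v \<in> {[]} \<and> faulty [0..<k] KB us w} \<union>
      ({1 # us @ q @ w | us q w. length us = k + m \<and> q \<in> G \<and> faulty [0..<k + m] KS us w} \<union>
       {1 # us @ v @ w | us v w. length us = k + m \<and> v \<in> {[]} \<and> mismatch as us w})) P {[]}"
  have "P = {[1]} \<cdot> {us. length us = k + m}"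
    unfolding P_def by (auto elim!: concE intro: concI[of "[_]", simplified])
  then have nlP: "cf_lists P" by (simp add: cf_lists_conc cf_lists_single cf_lists_length)
  have nlG: "cf_lists G"
    unfolding G_def frame_conc using b s nlP by (simp add: cf_lists_lin cf_lists_conc cf_lists_single cf_lists_length)
  have nlH: "cf_lists H"
    unfolding H_def using b s nlP nlG assms(4)
    by (intro cf_lists_lin cf_lists_Un cf_lists_faulty cf_lists_mismatch cf_lists_single) auto
  have G_cases [consumes 1, case_names base step]: thesis
    if "q \<in> G" "\<And>us t. q = 0 # us @ t \<Longrightarrow> length us = k \<Longrightarrow> t \<in> JB \<Longrightarrow> thesis"
      "\<And>us q' t. q = 1 # us @ q' @ t \<Longrightarrow> length us = k + m \<Longrightarrow> q' \<in> G \<Longrightarrow> t \<in> JS \<Longrightarrow> thesis"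
    for q thesis
    using that(1) unfolding G_def
    by (cases rule: lin.cases) (use that(2,3) in \<open>auto simp: G_def P_def\<close>)
  have G0: "0 # us @ t \<in> G" if "length us = k" "t \<in> JB" for us t
    unfolding G_def using that by (intro lin.base) blast
  have G1: "1 # us @ q @ t \<in> G" if "length us = k + m" "q \<in> G" "t \<in> JS" for us q t
    using lin.step[of "1 # us" P q _ JS t] that unfolding G_def P_def by auto
  have G_induct [consumes 1, case_names base step]: "Q q"
    if "q \<in> G" "\<And>us t. length us = k \<Longrightarrow> t \<in> JB \<Longrightarrow> Q (0 # us @ t)"
      "\<And>us q t. length us = k + m \<Longrightarrow> q \<in> G \<Longrightarrow> Q q \<Longrightarrow> t \<in> JS \<Longrightarrow> Q (1 # us @ q @ t)"
    for q Q
    using that(1) unfolding G_def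
    by (induction rule: lin.induct) (use that(2,3) in \<open>auto simp: G_def P_def\<close>)
  have H0: "0 # us @ w \<in> H \<longleftrightarrow> faulty [0..<k] KB us w" if "length us = k" for us w
  proof -
    \<comment> \<open>Words of \<open>P\<close> begin with the tag 1, so a word with the tag 0 can
      only stem from the core.\<close>
    have "0 # us @ w \<in> lin A P {[]} \<longleftrightarrow> 0 # us @ w \<in> A" for A
      by (subst lin.simps) (auto simp: P_def)
    then show ?thesis unfolding H_def by (simp only: Un_iff frame_mem[OF that]) simp
  qed
  have H1: "1 # us @ w \<in> H \<longleftrightarrow>
      faulty as H us w \<or> (\<exists>q\<in>G. \<exists>x. w = q @ x \<and> faulty [0..<k + m] KS us x)"
    if "length us = k + m" for us w
  proof -
    have "1 # us @ w \<in> H \<longleftrightarrow> ((\<exists>q\<in>G. \<exists>x. w = q @ x \<and> faulty [0..<k + m] KS us x) \<or> mismatch as us w)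
      \<or> w \<in> H"
      unfolding H_def P_def lin_frame[OF that] Un_iff frame_mem[OF that]
      by simp
    then show ?thesis by (auto simp: faulty_def)
  qed
  have H_cases: thesis
    if "w \<in> H" "\<And>us x. w = 0 # us @ x \<Longrightarrow> length us = k \<Longrightarrow> thesis"
      "\<And>us x. w = 1 # us @ x \<Longrightarrow> length us = k + m \<Longrightarrow> thesis"
    for w thesis
    using that(1) unfolding H_def
    by (cases rule: lin.cases) (use that(2,3) in \<open>auto simp: P_def\<close>)
  have "u = u'" if "u \<in> G" "u' \<in> G" "u @ v = u' @ v'" for u u' v v'
    using that
  proof (induction arbitrary: u' v v' rule: G_induct)
    case (base us t)
    from base.prems(1) show ?case
    proof (cases rule: G_cases)
      case (base us' t')
      then have "us = us'" and e: "t @ v = t' @ v'"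
        using base.prems(2) \<open>length us = k\<close> by auto
      have "t = t'" using prefix_codeD[OF _ e] b \<open>t \<in> JB\<close> \<open>t' \<in> JB\<close> by blast
      then show ?thesis using base \<open>us = us'\<close> by simp
    qed (use base in auto)
  next
    case (step us q t)
    note IH = step.IH
    from step.prems(1) show ?case
    proof (cases rule: G_cases)
      case (step us' q' t')
      then have "us = us'" and e: "q @ t @ v = q' @ t' @ v'"
        using step.prems(2) \<open>length us = k + m\<close> by auto
      from e have "q = q'" by (rule IH[OF \<open>q' \<in> G\<close>])
      with e have e': "t @ v = t' @ v'" by simp
      have "t = t'" using prefix_codeD[OF _ e'] s \<open>t \<in> JS\<close> \<open>t' \<in> JS\<close> by blast
      then show ?thesis using step \<open>us = us'\<close> \<open>q = q'\<close> by simp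
    qed (use step in auto)
  qed
  then have pcG: "prefix_code G" unfolding prefix_code_def by blast
  have "w @ v \<in> H" if "w \<in> H" for w v
    using that unfolding H_def
  proof (induction rule: lin.induct)
    case (base x)
    then consider us w where "x = 0 # us @ w" "length us = k" "faulty [0..<k] KB us w"
      | us q w where "x = 1 # us @ q @ w" "length us = k + m" "q \<in> G" "faulty [0..<k + m] KS us w"
      | us w where "x = 1 # us @ w" "length us = k + m" "mismatch as us w"
      by auto
    then have "x @ v \<in> H"
    proof cases
      case 1
      then show ?thesis using H0[of us "w @ v"] faulty_ext b by auto
    next
      case 2
      have "faulty [0..<k + m] KS us (w @ v)" using faulty_ext[OF _ 2(4)] s by blast
      then have "1 # us @ (q @ w @ v) \<in> H" using H1[OF 2(2)] 2(3) by blast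
      then show ?thesis using 2(1) by simp
    next
      case 3
      then show ?thesis using H1[of us "w @ v"] mismatch_ext by (auto simp: faulty_def)
    qed
    then show ?case by (simp add: H_def)
  next
    case (step p x q)
    then show ?case using lin.step[of p P "x @ v" _ "{[]}" "[]"] by simp
  qed
  then have ri: "right_ideal H" unfolding right_ideal_def by blast
  have len: "k < length q" if "q \<in> G" for q
    using that by (cases rule: G_cases) auto
  have stable: "\<forall>w. t @ w \<in> H \<longrightarrow> t \<in> H" if "t \<in> G" for t
    using that
  proof (induction rule: G_induct)
    case (base us t)
    then show ?case using H0[of us] faulty_append[of KB "[0..<k]" t us] b by simp
  next
    case (step us q t)
    show ?case
    proof (intro allI impI)
      fix w assume "(1 # us @ q @ t) @ w \<in> H"
      then consider "faulty as H us (q @ t @ w)"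
        | q' x where "q' \<in> G" "q @ t @ w = q' @ x" "faulty [0..<k + m] KS us x"
        using H1[OF step.hyps(1), of "q @ t @ w"] by auto
      then show "1 # us @ q @ t \<in> H"
      proof cases
        case 1
        then have "faulty as H us q"
          using faulty_append[OF ri, of as q us "t @ w"] len[OF step.hyps(2)] assms(3) step.IH by simp
        then show ?thesis using H1[OF step.hyps(1)] faulty_ext[OF ri] by blast
      next
        case 2
        then have "x = t @ w" using prefix_codeD[OF pcG] step.hyps(2) by metis
        then have "faulty [0..<k + m] KS us t"
          using 2 faulty_append[of KS "[0..<k + m]" t us w] s step.hyps(3) by simp
        then show ?thesis using H1[OF step.hyps(1)] step.hyps(2) by blast
      qed
    qed
  qed
  have H1': "1 # us @ q @ t \<in> H \<longleftrightarrow> faulty as H us q \<or> faulty [0..<k + m] KS us t"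
    if l: "length us = k + m" "q \<in> G" "t \<in> JS" for us q t
  proof
    assume "1 # us @ q @ t \<in> H"
    then consider "faulty as H us (q @ t)"
      | q' x where "q' \<in> G" "q @ t = q' @ x" "faulty [0..<k + m] KS us x"
      using H1[OF l(1), of "q @ t"] by auto
    then show "faulty as H us q \<or> faulty [0..<k + m] KS us t"
    proof cases
      case 1
      then show ?thesis
        using faulty_append[OF ri, of as q us t] len[OF l(2)] assms(3) stable[OF l(2)] by simp
    next
      case 2
      then show ?thesis using prefix_codeD[OF pcG] l(2) by metis
    qed
  next
    assume "faulty as H us q \<or> faulty [0..<k + m] KS us t"
    then show "1 # us @ q @ t \<in> H" using H1[OF l(1)] faulty_ext[OF ri] l(2) by blast
  qed
  have B': "(\<exists>t\<in>JB. \<not> faulty [0..<k] KB us t) \<longleftrightarrow> us \<in> B" if "length us = k" for us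
    using ex_not_faulty_iff[of JB "[0..<k]" KB us] b B(2)[OF that] map_nth_id[OF that] by simp
  have S': "(\<exists>t\<in>JS. \<not> faulty [0..<k + m] KS us t) \<longleftrightarrow> us \<in> S" if "length us = k + m" for us
    using ex_not_faulty_iff[of JS "[0..<k + m]" KS us] s S(2)[OF that] map_nth_id[OF that] by simp
  have "checker k G H" unfolding checker_def using nlG nlH pcG ri len stable by blast
  moreover have "zs \<in> reach k m as B S \<longleftrightarrow> (\<exists>g c. g # zs @ c \<in> G - H)"
    if "length zs = k" for zs
  proof
    assume "zs \<in> reach k m as B S"
    then show "\<exists>g c. g # zs @ c \<in> G - H"
    proof induction
      case (base zs)
      then obtain t where t: "t \<in> JB" "\<not> faulty [0..<k] KB zs t"
        using B' by blast
      then have "0 # zs @ t \<in> G - H" using G0[OF base(1) t(1)] H0[OF base(1)] by blast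
      then show ?case by blast
    next
      case (step zs ys)
      have l: "length (zs @ ys) = k + m" using step.hyps by simp
      obtain q where q: "q \<in> G" "\<not> faulty as H (zs @ ys) q"
        using ex_not_faulty_iff[of G as H "zs @ ys"] step.IH len assms(3) by blast
      obtain t where t: "t \<in> JS" "\<not> faulty [0..<k + m] KS (zs @ ys) t"
        using S'[OF l] step.hyps(3) by blast
      have "1 # (zs @ ys) @ q @ t \<in> G - H"
        using G1[OF l q(1) t(1)] H1'[OF l q(1) t(1)] q t by blast
      then have "1 # zs @ (ys @ q @ t) \<in> G - H" by simp
      then show ?case by blast
    qed
  next
    \<comment> \<open>In a step certificate the state is only the first \<open>k\<close> of the
      \<open>k + m\<close> listed numbers. Speaking about \<open>take k (tl t)\<close> covers both
      kinds of certificates in one induction.\<close>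
    have "t \<notin> H \<Longrightarrow> take k (tl t) \<in> reach k m as B S" if "t \<in> G" for t
      using that
    proof (induction rule: G_induct)
      case (base us t)
      then have "\<not> faulty [0..<k] KB us t" using H0 by blast
      then have "us \<in> B" using B'[OF base.hyps(1)] base.hyps(2) by blast
      then show ?case using base.hyps(1) by (simp add: reach.base)
    next
      case (step us q t)
      have nf: "\<not> faulty as H us q" "\<not> faulty [0..<k + m] KS us t"
        using H1'[OF step.hyps(1-3)] step.prems by blast+
      have us: "us \<in> S" using S'[OF step.hyps(1)] nf(2) step.hyps(3) by blast
      have "\<not> mismatch as us q" "length as < length q" "q \<notin> H"
        using nf(1) len[OF step.hyps(2)] assms(3) by (simp_all add: faulty_def)
      then obtain g c where gc: "q = g # map ((!) us) as @ c"
        using not_mismatch_iff by blast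
      have "take k (tl q) = map ((!) us) as" unfolding gc using assms(3) by simp
      then have "map ((!) us) as \<in> reach k m as B S"
        using step.IH[OF \<open>q \<notin> H\<close>] by (simp only:)
      then have "map ((!) (take k us @ drop k us)) as \<in> reach k m as B S"
        by (simp only: append_take_drop_id)
      then have "take k us \<in> reach k m as B S"
        by (rule reach.step[rotated 3]) (use us step.hyps(1) in simp_all)
      then show ?case using step.hyps(1) by simp
    qed
    moreover assume "\<exists>g c. g # zs @ c \<in> G - H"
    then obtain g c where "g # zs @ c \<in> G" "g # zs @ c \<notin> H" by blast
    ultimately have "take k (tl (g # zs @ c)) \<in> reach k m as B S" by blast
    then show "zs \<in> reach k m as B S" using that by simp
  qed
  ultimately show ?thesis unfolding certifiable_def by blast
qed

section \<open>Graphs of partial recursive functions\<close>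

text \<open>No evidence is required: a certificate is a tag followed by the arguments, and it is
  faulty if the arguments form an element of \<open>N\<close>. This supplies the atomic relations,
  whose complements are easily context-free.\<close>

lemma certifiable_cf_lists_compl:
  assumes "cf_lists N" "\<And>z. z \<in> N \<Longrightarrow> length z = m"
  shows "certifiable m {zs. zs \<notin> N}"
proof -
  define J where "J = {us :: nat list. length us = Suc m}"
  define K where "K = {us :: nat list. length us = 1} \<cdot> N \<cdot> UNIV"
  have K: "g # zs @ c \<in> K \<longleftrightarrow> zs \<in> N" if "length zs = m" for g zs c
  proof
    assume "g # zs @ c \<in> K"
    then obtain a z w where "g # zs @ c = a @ z @ w" "length a = 1" "z \<in> N"
      unfolding K_def by (auto elim!: concE)
    moreover from this obtain b where "a = [b]" by (auto simp: length_Suc_conv)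
    ultimately show "zs \<in> N" using assms(2) that by auto
  next
    assume z: "zs \<in> N"
    have "[g] \<in> {us :: nat list. length us = 1}" by simp
    from concI[OF this concI[OF z UNIV_I, of c]] show "g # zs @ c \<in> K" by (simp add: K_def)
  qed
  have "checker m J K"
    unfolding checker_def
  proof (intro conjI ballI)
    show "cf_lists J" unfolding J_def by (rule cf_lists_length)
    show "cf_lists K" unfolding K_def by (intro cf_lists_conc cf_lists_length cf_lists_UNIV assms(1))
    show "prefix_code J" unfolding prefix_code_def J_def by auto
    show "right_ideal K"
      unfolding right_ideal_def
    proof (intro ballI allI)
      fix w v assume "w \<in> K"
      then obtain a z x where "w = a @ z @ x" "a \<in> {us :: nat list. length us = 1}" "z \<in> N"
        unfolding K_def by (auto elim!: concE)
      then show "w @ v \<in> K"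
        using concI[OF _ concI[OF _ UNIV_I], of a "{us. length us = 1}" z N "x @ v"]
        by (simp add: K_def)
    qed
    fix t assume "t \<in> J"
    then obtain g zs where "t = g # zs @ []" "length zs = m" by (auto simp: J_def length_Suc_conv)
    then show "m < length t" "\<forall>w. t @ w \<in> K \<longrightarrow> t \<in> K" using K[of zs g "[]"] K[of zs g] by auto
  qed
  moreover have "zs \<in> {zs. zs \<notin> N} \<longleftrightarrow> (\<exists>g c. g # zs @ c \<in> J - K)" if "length zs = m" for zs
    using K[OF that] that by (auto simp: J_def)
  ultimately show ?thesis unfolding certifiable_def by blast
qed

lemma certifiable_rename:
  "certifiable m R \<Longrightarrow> length as = m \<Longrightarrow> set as \<subseteq> {..<N} \<Longrightarrow> certifiable N {us. map ((!) us) as \<in> R}"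
  using certifiable_query[of m R m R as as N] by simp

lemma certifiable_empty: "certifiable m {}"
  by (rule certifiable_cong[OF certifiable_cf_lists_compl[OF cf_lists_length]]) auto

lemma certifiable_zero: "certifiable 1 {[0]}"
  by (rule certifiable_cong[OF certifiable_cf_lists_compl[OF cf_lists_pos_block]])
    (auto simp: length_Suc_conv)

lemma certifiable_Suc: "certifiable 2 {[Suc b, b] | b. True}"
  by (rule certifiable_cong[OF certifiable_cf_lists_compl[OF cf_lists_not_Suc]])
    (auto simp: length_Suc_conv numeral_2_eq_2)

text \<open>Equality of \<open>a\<close> and \<open>b\<close> is expressed through an auxiliary
  number, at position 2, that is the successor of both.\<close>

lemma certifiable_eq: "certifiable 2 {[a, a] | a. True}"
proof -
  have "certifiable (2 + 1) {us. map ((!) us) [2, 0] \<in> {[Suc b, b] | b. True} \<and>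
      map ((!) us) [2, 1] \<in> {[Suc b, b] | b. True}}"
    by (rule certifiable_query[OF certifiable_Suc certifiable_Suc]) auto
  from certifiable_proj[OF this] show ?thesis
    by (rule certifiable_cong) (auto simp: length_Suc_conv numeral_2_eq_2)
qed

text \<open>The complement is empty and thus not the language of an expression. Instead, the
  satisfiable condition that some number is 0 is projected to no arguments at all, and renaming then
  adds \<open>m\<close> unconstrained ones.\<close>

lemma certifiable_UNIV: "certifiable m UNIV"
proof -
  have "certifiable (0 + 1) {[0]}" using certifiable_zero by simp
  from certifiable_proj[OF this] have "certifiable 0 (UNIV :: nat list set)"
    by (rule certifiable_cong) (auto intro: exI[of _ "[0]"])
  from certifiable_rename[OF this, of "[]" m] show ?thesis by simp
qed

lemma map_nth_upt: "j \<le> length us \<Longrightarrow> map ((!) us) [i..<j] = take (j - i) (drop i us)"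
  by (rule nth_equalityI) auto

abbreviation graph :: "recf \<Rightarrow> nat list set" where
  "graph f \<equiv> {zs. computes f (tl zs) (hd zs)}"

text \<open>The inner layer of a composition: the outputs come first, then the shared arguments, and
  each function adds one conjunct.\<close>

lemma certifiable_graphs:
  assumes "\<And>g. g \<in> set gs \<Longrightarrow> certifiable (Suc k) (graph g)"
  shows "certifiable (length gs + k)
    {us. \<forall>i<length gs. computes (gs ! i) (drop (length gs) us) (us ! i)}"
  using assms
proof (induction gs)
  case Nil
  show ?case using certifiable_UNIV by simp
next
  case (Cons g gs)
  let ?l = "length gs"
  let ?A = "{us. \<forall>i<length gs. computes (gs ! i) (drop (length gs) us) (us ! i)}"
  have "certifiable (Suc ?l + k) {us. map ((!) us) (0 # [Suc ?l..<Suc ?l + k]) \<in> graph g \<and>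
      map ((!) us) [1..<Suc ?l + k] \<in> ?A}"
    by (rule certifiable_query[OF Cons.prems Cons.IH]) (use Cons.prems in \<open>auto simp: Suc_le_eq\<close>)
  then have "certifiable (Suc ?l + k)
    {us. \<forall>i<Suc ?l. computes ((g # gs) ! i) (drop (Suc ?l) us) (us ! i)}"
  proof (rule certifiable_cong)
    fix zs :: "nat list" assume "length zs = Suc ?l + k"
    then obtain y us where zs: "zs = y # us" "length us = ?l + k" by (auto simp: length_Suc_conv)
    have "map ((!) zs) [Suc ?l..<Suc ?l + k] = drop ?l us"
      "map ((!) zs) [1..<Suc ?l + k] = us"
      using zs by (simp_all add: map_nth_upt del: upt_Suc)
    then show "zs \<in> {us. map ((!) us) (0 # [Suc ?l..<Suc ?l + k]) \<in> graph g \<and>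
        map ((!) us) [1..<Suc ?l + k] \<in> ?A} \<longleftrightarrow>
      zs \<in> {us. \<forall>i<Suc ?l. computes ((g # gs) ! i) (drop (Suc ?l) us) (us ! i)}"
      using zs(1) by (simp add: All_less_Suc2 del: upt_Suc)
  qed
  then show ?case by simp
qed

text \<open>Certificates follow the structure of \<open>f\<close>: the intermediate values of a
  composition are projected away, while recursion and search become runs of
  \<open>reach\<close>.\<close>

theorem certifiable_computes: "certifiable (Suc k) (graph f)"
proof (induction f arbitrary: k)
  case Zero
  have "certifiable (Suc k) {us. map ((!) us) [0] \<in> {[0]}}"
    by (rule certifiable_rename[OF certifiable_zero]) auto
  then show ?case
    by (rule certifiable_cong) (auto simp: length_Suc_conv intro: computes.Zero elim: computes_ZeroE)
next
  case Succ
  show ?case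
  proof (cases "k = 1")
    case True
    then have "certifiable (Suc k) {[Suc b, b] | b. True}"
      using certifiable_Suc by (simp add: numeral_2_eq_2)
    then show ?thesis
      by (rule certifiable_cong)
        (use True in \<open>auto simp: length_Suc_conv intro: computes.Succ elim: computes_SuccE\<close>)
  next
    case False
    show ?thesis
      by (rule certifiable_cong[OF certifiable_empty])
        (use False in \<open>auto simp: length_Suc_conv elim!: computes_SuccE\<close>)
  qed
next
  case (Proj i)
  show ?case
  proof (cases "i < k")
    case True
    have "certifiable (Suc k) {us. map ((!) us) [0, Suc i] \<in> {[a, a] | a. True}}"
      by (rule certifiable_rename[OF certifiable_eq]) (use True in auto)
    then show ?thesis
      by (rule certifiable_cong)
        (use True in \<open>auto simp: length_Suc_conv elim!: computes_ProjE intro: computes.Proj\<close>)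
  next
    case False
    show ?thesis
      by (rule certifiable_cong[OF certifiable_empty])
        (use False in \<open>auto simp: length_Suc_conv elim!: computes_ProjE\<close>)
  qed
next
  case (Comp f gs)
  let ?m = "length gs"
  let ?A = "{us. \<forall>i<?m. computes (gs ! i) (drop ?m us) (us ! i)}"
  \<comment> \<open>Position 0 holds the output, the next \<open>k\<close> positions the arguments,
    and the last \<open>?m\<close> positions the intermediate values.\<close>
  have "certifiable (Suc k + ?m) {us. map ((!) us) ([Suc k..<Suc k + ?m] @ [1..<Suc k]) \<in> ?A \<and>
      map ((!) us) (0 # [Suc k..<Suc k + ?m]) \<in> graph f}"
    by (rule certifiable_query[OF certifiable_graphs Comp.IH(1)]) (use Comp.IH(2) in \<open>auto simp: Suc_le_eq\<close>)
  from certifiable_proj[OF this] show ?case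
  proof (rule certifiable_cong)
    fix zs :: "nat list" assume "length zs = Suc k"
    then obtain z xs where zs: "zs = z # xs" "length xs = k" by (auto simp: length_Suc_conv)
    let ?C = "{us. map ((!) us) ([Suc k..<Suc k + ?m] @ [1..<Suc k]) \<in> ?A \<and>
        map ((!) us) (0 # [Suc k..<Suc k + ?m]) \<in> graph f}"
    have "zs @ ys \<in> ?C \<longleftrightarrow> (\<forall>i<?m. computes (gs ! i) xs (ys ! i)) \<and> computes f ys z"
      if "length ys = ?m" for ys
    proof -
      have eqs: "map ((!) (zs @ ys)) [Suc k..<Suc k + ?m] = ys" "map ((!) (zs @ ys)) [1..<Suc k] = xs"
        using zs that by (simp_all add: map_nth_upt del: upt_Suc)
      show ?thesis
        unfolding mem_Collect_eq map_append list.map eqs using zs(1) that by (simp add: nth_append)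
    qed
    then have "(\<exists>ys. length ys = ?m \<and> zs @ ys \<in> ?C) \<longleftrightarrow>
        (\<exists>ys. length ys = ?m \<and> (\<forall>i<?m. computes (gs ! i) xs (ys ! i)) \<and> computes f ys z)"
      by (intro ex_cong) blast
    also have "\<dots> \<longleftrightarrow> computes (Comp f gs) xs z"
      using computes.Comp[of _ gs xs f z] computes_CompE[of f gs xs z] by metis
    finally have "(\<exists>ys. length ys = ?m \<and> zs @ ys \<in> ?C) \<longleftrightarrow> computes (Comp f gs) xs z" .
    then show "zs \<in> {zs. \<exists>ys. length ys = ?m \<and> zs @ ys \<in> ?C} \<longleftrightarrow> zs \<in> graph (Comp f gs)"
      using zs(1) by simp
  qed
next
  case (PrimRec f g)
  show ?case
  proof (cases k)
    case 0
    \<comment> \<open>\<open>PrimRec\<close> never halts on the empty list, as there is no recursion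
      argument.\<close>
    show ?thesis
      by (rule certifiable_cong[OF certifiable_empty])
        (auto simp: 0 length_Suc_conv elim: computes.cases)
  next
    case (Suc p)
    \<comment> \<open>A state \<open>n # r # xs\<close> asserts that the recursion at
      \<open>n\<close> yields \<open>r\<close>. The auxiliary values at positions
      \<open>p + 2\<close> and \<open>p + 3\<close> are the predecessor of \<open>n\<close> and the
      value of the recursion there.\<close>
    define B where "B = {us. map ((!) us) [0] \<in> {[0]} \<and> map ((!) us) [1..<p + 2] \<in> graph f}"
    define S where "S = {us. map ((!) us) [0, p + 2] \<in> {[Suc b, b] | b. True} \<and>
      map ((!) us) (1 # (p + 2) # (p + 3) # [2..<p + 2]) \<in> graph g}"
    let ?as = "(p + 2) # (p + 3) # [2..<p + 2]"
    let ?R = "reach (p + 2) 2 ?as B S"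
    have "certifiable (p + 2) B"
      unfolding B_def by (rule certifiable_query[OF certifiable_zero PrimRec.IH(1)]) auto
    moreover have "certifiable (p + 2 + 2) S"
      unfolding S_def by (rule certifiable_query[OF certifiable_Suc PrimRec.IH(2)]) auto
    ultimately have R: "certifiable (p + 2) ?R"
      by (rule certifiable_reach) auto
    have S: "(n # r # xs) @ [n', r'] \<in> S \<longleftrightarrow> n = Suc n' \<and> computes g (n' # r' # xs) r"
      "map ((!) ((n # r # xs) @ [n', r'])) ?as = n' # r' # xs"
      if "length xs = p" for n r xs n' r'
    proof -
      have "map ((!) ((n # r # xs) @ [n', r'])) [2..<p + 2] = xs"
        using that by (simp add: map_nth_upt numeral_2_eq_2 del: upt_Suc)
      moreover have "((n # r # xs) @ [n', r']) ! (p + 2) = n'" "((n # r # xs) @ [n', r']) ! (p + 3) = r'"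
        "((n # r # xs) @ [n', r']) ! 0 = n" "((n # r # xs) @ [n', r']) ! 1 = r"
        using that by (simp_all add: nth_append numeral_3_eq_3)
      ultimately show "(n # r # xs) @ [n', r'] \<in> S \<longleftrightarrow> n = Suc n' \<and> computes g (n' # r' # xs) r"
        "map ((!) ((n # r # xs) @ [n', r'])) ?as = n' # r' # xs"
        unfolding S_def by (auto simp del: upt_Suc append_Cons append.simps)
    qed
    have B: "n # r # xs \<in> B \<longleftrightarrow> n = 0 \<and> computes f xs r" if "length xs = p" for n r xs
      unfolding B_def using that by (simp add: map_nth_upt del: upt_Suc)
    have "n # r # xs \<in> ?R \<longleftrightarrow> computes (PrimRec f g) (n # xs) r" if xs: "length xs = p" for n r xs
    proof
      have "\<And>n r. zs = n # r # xs \<Longrightarrow> computes (PrimRec f g) (n # xs) r" if "zs \<in> ?R" for zs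
        using that
      proof induction
        case (base zs)
        then show ?case using B[OF xs] by (auto intro: computes.PrimRec_0)
      next
        case (step zs ys)
        obtain n' r' where ys: "ys = [n', r']"
          using step.hyps(2) by (auto simp: length_Suc_conv numeral_2_eq_2)
        show ?case
          using step.hyps(3) step.IH S[OF xs, of n r n' r'] step.prems ys
          by (auto intro: computes.PrimRec_Suc simp del: append_Cons append.simps)
      qed
      then show "n # r # xs \<in> ?R \<Longrightarrow> computes (PrimRec f g) (n # xs) r" by blast
    next
      show "computes (PrimRec f g) (n # xs) r \<Longrightarrow> n # r # xs \<in> ?R"
      proof (induction n arbitrary: r)
        case 0
        then show ?case using B[OF xs] xs by (intro reach.base) (auto elim: computes_PrimRec_0E)
      next
        case (Suc n)
        then obtain r' where r': "computes (PrimRec f g) (n # xs) r'" "computes g (n # r' # xs) r"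
          by (blast elim: computes_PrimRec_SucE)
        show ?case
        proof (rule reach.step[of _ _ "[n, r']"])
          show "(Suc n # r # xs) @ [n, r'] \<in> S" using S(1)[OF xs] r'(2) by blast
          show "map ((!) ((Suc n # r # xs) @ [n, r'])) ?as \<in> ?R"
            using S(2)[OF xs, of "Suc n" r n r'] Suc.IH[OF r'(1)] by (simp only:)
        qed (use xs in simp_all)
      qed
    qed
    note iff = this
    \<comment> \<open>The graph lists the output first, a state lists the recursion argument first;
      the renaming swaps the two.\<close>
    have "certifiable (Suc k) {us. map ((!) us) (1 # 0 # [2..<p + 2]) \<in> ?R}"
      by (rule certifiable_rename[OF R]) (auto simp: Suc)
    then show ?thesis
    proof (rule certifiable_cong)
      fix zs :: "nat list" assume "length zs = Suc k"
      then obtain y n xs where zs: "zs = y # n # xs" "length xs = p"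
        by (auto simp: length_Suc_conv Suc)
      then have "map ((!) zs) [2..<p + 2] = xs"
        by (simp add: map_nth_upt numeral_2_eq_2 del: upt_Suc)
      then have "map ((!) zs) (1 # 0 # [2..<p + 2]) = n # y # xs" using zs by simp
      then show "zs \<in> {us. map ((!) us) (1 # 0 # [2..<p + 2]) \<in> ?R} \<longleftrightarrow> zs \<in> graph (PrimRec f g)"
        using iff[OF zs(2)] zs(1) by (simp del: list.map upt_Suc)
    qed
  qed
next
  case (Mu f)
  let ?suc = "{[Suc b, b] | b. True}"
  define B where "B = {us. map ((!) us) [0] \<in> {[0 :: nat]}}"
  \<comment> \<open>The run counts \<open>n\<close> down to 0 and certifies a positive value of
    \<open>f\<close> at each smaller number. The three auxiliary values are the predecessor of
    \<open>n\<close>, the value of \<open>f\<close> there, and the predecessor of this value, which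
    witnesses positivity.\<close>
  define T where "T = {us. map ((!) us) [0, k + 1] \<in> ?suc \<and> map ((!) us) [k + 2, k + 3] \<in> ?suc}"
  define S where "S = {us. map ((!) us) [0..<k + 4] \<in> T \<and>
    map ((!) us) ((k + 2) # (k + 1) # [1..<k + 1]) \<in> graph f}"
  let ?as = "(k + 1) # [1..<k + 1]"
  let ?R = "reach (k + 1) 3 ?as B S"
  have "certifiable (k + 1) B"
    unfolding B_def by (rule certifiable_rename[OF certifiable_zero]) auto
  moreover have "certifiable (k + 4) T"
    unfolding T_def by (rule certifiable_query[OF certifiable_Suc certifiable_Suc]) auto
  then have "certifiable (k + 1 + 3) S"
    unfolding S_def by (rule certifiable_query[OF _ Mu.IH]) auto
  ultimately have R: "certifiable (k + 1) ?R"
    by (rule certifiable_reach) auto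
  have S: "(n # xs) @ [n', c, c'] \<in> S \<longleftrightarrow> n = Suc n' \<and> c = Suc c' \<and> computes f (n' # xs) c"
    "map ((!) ((n # xs) @ [n', c, c'])) ?as = n' # xs"
    if "length xs = k" for n xs n' c c'
  proof -
    let ?us = "(n # xs) @ [n', c, c']"
    have eqs: "map ((!) ?us) [1..<k + 1] = xs" "map ((!) ?us) [0..<k + 4] = ?us"
      using that by (simp_all add: map_nth_upt del: upt_Suc)
    moreover have nths: "?us ! (k + 1) = n'" "?us ! (k + 2) = c" "?us ! (k + 3) = c'"
      using that by (simp_all add: nth_append numeral_3_eq_3 numeral_2_eq_2)
    moreover have "?us ! 0 = n" by simp
    ultimately have "map ((!) ?us) [0, k + 1] = [n, n']" "map ((!) ?us) [k + 2, k + 3] = [c, c']"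
      "map ((!) ?us) ((k + 2) # (k + 1) # [1..<k + 1]) = c # n' # xs"
      unfolding list.map by (simp_all only:)
    then show "?us \<in> S \<longleftrightarrow> n = Suc n' \<and> c = Suc c' \<and> computes f (n' # xs) c"
      unfolding S_def T_def mem_Collect_eq eqs by (simp only:) auto
    show "map ((!) ?us) ?as = n' # xs" unfolding list.map eqs nths ..
  qed
  have B: "n # xs \<in> B \<longleftrightarrow> n = 0" for n xs by (simp add: B_def)
  have iff: "n # xs \<in> ?R \<longleftrightarrow> (\<forall>m<n. \<exists>c. computes f (m # xs) (Suc c))" if xs: "length xs = k" for n xs
  proof
    have "\<And>n. zs = n # xs \<Longrightarrow> \<forall>m<n. \<exists>c. computes f (m # xs) (Suc c)" if "zs \<in> ?R" for zs
      using that
    proof induction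
      case (base zs)
      then show ?case using B by auto
    next
      case (step zs ys)
      obtain n' c c' where ys: "ys = [n', c, c']"
        using step.hyps(2) by (auto simp: length_Suc_conv numeral_3_eq_3)
      have e: "zs @ ys = (n # xs) @ [n', c, c']" by (simp add: step.prems ys)
      have "n = Suc n' \<and> c = Suc c' \<and> computes f (n' # xs) c"
        using step.hyps(3) unfolding e S(1)[OF xs] .
      moreover have "\<forall>m<n'. \<exists>c. computes f (m # xs) (Suc c)"
        by (rule step.IH) (unfold e, rule S(2)[OF xs])
      ultimately show ?case by (auto simp: less_Suc_eq)
    qed
    then show "n # xs \<in> ?R \<Longrightarrow> \<forall>m<n. \<exists>c. computes f (m # xs) (Suc c)" by blast
  next
    show "\<forall>m<n. \<exists>c. computes f (m # xs) (Suc c) \<Longrightarrow> n # xs \<in> ?R"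
    proof (induction n)
      case 0
      then show ?case using B xs by (intro reach.base) auto
    next
      case (Suc n)
      then obtain c where c: "computes f (n # xs) (Suc c)" by blast
      show ?case
      proof (rule reach.step[of _ _ "[n, Suc c, c]"])
        show "(Suc n # xs) @ [n, Suc c, c] \<in> S" using S(1)[OF xs] c by blast
        have "n # xs \<in> ?R" using Suc by simp
        then show "map ((!) ((Suc n # xs) @ [n, Suc c, c])) ?as \<in> ?R"
          using S(2)[OF xs, of "Suc n" n "Suc c" c] by (simp only:)
      qed (use xs in simp_all)
    qed
  qed
  \<comment> \<open>Index lists select positions and cannot supply constants, so the final value 0
    of \<open>f\<close> becomes an auxiliary argument at position \<open>k + 1\<close> that is
    required to be zero.\<close>
  let ?Z = "{us. map ((!) us) [k + 1] \<in> {[0]} \<and> map ((!) us) ((k + 1) # [0..<k + 1]) \<in> graph f}"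
  have "certifiable (k + 2) ?Z"
    by (rule certifiable_query[OF certifiable_zero Mu.IH]) auto
  then have "certifiable (Suc k + 1)
      {us. map ((!) us) [0..<k + 1] \<in> ?R \<and> map ((!) us) [0..<k + 2] \<in> ?Z}"
    by (rule certifiable_query[OF R]) auto
  from certifiable_proj[OF this] show ?case
  proof (rule certifiable_cong)
    fix zs :: "nat list" assume l: "length zs = Suc k"
    then obtain y xs where zs: "zs = y # xs" "length xs = k" by (auto simp: length_Suc_conv)
    have "map ((!) (zs @ [z])) [0..<k + 1] = zs" "map ((!) (zs @ [z])) [0..<k + 2] = zs @ [z]"
      "(zs @ [z]) ! (k + 1) = z" for z
      using l by (simp_all add: map_nth_upt nth_append del: upt_Suc)
    then have mem: "zs @ [z] \<in> {us. map ((!) us) [0..<k + 1] \<in> ?R \<and> map ((!) us) [0..<k + 2] \<in> ?Z} \<longleftrightarrow>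
        zs \<in> ?R \<and> z = 0 \<and> computes f zs z" for z
      by (simp del: upt_Suc)
    have ex1: "(\<exists>ys :: nat list. length ys = 1 \<and> P ys) \<longleftrightarrow> (\<exists>z. P [z])" for P
      by (auto simp: length_Suc_conv)
    have "(\<exists>ys. length ys = 1 \<and>
        zs @ ys \<in> {us. map ((!) us) [0..<k + 1] \<in> ?R \<and> map ((!) us) [0..<k + 2] \<in> ?Z}) \<longleftrightarrow>
        zs \<in> ?R \<and> computes f zs 0"
      unfolding ex1 mem by blast
    then show "zs \<in> {zs. \<exists>ys. length ys = 1 \<and>
        zs @ ys \<in> {us. map ((!) us) [0..<k + 1] \<in> ?R \<and> map ((!) us) [0..<k + 2] \<in> ?Z}} \<longleftrightarrow>
        zs \<in> graph (Mu f)"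
      unfolding mem_Collect_eq zs(1) iff[OF zs(2)] list.sel
      using computes.Mu[of f y xs] computes_MuE[of f xs y] by metis
  qed
qed

section \<open>Rees quotients of free semigroups\<close>

definition words :: "'a set \<Rightarrow> 'a list set" where
  "words A = {w \<in> lists A. w \<noteq> []}"

lemma words_append: "u \<in> words A \<Longrightarrow> v \<in> words A \<Longrightarrow> u @ v \<in> words A"
  by (auto simp: words_def)

text \<open>\<open>None\<close> codes the zero of the quotient and \<open>Some w\<close> a word
  outside the ideal; \<open>\<iota>\<close> moves these codes into an arbitrary type. The length
  bound keeps the letters out of the ideal, hence distinct and indecomposable.\<close>

locale rees_quotient =
  fixes \<iota> :: "'a list option \<Rightarrow> 's" and A :: "'a set" and I :: "'a list set"
  assumes inj: "inj \<iota>"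
    and finite: "finite A" and nonempty: "A \<noteq> {}"
    and ideal_sub: "I \<subseteq> words A" and ideal_nonempty: "I \<noteq> {}"
    and ideal: "w \<in> I \<Longrightarrow> u \<in> lists A \<Longrightarrow> u @ w \<in> I \<and> w @ u \<in> I"
    and long: "w \<in> I \<Longrightarrow> 2 \<le> length w"
begin

definition cls :: "'a list \<Rightarrow> 's" where
  "cls w = \<iota> (if w \<in> I then None else Some w)"

definition rep :: "'s \<Rightarrow> 'a list" where
  "rep x = (SOME w. w \<in> words A \<and> cls w = x)"

definition quotient :: "'s monoid" where
  "quotient = \<lparr>carrier = cls ` words A, mult = (\<lambda>x y. cls (rep x @ rep y)), one = cls []\<rparr>"

lemma cls_eq: "cls u = cls v \<longleftrightarrow> u = v \<or> u \<in> I \<and> v \<in> I"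
  by (auto simp: cls_def inj_eq[OF inj])

lemma carrier_quotient [simp]: "carrier quotient = cls ` words A"
  by (simp add: quotient_def)

lemma rep: "w \<in> words A \<Longrightarrow> rep (cls w) \<in> words A \<and> cls (rep (cls w)) = cls w"
  unfolding rep_def by (rule someI[of _ w]) simp

lemma mult_quotient:
  assumes "u \<in> words A" "v \<in> words A"
  shows "cls u \<otimes>\<^bsub>quotient\<^esub> cls v = cls (u @ v)"
proof -
  note r = rep[OF assms(1)] rep[OF assms(2)]
  have l: "u \<in> lists A" "v \<in> lists A" "rep (cls u) \<in> lists A" "rep (cls v) \<in> lists A"
    using assms r by (auto simp: words_def)
  have "cls (rep (cls u) @ rep (cls v)) = cls (u @ rep (cls v))"
    using r(1) ideal l unfolding cls_eq by blast
  also have "\<dots> = cls (u @ v)"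
    using r(2) ideal l unfolding cls_eq by blast
  finally show ?thesis by (simp add: quotient_def)
qed

lemma semigroup_quotient: "semigroup_struct quotient"
  unfolding semigroup_struct_def
proof (intro conjI ballI)
  obtain a where "a \<in> A" using nonempty by blast
  then have "[a] \<in> words A" by (simp add: words_def)
  then show "carrier quotient \<noteq> {}" by auto
qed (auto simp: mult_quotient words_append)

lemma cls_hom: "cls \<in> hom (free_semigroup A) quotient"
  unfolding hom_def free_semigroup_def words_def[symmetric] by (auto simp: mult_quotient)

lemma singleton_notin: "[a] \<notin> I"
  using long[of "[a]"] by auto

lemma interpreted_quotient:
  assumes "alphabet \<Sigma> = A" "repr_lang \<Sigma> = words A"
    and M: "mult_lang \<Sigma> = {mult_word u v w | u v w. u \<in> words A \<and> v \<in> words A \<and> w \<in> words A \<and>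
      (u @ v = w \<or> u @ v \<in> I \<and> w \<in> I)}"
    and "regular_over A (words A)" "context_free_over (msyms A) (mult_lang \<Sigma>)"
  shows "interpreted_wh_structure_for \<Sigma> quotient"
proof -
  have "interpretation_wrt \<Sigma> quotient cls"
    unfolding interpretation_wrt_def assms(1,2)
  proof (intro conjI)
    show "inj_on (\<lambda>a. cls [a]) A" by (auto simp: inj_on_def cls_eq singleton_notin)
    have "(u @ v = w \<or> u @ v \<in> I \<and> w \<in> I) \<longleftrightarrow> cls u \<otimes>\<^bsub>quotient\<^esub> cls v = cls w"
      if "u \<in> words A" "v \<in> words A" for u v w
      using that by (simp add: mult_quotient cls_eq)
    then show "mult_lang \<Sigma> = {mult_word u v w | u v w. u \<in> words A \<and> v \<in> words A \<and>
        w \<in> words A \<and> cls u \<otimes>\<^bsub>quotient\<^esub> cls v = cls w}"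
      unfolding M by blast
  qed (auto simp: cls_hom)
  moreover have "pre_word_hyperbolic \<Sigma>"
    unfolding pre_word_hyperbolic_def assms(1,2)
  proof (intro conjI)
    show "mult_lang \<Sigma> \<subseteq> {mult_word u v w | u v w. u \<in> words A \<and> v \<in> words A \<and> w \<in> words A}"
      unfolding M by blast
  qed (use assms(4,5) finite in \<open>simp_all add: words_def\<close>)
  moreover have "(\<lambda>a. [a]) ` A \<subseteq> words A" by (auto simp: words_def)
  ultimately show ?thesis
    unfolding interpreted_wh_structure_for_def word_hyperbolic_structure_for_def
      assignment_of_generators_def assms(1,2)
    using semigroup_quotient by auto
qed

definition zero :: "'s" where
  "zero = \<iota> None"

lemma cls_zero: "cls w = zero \<longleftrightarrow> w \<in> I"
  by (simp add: cls_def zero_def inj_eq[OF inj])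

text \<open>Multiplication by an element of the ideal gives zero, so an element that swallows every
  right factor is zero itself. Isomorphisms preserve this characterisation.\<close>

lemma zero_unique:
  assumes "z \<in> carrier quotient" "\<And>x. x \<in> carrier quotient \<Longrightarrow> z \<otimes>\<^bsub>quotient\<^esub> x = z"
  shows "z = zero"
proof -
  obtain u where u: "u \<in> words A" "z = cls u" using assms(1) by auto
  obtain w where w: "w \<in> I" using ideal_nonempty by blast
  then have "cls u = cls (u @ w)"
    using assms(2)[of "cls w"] u mult_quotient[of u w] ideal_sub by auto
  moreover have "u @ w \<in> I" using w ideal u by (auto simp: words_def)
  ultimately show ?thesis using cls_zero u by metis
qed

lemma zero_mult:
  assumes "x \<in> carrier quotient"
  shows "zero \<in> carrier quotient" "zero \<otimes>\<^bsub>quotient\<^esub> x = zero"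
proof -
  obtain w where w: "w \<in> I" using ideal_nonempty by blast
  obtain u where u: "u \<in> words A" "x = cls u" using assms by auto
  have z: "zero = cls w" using w cls_zero[of w] by simp
  with w show "zero \<in> carrier quotient" using ideal_sub by auto
  have "w @ u \<in> I" using w ideal u by (auto simp: words_def)
  then show "zero \<otimes>\<^bsub>quotient\<^esub> x = zero"
    using z u mult_quotient[of w u] w ideal_sub cls_zero by auto
qed

text \<open>Distinct words are identified only inside the ideal, where all lengths are at least 2.
  So being a product is an algebraic test for not being a letter.\<close>

lemma decomposable_iff:
  assumes "w \<in> words A"
  shows "(\<exists>x\<in>carrier quotient. \<exists>y\<in>carrier quotient. cls w = x \<otimes>\<^bsub>quotient\<^esub> y) \<longleftrightarrow> 2 \<le> length w"
proof
  assume "\<exists>x\<in>carrier quotient. \<exists>y\<in>carrier quotient. cls w = x \<otimes>\<^bsub>quotient\<^esub> y"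
  then obtain u v where uv: "u \<in> words A" "v \<in> words A" "cls w = cls (u @ v)"
    by (auto simp: mult_quotient)
  then have "0 < length u" "0 < length v" by (auto simp: words_def)
  then have "2 \<le> length (u @ v)" unfolding length_append by linarith
  then show "2 \<le> length w" using uv(3) long unfolding cls_eq by blast
next
  assume "2 \<le> length w"
  then obtain a b v where w: "w = [a] @ (b # v)"
    by (auto simp: numeral_2_eq_2 Suc_le_length_iff)
  with assms have "[a] \<in> words A" "b # v \<in> words A" by (auto simp: words_def)
  with w mult_quotient[of "[a]" "b # v"]
  show "\<exists>x\<in>carrier quotient. \<exists>y\<in>carrier quotient. cls w = x \<otimes>\<^bsub>quotient\<^esub> y"
    by (metis carrier_quotient imageI)
qed

end

section \<open>Isomorphisms between Rees quotients\<close>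

lemma rees_iso:
  assumes "rees_quotient \<iota> A I" "rees_quotient \<kappa> A I"
  shows "rees_quotient.quotient \<iota> A I \<cong> rees_quotient.quotient \<kappa> A I"
proof -
  interpret L: rees_quotient \<iota> A I by (rule assms)
  interpret R: rees_quotient \<kappa> A I by (rule assms)
  define h where "h x = R.cls (L.rep x)" for x
  have h: "h (L.cls w) = R.cls w" if "w \<in> words A" for w
    using L.rep[OF that] unfolding h_def by (simp add: L.cls_eq R.cls_eq)
  have "h \<in> hom L.quotient R.quotient"
    by (auto simp: hom_def h L.mult_quotient R.mult_quotient words_append)
  moreover have "bij_betw h (carrier L.quotient) (carrier R.quotient)"
    by (auto simp: bij_betw_def inj_on_def h L.cls_eq R.cls_eq image_image)
  ultimately show ?thesis by (auto simp: is_iso_def iso_def)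
qed

text \<open>
  An isomorphism permutes the indecomposable elements, which are the letters, and thus maps one
  ideal onto the other by a length-preserving permutation of words.
\<close>

lemma rees_iso_eq:
  assumes "rees_quotient \<iota> A I" "rees_quotient \<kappa> A J" "I \<subseteq> J"
    and "rees_quotient.quotient \<iota> A I \<cong> rees_quotient.quotient \<kappa> A J"
  shows "I = J"
proof -
  interpret L: rees_quotient \<iota> A I by (rule assms)
  interpret R: rees_quotient \<kappa> A J by (rule assms)
  obtain h where hom: "h \<in> hom L.quotient R.quotient"
    and bij: "bij_betw h (carrier L.quotient) (carrier R.quotient)"
    using assms(4) by (auto simp: is_iso_def iso_def)
  have mult: "h (x \<otimes>\<^bsub>L.quotient\<^esub> y) = h x \<otimes>\<^bsub>R.quotient\<^esub> h y"
    if "x \<in> carrier L.quotient" "y \<in> carrier L.quotient" for x y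
    using hom that unfolding hom_def by blast
  have closed: "h x \<in> carrier R.quotient" if "x \<in> carrier L.quotient" for x
    using bij that by (auto simp: bij_betw_def)
  have surj: "\<exists>x\<in>carrier L.quotient. y = h x" if "y \<in> carrier R.quotient" for y
    using bij that unfolding bij_betw_def by blast
  have inj: "h x = h y \<longleftrightarrow> x = y"
    if "x \<in> carrier L.quotient" "y \<in> carrier L.quotient" for x y
    using bij that unfolding bij_betw_def inj_on_def by blast
  have mult_closed: "x \<otimes>\<^bsub>L.quotient\<^esub> y \<in> carrier L.quotient"
    if "x \<in> carrier L.quotient" "y \<in> carrier L.quotient" for x y
    using that L.semigroup_quotient unfolding semigroup_struct_def by blast
  have "\<exists>b\<in>A. h (L.cls [a]) = R.cls [b]" if "a \<in> A" for a
  proof -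
    have a: "[a] \<in> words A" using that by (simp add: words_def)
    then have ac: "L.cls [a] \<in> carrier L.quotient" by simp
    then obtain w where w: "w \<in> words A" "h (L.cls [a]) = R.cls w" using closed by fastforce
    have "\<not> 2 \<le> length w"
    proof
      assume "2 \<le> length w"
      then obtain x y where xy: "x \<in> carrier R.quotient" "y \<in> carrier R.quotient"
        "h (L.cls [a]) = x \<otimes>\<^bsub>R.quotient\<^esub> y"
        using R.decomposable_iff[OF w(1)] w(2) by auto
      obtain x' where x': "x' \<in> carrier L.quotient" "x = h x'" using surj xy(1) by blast
      obtain y' where y': "y' \<in> carrier L.quotient" "y = h y'" using surj xy(2) by blast
      have "h (L.cls [a]) = h (x' \<otimes>\<^bsub>L.quotient\<^esub> y')" using xy(3) x' y' mult by simp
      then have "L.cls [a] = x' \<otimes>\<^bsub>L.quotient\<^esub> y'" using inj ac mult_closed x' y' by blast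
      then show False using L.decomposable_iff[OF a] x' y' by auto
    qed
    moreover have "w \<noteq> []" using w by (simp add: words_def)
    ultimately obtain b where "w = [b]" by (cases w) (auto simp: Suc_le_eq)
    with w show ?thesis by (auto simp: words_def)
  qed
  then obtain \<pi> where \<pi>: "\<And>a. a \<in> A \<Longrightarrow> \<pi> a \<in> A \<and> h (L.cls [a]) = R.cls [\<pi> a]" by metis
  have map_words: "map \<pi> w \<in> words A" if "w \<in> words A" for w
    using that \<pi> by (auto simp: words_def)
  have h: "h (L.cls w) = R.cls (map \<pi> w)" if "w \<in> words A" for w
  proof -
    have "w \<noteq> []" "w \<in> lists A" using that by (auto simp: words_def)
    then show ?thesis
    proof (induction w rule: list_nonempty_induct)
      case (single a)
      then show ?case using \<pi> by simp
    next
      case (cons a w)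
      then have *: "[a] \<in> words A" "w \<in> words A" "a \<in> A" by (auto simp: words_def)
      have "h (L.cls (a # w)) = h (L.cls [a] \<otimes>\<^bsub>L.quotient\<^esub> L.cls w)"
        using L.mult_quotient[OF *(1,2)] by simp
      also have "\<dots> = R.cls [\<pi> a] \<otimes>\<^bsub>R.quotient\<^esub> R.cls (map \<pi> w)"
        using * cons \<pi> by (simp add: mult)
      also have "\<dots> = R.cls (map \<pi> (a # w))"
        using R.mult_quotient[OF map_words[OF *(1)] map_words[OF *(2)]] by simp
      finally show ?case .
    qed
  qed
  \<comment> \<open>Since \<open>h\<close> is surjective, absorption of right factors by
    \<open>L.zero\<close> carries over to its image, which \<open>R.zero_unique\<close> then
    identifies.\<close>
  have "h L.zero = R.zero"
  proof (rule R.zero_unique)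
    have z: "L.zero \<in> carrier L.quotient"
      using L.zero_mult(1) L.semigroup_quotient unfolding semigroup_struct_def by blast
    then show "h L.zero \<in> carrier R.quotient" by (rule closed)
    fix y assume "y \<in> carrier R.quotient"
    then obtain x where x: "x \<in> carrier L.quotient" "y = h x" using surj by blast
    have "h L.zero \<otimes>\<^bsub>R.quotient\<^esub> h x = h (L.zero \<otimes>\<^bsub>L.quotient\<^esub> x)"
      using mult[OF z x(1)] by simp
    then show "h L.zero \<otimes>\<^bsub>R.quotient\<^esub> y = h L.zero"
      using x L.zero_mult(2)[OF x(1)] by simp
  qed
  then have iff: "w \<in> I \<longleftrightarrow> map \<pi> w \<in> J" if "w \<in> words A" for w
    using h[OF that] inj[of "L.cls w" L.zero] that L.zero_mult(1)[of "L.cls w"]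
    by (auto simp: L.cls_zero[symmetric] R.cls_zero[symmetric])
  have inj_\<pi>: "inj_on \<pi> A"
  proof (rule inj_onI)
    fix a b assume ab: "a \<in> A" "b \<in> A" "\<pi> a = \<pi> b"
    then have "h (L.cls [a]) = h (L.cls [b])" using \<pi> by metis
    moreover have "[a] \<in> words A" "[b] \<in> words A" using ab by (auto simp: words_def)
    ultimately have "L.cls [a] = L.cls [b]" using inj[of "L.cls [a]" "L.cls [b]"] by simp
    then show "a = b" by (simp add: L.cls_eq L.singleton_notin)
  qed
  have "w \<in> I" if "w \<in> J" for w
  proof -
    define W where "W = {v \<in> words A. length v = length w}"
    have fin: "finite W"
      by (rule finite_subset[OF _ finite_lists_length_eq[OF L.finite, of "length w"]])
        (auto simp: W_def words_def)
    have injW: "inj_on (map \<pi>) W"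
      by (rule inj_on_subset[OF inj_on_mapI[of \<pi> "lists A" ]])
        (use inj_\<pi> in \<open>auto simp: W_def words_def intro: inj_on_subset\<close>)
    have "map \<pi> ` W \<subseteq> W" using map_words by (auto simp: W_def)
    then have im: "map \<pi> ` W = W" using endo_inj_surj[OF fin _ injW] by blast
    have "map \<pi> ` (W \<inter> I) = W \<inter> J"
    proof (intro equalityI subsetI)
      fix x assume "x \<in> map \<pi> ` (W \<inter> I)"
      then show "x \<in> W \<inter> J" using im iff by (auto simp: W_def)
    next
      fix x assume x: "x \<in> W \<inter> J"
      then obtain y where "y \<in> W" "x = map \<pi> y" using im by blast
      with x show "x \<in> map \<pi> ` (W \<inter> I)" using iff by (auto simp: W_def)
    qed
    then have "card (W \<inter> J) = card (W \<inter> I)"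
      using card_image[OF inj_on_subset[OF injW, of "W \<inter> I"]] by auto
    then have "W \<inter> I = W \<inter> J"
      using assms(3) fin by (intro card_subset_eq) auto
    moreover have "w \<in> W \<inter> J" using that R.ideal_sub by (auto simp: W_def)
    ultimately show ?thesis by blast
  qed
  with assms(3) show ?thesis by blast
qed

section \<open>Computing the presentations\<close>

lemma computes_Comp1: "computes g xs a \<Longrightarrow> computes f [a] z \<Longrightarrow> computes (Comp f [g]) xs z"
  by (rule computes.Comp[of "[a]"]) auto

lemma computes_Comp2:
  "computes g xs a \<Longrightarrow> computes h xs b \<Longrightarrow> computes f [a, b] z \<Longrightarrow> computes (Comp f [g, h]) xs z"
  by (rule computes.Comp[of "[a, b]"]) (auto simp: less_Suc_eq)

lemma computes_Proj: "i < length xs \<Longrightarrow> xs ! i = y \<Longrightarrow> computes (Proj i) xs y"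
  using computes.Proj by blast

primrec const_rf :: "nat \<Rightarrow> recf" where
  "const_rf 0 = Zero"
| "const_rf (Suc n) = Comp Succ [const_rf n]"

lemma computes_const: "computes (const_rf n) xs n"
  by (induction n) (auto intro: computes_Comp1 computes.intros)

definition add_rf :: recf where
  "add_rf = PrimRec (Proj 0) (Comp Succ [Proj 1])"

lemma computes_add: "computes add_rf [m, n] (m + n)"
  unfolding add_rf_def
proof (induction m)
  case 0
  show ?case by (rule computes.PrimRec_0) (auto intro: computes_Proj)
next
  case (Suc m)
  show ?case
    by (rule computes.PrimRec_Suc[OF Suc]) (auto intro!: computes_Comp1 computes_Proj computes.Succ)
qed

text \<open>Triangular numbers occur because \<open>prod_encode (a, b)\<close> is
  \<open>triangle (a + b) + a\<close>.\<close>

definition triangle_rf :: recf where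
  "triangle_rf = PrimRec Zero (Comp add_rf [Proj 1, Comp Succ [Proj 0]])"

lemma computes_triangle: "computes triangle_rf [n] (triangle n)"
  unfolding triangle_rf_def
proof (induction n)
  case 0
  show ?case by (rule computes.PrimRec_0) (auto intro: computes.Zero)
next
  case (Suc n)
  have "computes (Comp add_rf [Proj 1, Comp Succ [Proj 0]]) [n, triangle n] (triangle n + Suc n)"
    by (rule computes_Comp2[OF computes_Proj computes_Comp1[OF computes_Proj computes.Succ]
        computes_add]) auto
  then show ?case using computes.PrimRec_Suc[OF Suc] by simp
qed

definition pair_rf :: "recf \<Rightarrow> recf \<Rightarrow> recf" where
  "pair_rf f g = Comp (Comp add_rf [Comp triangle_rf [add_rf], Proj 0]) [f, g]"

lemma computes_pair:
  assumes "computes f xs a" "computes g xs b"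
  shows "computes (pair_rf f g) xs (prod_encode (a, b))"
proof -
  have "computes (Comp add_rf [Comp triangle_rf [add_rf], Proj 0]) [a, b] (triangle (a + b) + a)"
    by (rule computes_Comp2[OF computes_Comp1[OF computes_add computes_triangle] computes_Proj
        computes_add]) auto
  then show ?thesis
    unfolding pair_rf_def using assms by (auto simp: prod_encode_def intro: computes_Comp2)
qed

definition cons_rf :: "recf \<Rightarrow> recf \<Rightarrow> recf" where
  "cons_rf f g = Comp Succ [pair_rf f g]"

lemma computes_cons:
  "computes f xs a \<Longrightarrow> computes g xs (list_encode ys) \<Longrightarrow>
    computes (cons_rf f g) xs (list_encode (a # ys))"
  unfolding cons_rf_def by (auto intro: computes_Comp1 computes_pair computes.Succ)

definition replicate_rf :: "nat \<Rightarrow> recf" where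
  "replicate_rf c = PrimRec Zero (cons_rf (const_rf c) (Proj 1))"

lemma computes_replicate: "computes (replicate_rf c) [n] (list_encode (replicate n c))"
  unfolding replicate_rf_def
proof (induction n)
  case 0
  show ?case by (rule computes.PrimRec_0) (auto intro: computes.Zero)
next
  case (Suc n)
  have "computes (cons_rf (const_rf c) (Proj 1)) [n, list_encode (replicate n c)]
      (list_encode (c # replicate n c))"
    by (rule computes_cons[OF computes_const computes_Proj]) auto
  then show ?case using computes.PrimRec_Suc[OF Suc] by simp
qed

definition all_words_nfa :: "nat nfa" where
  "all_words_nfa =
     \<lparr>initial = [0], transitions = [(p, a, 1). p \<leftarrow> [0, 1], a \<leftarrow> [0, 1, 2]], final = [1]\<rparr>"

definition presentation :: "nat \<Rightarrow> lexp \<Rightarrow> lexp \<Rightarrow> nat \<Rightarrow> nat wh_input" where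
  "presentation s e e' n =
     \<lparr>letters = [0, 1, 2], automaton = all_words_nfa, grammar = lexp_cfg s e e' n\<rparr>"

text \<open>The argument has two roles: \<open>replicate_rf\<close> takes it as the number of
  repetitions in the two input productions, and \<open>Proj 0\<close> passes it on as the code of
  the remaining productions.\<close>

definition presentation_rf :: "nat \<Rightarrow> recf" where
  "presentation_rf s =
     pair_rf (const_rf (list_encode [0, 1, 2]))
       (pair_rf (const_rf (nfa_encode all_words_nfa))
         (pair_rf (const_rf s)
           (cons_rf (pair_rf (const_rf 2) (replicate_rf (sum_encode (Inl 4))))
             (cons_rf (pair_rf (const_rf 3) (replicate_rf (sum_encode (Inr (msym_encode (Letter 1))))))
               (Proj 0)))))"

lemma computes_presentation:
  assumes n: "n = list_encode (map production_encode (base_prods e e'))"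
  shows "computes (presentation_rf s) [n] (input_encode (presentation s e e' n))"
proof -
  have "computes (Proj 0) [n] (list_encode (map production_encode (base_prods e e')))"
    by (rule computes_Proj) (auto simp: n)
  then show ?thesis
    unfolding presentation_rf_def input_encode_def presentation_def cfg_encode_def lexp_cfg_def
      input_prods_def
    by (auto simp: production_encode_def simp del: list_encode.simps
        intro!: computes_pair computes_cons computes_const computes_replicate)
qed

text \<open>The \<open>PrimRec\<close> term exchanges 0 and 1. The search variable is ignored, the
  actual argument being \<open>Proj 1\<close>; the search thus succeeds immediately if
  \<open>f\<close> answers 1 and continues forever if it answers 0.\<close>

definition diagonal_rf :: "recf \<Rightarrow> recf" where
  "diagonal_rf f = Mu (Comp (PrimRec (const_rf 1) (Proj 0))
     [Comp f [Comp (presentation_rf 0) [Proj 1], Comp (presentation_rf 1) [Proj 1]]])"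

lemma diagonal_halts:
  assumes "computes (presentation_rf 0) [n] a" "computes (presentation_rf 1) [n] b"
    "computes f [a, b] (if Q then 1 else 0)"
  shows "(\<exists>y. computes (diagonal_rf f) [n] y) \<longleftrightarrow> Q"
proof -
  let ?g = "Comp (PrimRec (const_rf 1) (Proj 0))
     [Comp f [Comp (presentation_rf 0) [Proj 1], Comp (presentation_rf 1) [Proj 1]]]"
  have "computes (Comp f [Comp (presentation_rf 0) [Proj 1], Comp (presentation_rf 1) [Proj 1]])
      [m, n] (if Q then 1 else 0)" for m
    by (rule computes_Comp2[OF computes_Comp1[OF computes_Proj assms(1)]
        computes_Comp1[OF computes_Proj assms(2)] assms(3)]) auto
  moreover have "computes (PrimRec (const_rf 1) (Proj 0)) [if Q then 1 else 0] (if Q then 0 else 1)"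
  proof -
    have 0: "computes (PrimRec (const_rf 1) (Proj 0)) [0] 1"
      by (rule computes.PrimRec_0[OF computes_const])
    have "computes (PrimRec (const_rf 1) (Proj 0)) [Suc 0] 0"
      by (rule computes.PrimRec_Suc[OF 0]) (auto intro: computes_Proj)
    with 0 show ?thesis by simp
  qed
  ultimately have g: "computes ?g [m, n] (if Q then 0 else 1)" for m
    by (rule computes_Comp1)
  show ?thesis
  proof
    assume "\<exists>y. computes (diagonal_rf f) [n] y"
    then obtain y where "computes ?g [y, n] 0"
      unfolding diagonal_rf_def by (blast elim: computes_MuE)
    with g[of y] have "(if Q then 0 else 1) = (0 :: nat)" by (rule computes_deterministic)
    then show Q by (simp split: if_splits)
  next
    assume Q
    then have "computes ?g [0, n] 0" using g[of 0] by simp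
    then have "computes (diagonal_rf f) [n] 0"
      unfolding diagonal_rf_def by (intro computes.Mu) auto
    then show "\<exists>y. computes (diagonal_rf f) [n] y" by blast
  qed
qed

section \<open>Languages of multiplication words\<close>

text \<open>Multiplication words contain the product backwards, so an expression for the reversed
  ideal is required.\<close>

primrec rev_lexp :: "lexp \<Rightarrow> lexp" where
  "rev_lexp (Word w) = Word (rev w)"
| "rev_lexp (Alt a b) = Alt (rev_lexp a) (rev_lexp b)"
| "rev_lexp (Cat a b) = Cat (rev_lexp b) (rev_lexp a)"
| "rev_lexp (Lin a p q) = Lin (rev_lexp a) (rev_lexp q) (rev_lexp p)"
| "rev_lexp (Mirror a) = Mirror (rev_lexp a)"
| "rev_lexp (Hole b) = Hole b"

lemma rev_conc: "rev ` (A \<cdot> B) = rev ` B \<cdot> rev ` A"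
proof (intro equalityI subsetI)
  fix w assume "w \<in> rev ` (A \<cdot> B)"
  then obtain u v where "w = rev v @ rev u" "u \<in> A" "v \<in> B" by (auto elim!: concE)
  then show "w \<in> rev ` B \<cdot> rev ` A" by (simp add: concI)
next
  fix w assume "w \<in> rev ` B \<cdot> rev ` A"
  then obtain u v where "w = rev (u @ v)" "u \<in> A" "v \<in> B" by (auto elim!: concE)
  then show "w \<in> rev ` (A \<cdot> B)" by (simp only:) (intro imageI concI)
qed

lemma rev_lin_subset: "rev ` lin A P Q \<subseteq> lin (rev ` A) (rev ` Q) (rev ` P)"
proof
  fix w assume "w \<in> rev ` lin A P Q"
  then obtain x where "x \<in> lin A P Q" "w = rev x" by blast
  then show "w \<in> lin (rev ` A) (rev ` Q) (rev ` P)"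
  proof (induction arbitrary: w)
    case (step p x q)
    then show ?case
      using lin.step[of "rev q" "rev ` Q" "rev x" "rev ` A" "rev ` P" "rev p"] by simp
  qed (auto intro: lin.base)
qed

lemma rev_lin: "rev ` lin A P Q = lin (rev ` A) (rev ` Q) (rev ` P)"
proof (rule antisym[OF rev_lin_subset])
  have "rev ` lin (rev ` A) (rev ` Q) (rev ` P) \<subseteq> lin A P Q"
    using rev_lin_subset[of "rev ` A" "rev ` Q" "rev ` P"] by (simp add: image_image)
  then have "rev ` rev ` lin (rev ` A) (rev ` Q) (rev ` P) \<subseteq> rev ` lin A P Q" by (rule image_mono)
  then show "lin (rev ` A) (rev ` Q) (rev ` P) \<subseteq> rev ` lin A P Q" by (simp add: image_image)
qed

lemma lang_rev_lexp: "lang n (rev_lexp e) = rev ` lang n e"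
proof (induction e)
  case (Mirror a)
  show ?case
    unfolding rev_lexp.simps lang.simps Mirror
  proof (intro equalityI subsetI)
    fix w assume "w \<in> {u @ x @ rev u | u x. u \<in> lists (set ltrs) \<and> x \<in> rev ` lang n a}"
    then obtain u x where "w = u @ rev x @ rev u" and *: "u \<in> lists (set ltrs)" "x \<in> lang n a"
      by blast
    then have "w = rev (u @ x @ rev u)" by simp
    with * show "w \<in> rev ` {u @ x @ rev u | u x. u \<in> lists (set ltrs) \<and> x \<in> lang n a}" by blast
  next
    fix w assume "w \<in> rev ` {u @ x @ rev u | u x. u \<in> lists (set ltrs) \<and> x \<in> lang n a}"
    then obtain u x where "w = rev (u @ x @ rev u)" and *: "u \<in> lists (set ltrs)" "x \<in> lang n a"
      by blast
    then have "w = u @ rev x @ rev u" by simp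
    with * show "w \<in> {u @ x @ rev u | u x. u \<in> lists (set ltrs) \<and> x \<in> rev ` lang n a}" by blast
  qed
next
  case (Hole b)
  have "rev ` {replicate k c | k. k \<le> n} = {replicate k c | k. k \<le> n}" for c :: "nat msym"
    by (force simp: image_def)
  then show ?case by simp
qed (simp_all add: image_Un rev_conc rev_lin)

section \<open>Insertion of the marker that separates two factors\<close>

definition ins :: "'a msym list set \<Rightarrow> 'a msym list set" where
  "ins L = {u @ [Hash1] @ v | u v. u @ v \<in> L}"

lemma insI: "u @ v \<in> L \<Longrightarrow> u @ [Hash1] @ v \<in> ins L"
  by (auto simp: ins_def)

lemma insE:
  assumes "w \<in> ins L"
  obtains u v where "w = u @ [Hash1] @ v" "u @ v \<in> L"
  using assms by (auto simp: ins_def)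

lemma ins_mono: "A \<subseteq> B \<Longrightarrow> ins A \<subseteq> ins B"
  by (auto simp: ins_def)

lemma ins_Un: "ins (A \<union> B) = ins A \<union> ins B"
  by (auto simp: ins_def)

text \<open>A product rule, as for derivations: the marker falls into the left or into the right
  factor.\<close>

lemma ins_conc: "ins (A \<cdot> B) = ins A \<cdot> B \<union> A \<cdot> ins B"
proof (intro equalityI subsetI)
  fix w assume "w \<in> ins (A \<cdot> B)"
  then obtain u v a b where w: "w = u @ [Hash1] @ v" "u @ v = a @ b" "a \<in> A" "b \<in> B"
    by (auto elim!: insE concE)
  from w(2) consider z where "a = u @ z" "v = z @ b" | z where "u = a @ z" "b = z @ v"
    by (auto simp: append_eq_append_conv2)
  then show "w \<in> ins A \<cdot> B \<union> A \<cdot> ins B"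
  proof cases
    case 1
    then have "w = (u @ [Hash1] @ z) @ b" "u @ [Hash1] @ z \<in> ins A" using w insI[of u z A] by simp_all
    then show ?thesis using concI[OF _ w(4)] by blast
  next
    case 2
    then have "w = a @ (z @ [Hash1] @ v)" "z @ [Hash1] @ v \<in> ins B" using w insI[of z v B] by simp_all
    then show ?thesis using concI[OF w(3)] by blast
  qed
next
  fix w assume "w \<in> ins A \<cdot> B \<union> A \<cdot> ins B"
  then consider u v b where "w = u @ [Hash1] @ (v @ b)" "(u @ v) @ b \<in> A \<cdot> B"
    | a u v where "w = (a @ u) @ [Hash1] @ v" "a @ (u @ v) \<in> A \<cdot> B"
  proof
    assume "w \<in> ins A \<cdot> B"
    then obtain u v b where *: "w = (u @ [Hash1] @ v) @ b" "u @ v \<in> A" "b \<in> B"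
      by (auto elim!: insE concE)
    from concI[OF *(2,3)] *(1) show ?thesis using that(1)[of u v b] by simp
  next
    assume "w \<in> A \<cdot> ins B"
    then obtain a u v where *: "w = a @ (u @ [Hash1] @ v)" "a \<in> A" "u @ v \<in> B"
      by (auto elim!: insE concE)
    from concI[OF *(2,3)] *(1) show ?thesis using that(2)[of a u v] by simp
  qed
  then show "w \<in> ins (A \<cdot> B)"
  proof cases
    case 1
    show ?thesis unfolding 1(1) by (rule insI) (use 1(2) in simp)
  next
    case 2
    show ?thesis unfolding 2(1) by (rule insI) (use 2(2) in simp)
  qed
qed

text \<open>Applying the product rule to \<open>X = A \<union> P \<cdot> X \<cdot> Q\<close> gives
  an equation of the same kind for \<open>ins X\<close>: the term
  \<open>P \<cdot> ins X \<cdot> Q\<close> keeps the recursion, and all others, which contain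
  \<open>X\<close> without a marker, join the core.\<close>

lemma ins_lin: "ins (lin A P Q) =
  lin (ins A \<union> (ins P \<cdot> lin A P Q \<cdot> Q \<union> P \<cdot> lin A P Q \<cdot> ins Q)) P Q" (is "_ = lin ?B P Q")
proof (intro equalityI subsetI)
  fix w assume "w \<in> ins (lin A P Q)"
  then obtain x where x: "x \<in> lin A P Q" "w \<in> ins {x}" by (auto simp: ins_def)
  then show "w \<in> lin ?B P Q"
  proof (induction arbitrary: w)
    case (base x)
    then have "w \<in> ins A" using ins_mono[of "{x}" A] by blast
    then show ?case by (intro lin.base) blast
  next
    case (step p x q)
    have "{p @ x @ q} = {p} \<cdot> {x} \<cdot> {q}" by (simp add: conc_def)
    then have "w \<in> ins {p} \<cdot> {x} \<cdot> {q} \<union> {p} \<cdot> (ins {x} \<cdot> {q} \<union> {x} \<cdot> ins {q})"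
      using step.prems by (simp add: ins_conc)
    then consider "w \<in> ins {p} \<cdot> {x} \<cdot> {q}" | "w \<in> {p} \<cdot> ins {x} \<cdot> {q}" | "w \<in> {p} \<cdot> {x} \<cdot> ins {q}"
      by (auto simp: conc_def)
    then show ?case
    proof cases
      case 1
      moreover have "ins {p} \<cdot> {x} \<cdot> {q} \<subseteq> ins P \<cdot> lin A P Q \<cdot> Q"
        using step.hyps by (intro conc_mono ins_mono) auto
      ultimately show ?thesis by (intro lin.base) blast
    next
      case 2
      then obtain y where "w = p @ y @ q" "y \<in> ins {x}" by (auto elim!: concE)
      then show ?thesis using lin.step step.hyps step.IH by metis
    next
      case 3
      moreover have "{p} \<cdot> {x} \<cdot> ins {q} \<subseteq> P \<cdot> lin A P Q \<cdot> ins Q"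
        using step.hyps by (intro conc_mono ins_mono) auto
      ultimately show ?thesis by (intro lin.base) blast
    qed
  qed
next
  have "P \<cdot> lin A P Q \<cdot> Q \<subseteq> lin A P Q" by (auto elim!: concE intro: lin.step)
  from ins_mono[OF this]
  have sub: "ins P \<cdot> lin A P Q \<cdot> Q \<union> P \<cdot> (ins (lin A P Q) \<cdot> Q \<union> lin A P Q \<cdot> ins Q) \<subseteq> ins (lin A P Q)"
    by (simp add: ins_conc)
  have conc_Un: "X \<cdot> (Y \<union> Z) = X \<cdot> Y \<union> X \<cdot> Z" for X Y Z :: "'a msym list set"
    by (auto simp: conc_def)
  fix w assume "w \<in> lin ?B P Q"
  then show "w \<in> ins (lin A P Q)"
  proof induction
    case (base x)
    moreover have "ins A \<subseteq> ins (lin A P Q)" by (rule ins_mono) (auto intro: lin.base)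
    ultimately show ?case using sub unfolding conc_Un by blast
  next
    case (step p x q)
    then have "p @ x @ q \<in> P \<cdot> ins (lin A P Q) \<cdot> Q" by (intro concI)
    then show ?case using sub unfolding conc_Un by blast
  qed
qed

primrec ins_word :: "nat msym list \<Rightarrow> lexp" where
  "ins_word [] = Word [Hash1]"
| "ins_word (c # w) = Alt (Word (Hash1 # c # w)) (Cat (Word [c]) (ins_word w))"

text \<open>The values on \<^const>\<open>Mirror\<close> and \<^const>\<open>Hole\<close> are junk.\<close>

primrec ins_lexp :: "lexp \<Rightarrow> lexp" where
  "ins_lexp (Word w) = ins_word w"
| "ins_lexp (Alt a b) = Alt (ins_lexp a) (ins_lexp b)"
| "ins_lexp (Cat a b) = Alt (Cat (ins_lexp a) b) (Cat a (ins_lexp b))"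
| "ins_lexp (Lin a p q) =
     Lin (Alt (ins_lexp a)
       (Alt (Cat (ins_lexp p) (Cat (Lin a p q) q)) (Cat p (Cat (Lin a p q) (ins_lexp q))))) p q"
| "ins_lexp (Mirror a) = Mirror a"
| "ins_lexp (Hole b) = Hole b"

lemma lang_ins_word: "lang n (ins_word w) = ins {w}"
proof (induction w)
  case Nil
  show ?case by (simp add: ins_def)
next
  case (Cons c w)
  have "{c # w} = {[c]} \<cdot> {w}" by (simp add: conc_def)
  then have "ins {c # w} = ins {[c]} \<cdot> {w} \<union> {[c]} \<cdot> ins {w}" by (simp add: ins_conc)
  moreover have "ins {[c]} = {[Hash1, c], [c, Hash1]}"
  proof (intro equalityI subsetI)
    fix x assume "x \<in> {[Hash1, c], [c, Hash1]}"
    then show "x \<in> ins {[c]}"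
      using insI[of "[c]" "[]" "{[c]}"] insI[of "[]" "[c]" "{[c]}"] by auto
  qed (auto elim!: insE simp: append_eq_Cons_conv)
  moreover have "[c, Hash1] @ w \<in> {[c]} \<cdot> ins {w}"
    using concI[OF singletonI insI[of "[]" w "{w}"], of "[c]"] by simp
  ultimately show ?case using Cons by (auto simp: conc_def)
qed

lemma lang_ins_lexp: "bits e \<Longrightarrow> lang n (ins_lexp e) = ins (lang n e)"
  by (induction e) (simp_all add: lang_ins_word ins_conc ins_Un ins_lin)

abbreviation digits :: "nat set" where
  "digits \<equiv> {0, 1, 2}"

primrec over :: "lexp \<Rightarrow> bool" where
  "over (Word w) \<longleftrightarrow> set w \<subseteq> msyms digits"
| "over (Alt a b) \<longleftrightarrow> over a \<and> over b"
| "over (Cat a b) \<longleftrightarrow> over a \<and> over b"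
| "over (Lin a p q) \<longleftrightarrow> over a \<and> over p \<and> over q"
| "over (Mirror a) \<longleftrightarrow> over a"
| "over (Hole b) \<longleftrightarrow> True"

lemma over_bits: "bits e \<Longrightarrow> over e"
  by (induction e) auto

lemma over_rev: "over e \<Longrightarrow> over (rev_lexp e)"
  by (induction e) auto

lemma over_ins_word: "set w \<subseteq> msyms digits \<Longrightarrow> over (ins_word w)"
  by (induction w) auto

lemma over_ins: "over e \<Longrightarrow> over (ins_lexp e)"
  by (induction e) (auto simp: over_ins_word)

lemma over_prods: "over e \<Longrightarrow> (X, w) \<in> set (prods e) \<Longrightarrow> Inr t \<in> set w \<Longrightarrow> t \<in> msyms digits"
  by (induction e) (auto simp: ltrs_def simp del: nonterm.simps)

lemma cfg_over_lexp:
  assumes "over e" "over e'"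
  shows "cfg_over (msyms digits) (lexp_cfg s e e' n)"
  using over_prods assms
  by (fastforce simp: cfg_over_def lexp_cfg_def input_prods_def base_prods_def
      simp del: nonterm.simps)

lemma bits_lang: "bits e \<Longrightarrow> lang n e \<subseteq> lists {Letter 0, Letter 1}"
proof (induction e)
  case (Cat a b)
  show ?case
  proof
    fix w assume "w \<in> lang n (Cat a b)"
    then obtain u v where "w = u @ v" "u \<in> lang n a" "v \<in> lang n b" by (auto elim!: concE)
    moreover from this Cat have "u \<in> lists {Letter 0, Letter 1}" "v \<in> lists {Letter 0, Letter 1}"
      by auto
    ultimately show "w \<in> lists {Letter 0, Letter 1}" by simp
  qed
next
  case (Lin a p q)
  have "w \<in> lists {Letter 0, Letter 1}" if "w \<in> lin (lang n a) (lang n p) (lang n q)" for w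
    using that
  proof induction
    case (step u x v)
    then have "u \<in> lists {Letter 0, Letter 1}" "v \<in> lists {Letter 0, Letter 1}" using Lin by auto
    with step.IH show ?case by simp
  qed (use Lin in auto)
  then show ?case by auto
qed (auto elim!: concE)

section \<open>Ideals and their multiplication words\<close>

definition letter :: lexp where
  "letter = Alt (Word [Letter 0]) (Alt (Word [Letter 1]) (Word [Letter 2]))"

definition anything :: lexp where
  "anything = Lin (Word []) letter (Word [])"

lemma lang_letter: "lang n letter = {[c] | c. c \<in> set ltrs}"
  by (auto simp: letter_def ltrs_def)

lemma lang_anything: "lang n anything = lists (set ltrs)"
proof (intro equalityI subsetI)
  fix w assume "w \<in> lang n anything"
  then have "w \<in> lin {[]} {[c] | c. c \<in> set ltrs} {[]}" by (simp add: anything_def lang_letter)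
  then show "w \<in> lists (set ltrs)" by induction auto
next
  fix w assume "w \<in> lists (set ltrs)"
  then have "w \<in> lin {[]} {[c] | c. c \<in> set ltrs} {[]}"
  proof induction
    case (Cons c w)
    then have "[c] @ w @ [] \<in> lin {[]} {[c] | c. c \<in> set ltrs} {[]}"
      by (intro lin.step) auto
    then show ?case by simp
  qed (simp add: lin.base)
  then show "w \<in> lang n anything" by (simp add: anything_def lang_letter)
qed

definition anything1 :: lexp where
  "anything1 = Cat letter anything"

definition ideal_lexp :: "lexp \<Rightarrow> lexp" where
  "ideal_lexp k =
     Cat anything (Cat (Word [Letter 2]) (Cat k (Cat (Word [Letter 2]) anything)))"

text \<open>The marker lies to the left of a generator \<open>2 w 2\<close>, to the right of it, or
  between its two letters 2. Both factors have to be non-empty: \<open>anything1\<close> ensures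
  this in the first two cases, the letters 2 in the third.\<close>

definition split_lexp :: "lexp \<Rightarrow> lexp \<Rightarrow> lexp" where
  "split_lexp k ik =
     Alt (Cat anything1 (Cat (Word [Hash1]) (ideal_lexp k)))
       (Alt (Cat (ideal_lexp k) (Cat (Word [Hash1]) anything1))
         (ideal_lexp ik))"

definition mirror1 :: "lexp \<Rightarrow> lexp" where
  "mirror1 e =
     Alt (Cat (Word [Letter 0]) (Cat (Mirror e) (Word [Letter 0])))
       (Alt (Cat (Word [Letter 1]) (Cat (Mirror e) (Word [Letter 1])))
         (Cat (Word [Letter 2]) (Cat (Mirror e) (Word [Letter 2]))))"

text \<open>Equality as words is expressed by the nested palindromes
  \<open>u Hash1 v Hash2 rev v rev u\<close>. Equality to zero relates \<open>w\<close> to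
  \<open>u\<close> and \<open>v\<close> only through membership in the ideal, so there a product of
  two independent languages is enough.\<close>

definition mult_lexp :: "lexp \<Rightarrow> lexp \<Rightarrow> lexp" where
  "mult_lexp k ik =
     Alt (mirror1 (Cat (Word [Hash1]) (mirror1 (Word [Hash2]))))
       (Cat (split_lexp k ik) (Cat (Word [Hash2]) (rev_lexp (ideal_lexp k))))"

lemma over_mult_lexp: "over k \<Longrightarrow> over ik \<Longrightarrow> over (mult_lexp k ik)"
  by (simp add: mult_lexp_def split_lexp_def mirror1_def ideal_lexp_def letter_def anything_def
      anything1_def over_rev)

lemma lang_ideal: "lang n (ideal_lexp k) =
  {x @ [Letter 2] @ w @ [Letter 2] @ y | x w y.
    x \<in> lists (set ltrs) \<and> w \<in> lang n k \<and> y \<in> lists (set ltrs)}" (is "_ = ?R")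
proof (intro equalityI subsetI)
  fix z assume "z \<in> lang n (ideal_lexp k)"
  then obtain x w y where "z = x @ [Letter 2] @ w @ [Letter 2] @ y"
    "x \<in> lists (set ltrs)" "w \<in> lang n k" "y \<in> lists (set ltrs)"
    unfolding ideal_lexp_def lang.simps lang_anything by (elim concE singletonE) blast
  then show "z \<in> ?R" by blast
next
  fix z assume "z \<in> ?R"
  then obtain x w y where z: "z = x @ [Letter 2] @ w @ [Letter 2] @ y"
    "x \<in> lists (set ltrs)" "w \<in> lang n k" "y \<in> lists (set ltrs)" by blast
  show "z \<in> lang n (ideal_lexp k)"
    unfolding ideal_lexp_def lang.simps lang_anything z(1)
    by (intro concI z(2-4) singletonI)
qed

lemma lang_wrap:
  "w \<in> lang n (Cat (Word [c]) (Cat (Mirror e) (Word [c]))) \<longleftrightarrow>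
    (\<exists>u x. w = (c # u) @ x @ rev (c # u) \<and> u \<in> lists (set ltrs) \<and> x \<in> lang n e)" (is "?l \<longleftrightarrow> ?r")
proof
  assume ?l
  then obtain z where "w = [c] @ z @ [c]" "z \<in> lang n (Mirror e)"
    unfolding lang.simps(1,3) by (elim concE singletonE) blast
  then obtain u x where "w = (c # u) @ x @ rev (c # u)" "u \<in> lists (set ltrs)" "x \<in> lang n e"
    by auto
  then show ?r by blast
next
  assume ?r
  then obtain u x where w: "w = [c] @ (u @ x @ rev u) @ [c]" "u \<in> lists (set ltrs)" "x \<in> lang n e"
    by auto
  then have "u @ x @ rev u \<in> lang n (Mirror e)" unfolding lang.simps by blast
  then show ?l unfolding w(1) lang.simps(1,3) by (intro concI singletonI)
qed

lemma ex_ltrs: "(\<exists>c\<in>set ltrs. P c) \<longleftrightarrow> P (Letter 0) \<or> P (Letter 1) \<or> P (Letter 2)"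
  by (simp add: ltrs_def)

lemma lang_mirror1:
  "w \<in> lang n (mirror1 e) \<longleftrightarrow>
    (\<exists>u x. w = u @ x @ rev u \<and> (u \<in> lists (set ltrs) \<and> u \<noteq> []) \<and> x \<in> lang n e)"
proof -
  have "w \<in> lang n (mirror1 e) \<longleftrightarrow> (\<exists>c\<in>set ltrs. \<exists>u x. w = (c # u) @ x @ rev (c # u) \<and>
      u \<in> lists (set ltrs) \<and> x \<in> lang n e)"
    unfolding mirror1_def lang.simps(2) Un_iff lang_wrap ex_ltrs ..
  also have "\<dots> \<longleftrightarrow>
      (\<exists>u x. w = u @ x @ rev u \<and> (u \<in> lists (set ltrs) \<and> u \<noteq> []) \<and> x \<in> lang n e)"
  proof
    assume "\<exists>u x. w = u @ x @ rev u \<and> (u \<in> lists (set ltrs) \<and> u \<noteq> []) \<and> x \<in> lang n e"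
    then obtain u x where *: "w = u @ x @ rev u" "u \<in> lists (set ltrs)" "u \<noteq> []" "x \<in> lang n e"
      by blast
    then obtain c v where "u = c # v" by (cases u) auto
    with * show "\<exists>c\<in>set ltrs. \<exists>u x. w = (c # u) @ x @ rev (c # u) \<and>
      u \<in> lists (set ltrs) \<and> x \<in> lang n e" by auto
  next
    assume "\<exists>c\<in>set ltrs. \<exists>u x. w = (c # u) @ x @ rev (c # u) \<and>
      u \<in> lists (set ltrs) \<and> x \<in> lang n e"
    then obtain c u x where "w = (c # u) @ x @ rev (c # u)" "c # u \<in> lists (set ltrs)" "x \<in> lang n e"
      by auto
    then show "\<exists>u x. w = u @ x @ rev u \<and> (u \<in> lists (set ltrs) \<and> u \<noteq> []) \<and> x \<in> lang n e" by blast
  qed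
  finally show ?thesis .
qed

lemma lang_anything1: "lang n anything1 = {w \<in> lists (set ltrs). w \<noteq> []}"
proof (intro equalityI subsetI)
  fix w assume "w \<in> {w \<in> lists (set ltrs). w \<noteq> []}"
  then obtain c v where "w = [c] @ v" "c \<in> set ltrs" "v \<in> lists (set ltrs)" by (cases w) auto
  then show "w \<in> lang n anything1"
    unfolding anything1_def lang.simps lang_letter lang_anything by (simp only:) (intro concI; blast)
qed (auto simp: anything1_def lang_letter lang_anything elim!: concE)

lemma Letter2_in: "Letter 2 \<in> set ltrs"
  by (simp add: ltrs_def)

lemma ideal_words:
  assumes "lang n k \<subseteq> lists (set ltrs)"
  shows "lang n (ideal_lexp k) \<subseteq> {w. w \<in> lists (set ltrs) \<and> w \<noteq> []}"
proof
  fix z assume "z \<in> lang n (ideal_lexp k)"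
  then obtain x w y where "z = x @ [Letter 2] @ w @ [Letter 2] @ y"
    "x \<in> lists (set ltrs)" "w \<in> lists (set ltrs)" "y \<in> lists (set ltrs)"
    using assms unfolding lang_ideal by blast
  then show "z \<in> {w. w \<in> lists (set ltrs) \<and> w \<noteq> []}" using Letter2_in by simp
qed

lemma lang_split:
  assumes "lang n k \<subseteq> lists (set ltrs)" "lang n ik = ins (lang n k)"
  shows "lang n (split_lexp k ik) = {u @ [Hash1] @ v | u v. u \<in> lists (set ltrs) \<and> u \<noteq> [] \<and>
    v \<in> lists (set ltrs) \<and> v \<noteq> [] \<and> u @ v \<in> lang n (ideal_lexp k)}" (is "_ = ?R")
proof (intro equalityI subsetI)
  have ideal_nonempty: "[] \<notin> lang n (ideal_lexp k)"
    and ideal_letters: "lang n (ideal_lexp k) \<subseteq> lists (set ltrs)"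
    using ideal_words[OF assms(1)] by auto
  have ideal_l: "u @ w \<in> lang n (ideal_lexp k)"
    if w: "w \<in> lang n (ideal_lexp k)" and u: "u \<in> lists (set ltrs)" for u w
  proof -
    obtain x t y where "w = x @ [Letter 2] @ t @ [Letter 2] @ y"
      "x \<in> lists (set ltrs)" "t \<in> lang n k" "y \<in> lists (set ltrs)"
      using w unfolding lang_ideal by blast
    then have "u @ w = (u @ x) @ [Letter 2] @ t @ [Letter 2] @ y"
      "u @ x \<in> lists (set ltrs)" "t \<in> lang n k" "y \<in> lists (set ltrs)"
      using u by auto
    then show ?thesis unfolding lang_ideal by blast
  qed
  have ideal_r: "w @ u \<in> lang n (ideal_lexp k)"
    if w: "w \<in> lang n (ideal_lexp k)" and u: "u \<in> lists (set ltrs)" for u w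
  proof -
    obtain x t y where "w = x @ [Letter 2] @ t @ [Letter 2] @ y"
      "x \<in> lists (set ltrs)" "t \<in> lang n k" "y \<in> lists (set ltrs)"
      using w unfolding lang_ideal by blast
    then have "w @ u = x @ [Letter 2] @ t @ [Letter 2] @ (y @ u)"
      "x \<in> lists (set ltrs)" "t \<in> lang n k" "y @ u \<in> lists (set ltrs)"
      using u by auto
    then show ?thesis unfolding lang_ideal by blast
  qed
  {
    fix w assume "w \<in> lang n (split_lexp k ik)"
    then consider "w \<in> lang n (Cat anything1 (Cat (Word [Hash1]) (ideal_lexp k)))"
      | "w \<in> lang n (Cat (ideal_lexp k) (Cat (Word [Hash1]) anything1))"
      | "w \<in> lang n (ideal_lexp ik)"
      unfolding split_lexp_def lang.simps(2) by blast
    then show "w \<in> ?R"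
    proof cases
      case 1
      then obtain u v where "w = u @ [Hash1] @ v" "u \<in> lists (set ltrs)" "u \<noteq> []"
        "v \<in> lang n (ideal_lexp k)"
        unfolding lang.simps(1,3) lang_anything1 by (elim concE singletonE) blast
      moreover from this have "v \<in> lists (set ltrs)" "v \<noteq> []" "u @ v \<in> lang n (ideal_lexp k)"
        using ideal_nonempty ideal_letters ideal_l by auto
      ultimately show ?thesis by blast
    next
      case 2
      then obtain u v where "w = u @ [Hash1] @ v" "v \<in> lists (set ltrs)" "v \<noteq> []"
        "u \<in> lang n (ideal_lexp k)"
        unfolding lang.simps(1,3) lang_anything1 by (elim concE singletonE) blast
      moreover from this have "u \<in> lists (set ltrs)" "u \<noteq> []" "u @ v \<in> lang n (ideal_lexp k)"
        using ideal_nonempty ideal_letters ideal_r by auto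
      ultimately show ?thesis by blast
    next
      case 3
      then obtain x t y where w: "w = x @ [Letter 2] @ t @ [Letter 2] @ y"
        "x \<in> lists (set ltrs)" "t \<in> ins (lang n k)" "y \<in> lists (set ltrs)"
        unfolding lang_ideal assms(2) by blast
      then obtain a b where ab: "t = a @ [Hash1] @ b" "a @ b \<in> lang n k" by (auto elim: insE)
      then have "a @ b \<in> lists (set ltrs)" using assms(1) by blast
      then have "w = (x @ [Letter 2] @ a) @ [Hash1] @ (b @ [Letter 2] @ y)"
        "x @ [Letter 2] @ a \<in> lists (set ltrs)" "b @ [Letter 2] @ y \<in> lists (set ltrs)"
        using w ab Letter2_in by auto
      moreover have "(x @ [Letter 2] @ a) @ (b @ [Letter 2] @ y) \<in> lang n (ideal_lexp k)"
      proof -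
        have "(x @ [Letter 2] @ a) @ (b @ [Letter 2] @ y) = x @ [Letter 2] @ (a @ b) @ [Letter 2] @ y"
          by simp
        then show ?thesis unfolding lang_ideal using w ab(2) by blast
      qed
      ultimately show ?thesis by blast
    qed
  }
  fix w assume "w \<in> ?R"
  then obtain u v where w: "w = u @ [Hash1] @ v" and u: "u \<in> lists (set ltrs)" "u \<noteq> []" and
    v: "v \<in> lists (set ltrs)" "v \<noteq> []" and "u @ v \<in> lang n (ideal_lexp k)" by blast
  then obtain x t y where e: "u @ v = x @ [Letter 2] @ t @ [Letter 2] @ y" and
    xty: "x \<in> lists (set ltrs)" "t \<in> lang n k" "y \<in> lists (set ltrs)"
    unfolding lang_ideal by blast
  have left: "w \<in> lang n (split_lexp k ik)" if "v \<in> lang n (ideal_lexp k)"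
  proof -
    have "u \<in> lang n anything1" using u by (simp add: lang_anything1)
    from concI[OF this concI[OF singletonI that]]
    show ?thesis unfolding w split_lexp_def lang.simps(1-3) by blast
  qed
  have right: "w \<in> lang n (split_lexp k ik)" if "u \<in> lang n (ideal_lexp k)"
  proof -
    have "v \<in> lang n anything1" using v by (simp add: lang_anything1)
    from concI[OF that concI[OF singletonI this]]
    show ?thesis unfolding w split_lexp_def lang.simps(1-3) by blast
  qed
  \<comment> \<open>The cut between \<open>u\<close> and \<open>v\<close> is located relative to the
    two letters 2 of the generator, here relative to the first one.\<close>
  from e consider x' where "x = u @ x'" "v = x' @ [Letter 2] @ t @ [Letter 2] @ y"
    | z where "u = x @ Letter 2 # z" "z @ v = t @ [Letter 2] @ y"
    by (auto simp: append_eq_append_conv2 append_eq_Cons_conv)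
  then show "w \<in> lang n (split_lexp k ik)"
  proof cases
    case 1
    have "v \<in> lang n (ideal_lexp k)" unfolding lang_ideal using 1 xty by auto
    then show ?thesis by (rule left)
  next
    case 2
    then consider t' where "t = z @ t'" "v = t' @ [Letter 2] @ y"
      | z' where "z = t @ Letter 2 # z'" "y = z' @ v"
      by (auto simp: append_eq_append_conv2 append_eq_Cons_conv)
    then show ?thesis
    proof cases
      case 1
      then have "w = x @ [Letter 2] @ (z @ [Hash1] @ t') @ [Letter 2] @ y"
        using w 2 by simp
      moreover have "z @ [Hash1] @ t' \<in> ins (lang n k)" using insI[of z t'] xty(2) 1 by simp
      ultimately have "w \<in> lang n (ideal_lexp ik)" unfolding lang_ideal assms(2) using xty by blast
      then show ?thesis unfolding split_lexp_def by simp
    next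
      case rest: 2
      then have "u = x @ [Letter 2] @ t @ [Letter 2] @ z'" "z' \<in> lists (set ltrs)"
        using 2 xty rest by auto
      then have "u \<in> lang n (ideal_lexp k)" unfolding lang_ideal using xty by blast
      then show ?thesis by (rule right)
    qed
  qed
qed

lemma lists_ltrs: "w \<in> lists (set ltrs) \<longleftrightarrow> (\<exists>v\<in>lists digits. w = map Letter v)"
proof
  assume "w \<in> lists (set ltrs)"
  then show "\<exists>v\<in>lists digits. w = map Letter v"
  proof induction
    case (Cons c w)
    then obtain v d where "v \<in> lists digits" "w = map Letter v" "c = Letter d" "d \<in> digits"
      by (auto simp: ltrs_def)
    then show ?case by (intro bexI[of _ "d # v"]) auto
  qed auto
qed (auto simp: ltrs_def)

definition word_ideal :: "nat msym list set \<Rightarrow> nat list set" where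
  "word_ideal L = {w \<in> words digits. map Letter w \<in> L}"

lemma ltrs_words: "w \<in> lists (set ltrs) \<and> w \<noteq> [] \<longleftrightarrow> (\<exists>v\<in>words digits. w = map Letter v)"
  unfolding lists_ltrs words_def by auto

lemma lang_mult_lexp:
  assumes "lang n k \<subseteq> lists (set ltrs)" "lang n ik = ins (lang n k)"
  shows "lang n (mult_lexp k ik) = {mult_word u v w | u v w.
    u \<in> words digits \<and> v \<in> words digits \<and> w \<in> words digits \<and>
    (u @ v = w \<or> u @ v \<in> word_ideal (lang n (ideal_lexp k)) \<and> w \<in> word_ideal (lang n (ideal_lexp k)))}"
proof -
  let ?I = "lang n (ideal_lexp k)"
  have M1: "lang n (mirror1 (Cat (Word [Hash1]) (mirror1 (Word [Hash2])))) =
    {mult_word u v w | u v w. u \<in> words digits \<and> v \<in> words digits \<and> u @ v = w}" (is "?L = ?R")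
  proof -
    have inner: "z \<in> lang n (Cat (Word [Hash1]) (mirror1 (Word [Hash2]))) \<longleftrightarrow>
        (\<exists>v. z = [Hash1] @ v @ [Hash2] @ rev v \<and> v \<in> lists (set ltrs) \<and> v \<noteq> [])" for z
      by (auto simp: conc_def lang_mirror1)
    have "x \<in> ?L \<longleftrightarrow> (\<exists>u v. (u \<in> lists (set ltrs) \<and> u \<noteq> []) \<and> (v \<in> lists (set ltrs) \<and> v \<noteq> []) \<and>
        x = u @ ([Hash1] @ v @ [Hash2] @ rev v) @ rev u)" for x
      unfolding lang_mirror1[of _ _ "Cat _ _"] inner by blast
    moreover have "(\<exists>u v. (u \<in> lists (set ltrs) \<and> u \<noteq> []) \<and> (v \<in> lists (set ltrs) \<and> v \<noteq> []) \<and>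
        x = u @ ([Hash1] @ v @ [Hash2] @ rev v) @ rev u) \<longleftrightarrow>
      (\<exists>u\<in>words digits. \<exists>v\<in>words digits. x = map Letter u @ ([Hash1] @ map Letter v @ [Hash2] @
        rev (map Letter v)) @ rev (map Letter u))" for x
      unfolding ltrs_words by blast
    moreover have "map Letter u @ ([Hash1] @ map Letter v @ [Hash2] @ rev (map Letter v)) @
        rev (map Letter u) = mult_word u v (u @ v)" for u v :: "nat list"
      by (simp add: mult_word_def rev_map)
    ultimately have "x \<in> ?L \<longleftrightarrow> (\<exists>u\<in>words digits. \<exists>v\<in>words digits. x = mult_word u v (u @ v))" for x
      by simp
    then show ?thesis by blast
  qed
  have M2: "lang n (Cat (split_lexp k ik) (Cat (Word [Hash2]) (rev_lexp (ideal_lexp k)))) =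
    {mult_word u v w | u v w. u \<in> words digits \<and> v \<in> words digits \<and>
      u @ v \<in> word_ideal ?I \<and> w \<in> word_ideal ?I}" (is "?L = ?R")
  proof -
    note I = ideal_words[OF assms(1)]
    have "x \<in> ?L \<longleftrightarrow> (\<exists>u v w. (u \<in> lists (set ltrs) \<and> u \<noteq> []) \<and> (v \<in> lists (set ltrs) \<and> v \<noteq> []) \<and>
        (w \<in> lists (set ltrs) \<and> w \<noteq> []) \<and> u @ v \<in> ?I \<and> w \<in> ?I \<and>
        x = (u @ [Hash1] @ v) @ [Hash2] @ rev w)" (is "_ \<longleftrightarrow> ?P x") for x
    proof
      assume "x \<in> ?L"
      then obtain s w where s: "x = s @ [Hash2] @ rev w" "s \<in> lang n (split_lexp k ik)" "w \<in> ?I"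
        unfolding lang.simps(1,3) lang_rev_lexp by (elim concE singletonE imageE) blast
      obtain u v where "s = u @ [Hash1] @ v" "u \<in> lists (set ltrs) \<and> u \<noteq> []"
        "v \<in> lists (set ltrs) \<and> v \<noteq> []" "u @ v \<in> ?I"
        using s(2) unfolding lang_split[OF assms] by blast
      with s I show "?P x" by blast
    next
      assume "?P x"
      then obtain u v w where x: "x = (u @ [Hash1] @ v) @ [Hash2] @ rev w" "w \<in> ?I"
        "u @ [Hash1] @ v \<in> lang n (split_lexp k ik)"
        unfolding lang_split[OF assms] by blast
      show "x \<in> ?L" unfolding x(1) lang.simps(1,3) lang_rev_lexp
        by (intro concI singletonI imageI x(2,3))
    qed
    moreover have "?P x \<longleftrightarrow> (\<exists>u\<in>words digits. \<exists>v\<in>words digits. \<exists>w\<in>words digits.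
        map Letter u @ map Letter v \<in> ?I \<and> map Letter w \<in> ?I \<and>
        x = (map Letter u @ [Hash1] @ map Letter v) @ [Hash2] @ rev (map Letter w))" for x
      unfolding ltrs_words by blast
    moreover have "(map Letter u @ [Hash1] @ map Letter v) @ [Hash2] @ rev (map Letter w) =
        mult_word u v w" for u v w :: "nat list"
      by (simp add: mult_word_def rev_map)
    ultimately have "x \<in> ?L \<longleftrightarrow> (\<exists>u\<in>words digits. \<exists>v\<in>words digits. \<exists>w\<in>words digits.
        map Letter (u @ v) \<in> ?I \<and> map Letter w \<in> ?I \<and> x = mult_word u v w)" for x
      unfolding map_append by simp
    then show ?thesis using words_append[of _ digits] unfolding word_ideal_def by blast
  qed
  have "word_ideal ?I \<subseteq> words digits" by (auto simp: word_ideal_def)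
  then show ?thesis
    unfolding mult_lexp_def lang.simps(2) M1 M2 using words_append[of _ digits] by blast
qed

lemma regular_words: "nfa_lang all_words_nfa = words digits"
proof -
  have trans: "(p, a, q) \<in> set (transitions all_words_nfa) \<longleftrightarrow> p \<in> {0, 1} \<and> a \<in> digits \<and> q = 1" for p a q
    by (auto simp: all_words_nfa_def)
  have 1: "nfa_run all_words_nfa (Suc 0) w q \<longleftrightarrow> w \<in> lists digits \<and> q = 1" for w q
    by (induction w) (auto simp: trans)
  have "nfa_run all_words_nfa 0 w 1 \<longleftrightarrow> w \<in> words digits" for w
    by (cases w) (auto simp: trans 1 words_def)
  then show ?thesis by (auto simp: nfa_lang_def all_words_nfa_def)
qed

lemma regular_over_words: "regular_over digits (words digits)"
  unfolding regular_over_def using regular_words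
  by (intro exI[of _ all_words_nfa]) (auto simp: nfa_over_def all_words_nfa_def)

text \<open>A word \<open>t\<close> of \<open>lang n k\<close> puts \<open>2 t 2\<close> into the
  ideal, and the two letters 2 of a generator give the length bound.\<close>

lemma rees_word_ideal:
  assumes "inj \<iota>" "lang n k \<subseteq> lists (set ltrs)" "lang n k \<noteq> {}"
  shows "rees_quotient \<iota> digits (word_ideal (lang n (ideal_lexp k)))"
proof
  show "inj \<iota>" by (rule assms)
  show "finite digits" "digits \<noteq> {}" by auto
  show "word_ideal (lang n (ideal_lexp k)) \<subseteq> words digits" by (auto simp: word_ideal_def)
  obtain t where t: "t \<in> lang n k" using assms(3) by blast
  then have "[Letter 2] @ t @ [Letter 2] \<in> lists (set ltrs)"
    using assms(2) Letter2_in by auto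
  then obtain v where "v \<in> lists digits" "[Letter 2] @ t @ [Letter 2] = map Letter v"
    unfolding lists_ltrs by blast
  moreover have "[] @ [Letter 2] @ t @ [Letter 2] @ [] \<in> lang n (ideal_lexp k)"
    unfolding lang_ideal using t by blast
  ultimately have "v \<in> word_ideal (lang n (ideal_lexp k))" by (auto simp: word_ideal_def words_def)
  then show "word_ideal (lang n (ideal_lexp k)) \<noteq> {}" by blast
next
  fix w u assume w: "w \<in> word_ideal (lang n (ideal_lexp k))" and u: "u \<in> lists digits"
  then obtain x t y where *: "map Letter w = x @ [Letter 2] @ t @ [Letter 2] @ y"
      "x \<in> lists (set ltrs)" "t \<in> lang n k" "y \<in> lists (set ltrs)"
    unfolding word_ideal_def lang_ideal by blast
  have u': "map Letter u \<in> lists (set ltrs)" using u lists_ltrs by blast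
  have "map Letter (u @ w) = (map Letter u @ x) @ [Letter 2] @ t @ [Letter 2] @ y"
    "map Letter (w @ u) = x @ [Letter 2] @ t @ [Letter 2] @ (y @ map Letter u)"
    "map Letter u @ x \<in> lists (set ltrs)" "y @ map Letter u \<in> lists (set ltrs)"
    using * u' by auto
  then have "map Letter (u @ w) \<in> lang n (ideal_lexp k)" "map Letter (w @ u) \<in> lang n (ideal_lexp k)"
    unfolding lang_ideal using * by blast+
  moreover have "u @ w \<in> words digits" "w @ u \<in> words digits"
    using w u by (auto simp: word_ideal_def words_def)
  ultimately show "u @ w \<in> word_ideal (lang n (ideal_lexp k)) \<and> w @ u \<in> word_ideal (lang n (ideal_lexp k))"
    by (simp add: word_ideal_def)
next
  fix w assume "w \<in> word_ideal (lang n (ideal_lexp k))"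
  then obtain x t y where "map Letter w = x @ [Letter 2] @ t @ [Letter 2] @ y"
    unfolding word_ideal_def lang_ideal by blast
  then have "length (map Letter w) = length (x @ [Letter 2] @ t @ [Letter 2] @ y)" by (rule arg_cong)
  then show "2 \<le> length w" by simp
qed

lemma word_ideal_mono: "lang n k \<subseteq> lang n j \<Longrightarrow>
  word_ideal (lang n (ideal_lexp k)) \<subseteq> word_ideal (lang n (ideal_lexp j))"
  unfolding word_ideal_def lang_ideal by blast

text \<open>If \<open>t\<close> has no letter 2, then \<open>2 t 2\<close> has only itself as a
  factor of the form \<open>2 w 2\<close>. So the generators over 0 and 1 can be read off the
  ideal.\<close>

lemma word_ideal_eqD:
  assumes "lang n k \<subseteq> lists {Letter 0, Letter 1}" "lang n j \<subseteq> lists {Letter 0, Letter 1}"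
    and "word_ideal (lang n (ideal_lexp j)) \<subseteq> word_ideal (lang n (ideal_lexp k))"
  shows "lang n j \<subseteq> lang n k"
proof
  fix t assume t: "t \<in> lang n j"
  have tl: "t \<in> lists {Letter 0, Letter 1}" using t assms(2) by blast
  then have "[Letter 2] @ t @ [Letter 2] \<in> lists (set ltrs)" by (auto simp: ltrs_def)
  then obtain v where v: "v \<in> lists digits" "[Letter 2] @ t @ [Letter 2] = map Letter v"
    unfolding lists_ltrs by blast
  moreover have "[] @ [Letter 2] @ t @ [Letter 2] @ [] \<in> lang n (ideal_lexp j)"
    unfolding lang_ideal using t by blast
  ultimately have "v \<in> word_ideal (lang n (ideal_lexp j))" by (auto simp: word_ideal_def words_def)
  then have "[Letter 2] @ t @ [Letter 2] \<in> lang n (ideal_lexp k)"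
    using assms(3) v(2) by (auto simp: word_ideal_def)
  then obtain x w y where e: "[Letter 2] @ t @ [Letter 2] = x @ [Letter 2] @ w @ [Letter 2] @ y"
    and w: "w \<in> lang n k" unfolding lang_ideal by blast
  have t2: "Letter 2 \<notin> set t" using tl by auto
  have "x = []"
  proof (cases x)
    case (Cons c x')
    have "tl ([Letter 2] @ t @ [Letter 2]) = tl (x @ [Letter 2] @ w @ [Letter 2] @ y)"
      using e by (rule arg_cong)
    then have "t @ Letter 2 # [] = x' @ Letter 2 # (w @ [Letter 2] @ y)" by (simp add: Cons)
    then have "w @ [Letter 2] @ y = []"
      using append_Cons_eq_iff[of "Letter 2" t "[]"] t2 by fastforce
    then show ?thesis by simp
  qed
  with e have "t @ Letter 2 # [] = w @ Letter 2 # y" by simp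
  then have "t = w" using append_Cons_eq_iff[of "Letter 2" t "[]"] t2 by fastforce
  with w show "t \<in> lang n k" by simp
qed

section \<open>Undecidability\<close>

text \<open>Testing against \<open>Suc n\<close> instead of \<open>n\<close> makes the smaller
  numbers exactly those up to \<open>n\<close>, which \<open>n\<close> optional tallies generate.
  The larger ones consist of \<open>n\<close> fixed tallies, two more, and arbitrarily many
  others.\<close>

definition wrong_input :: lexp where
  "wrong_input = Alt (Cat (Hole False) (Word [Letter 0]))
     (Cat (Hole True) (Cat (Word [Letter 1, Letter 1]) (Cat ones (Word [Letter 0]))))"

lemma lang_wrong_input: "lang n wrong_input = {tally x | x. x \<noteq> Suc n}"
proof (intro equalityI subsetI)
  fix w assume "w \<in> lang n wrong_input"
  then consider k where "w = tally k" "k \<le> n"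
    | j where "w = replicate n (Letter 1) @ [Letter 1, Letter 1] @ replicate j (Letter 1) @ [Letter 0]"
    by (auto simp: wrong_input_def conc_def tally_def)
  then show "w \<in> {tally x | x. x \<noteq> Suc n}"
  proof cases
    case 1
    then show ?thesis by auto
  next
    case 2
    then have "w = tally (n + Suc (Suc j))"
      by (simp add: tally_def replicate_add replicate_app_Cons_same replicate_append_same)
    then show ?thesis by auto
  qed
next
  fix w assume "w \<in> {tally x | x. x \<noteq> Suc n}"
  then obtain x where x: "w = tally x" "x \<noteq> Suc n" by blast
  show "w \<in> lang n wrong_input"
  proof (cases "x \<le> n")
    case True
    then have "replicate x (Letter 1) \<in> lang n (Hole False)" by auto
    from concI[OF this singletonI] x(1) show ?thesis by (simp add: wrong_input_def tally_def)
  next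
    case False
    then obtain j where "x = n + Suc (Suc j)"
      using x(2) less_imp_Suc_add[of "Suc n" x] by auto
    then have w: "w = replicate n (Letter 1) @ [Letter 1, Letter 1] @ replicate j (Letter 1) @ [Letter 0]"
      using x(1) by (simp add: tally_def replicate_add replicate_app_Cons_same replicate_append_same)
    have "w \<in> lang n (Cat (Hole True) (Cat (Word [Letter 1, Letter 1]) (Cat ones (Word [Letter 0]))))"
      unfolding w lang.simps(1,3) ones(2) by (intro concI singletonI rangeI) simp
    then show ?thesis by (simp add: wrong_input_def)
  qed
qed

text \<open>
  The tested number is compared with the input at two places of a certificate. Wherever the marker
  \<^const>\<open>Hash1\<close> is inserted, one of the two copies remains intact, unless they differ.
\<close>

definition reject :: "lexp \<Rightarrow> lexp \<Rightarrow> lexp \<Rightarrow> lexp" where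
  "reject e y z = Alt e (Alt (Cat wrong_input (Cat y z)) (Cat y (Cat wrong_input z)))"

definition ins_reject :: "lexp \<Rightarrow> lexp \<Rightarrow> lexp \<Rightarrow> lexp" where
  "ins_reject e y z =
     Alt (ins_lexp e) (Alt (Cat wrong_input (ins_lexp (Cat y z)))
       (Alt (Cat (ins_lexp y) (Cat wrong_input z)) (Cat y (Cat wrong_input (ins_lexp z)))))"

text \<open>\<open>ins_lexp\<close> cannot handle \<open>wrong_input\<close>, so the terms of the
  product rule with the marker inside it must be covered by the remaining ones. If the two copies
  agree, the untouched copy is wrong as well, and the damaged one passes as arbitrary content of
  \<open>y\<close>. If they differ, \<open>e\<close> already contains the word without its
  marker.\<close>

lemma lang_ins_reject:
  assumes bits: "bits e" "bits y" "bits z"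
    and y: "lang n y = tallies ` {us. length us = 2}" and z: "lang n z = tallies ` UNIV"
    and e: "tallies ` {x # a # b # c | x a b c. x \<noteq> b} \<subseteq> lang n e"
  shows "lang n (ins_reject e y z) = ins (lang n (reject e y z))"
proof -
  let ?D = "lang n wrong_input" and ?e = "lang n e" and ?y = "lang n y" and ?z = "lang n z"
  have l: "lang n (ins_reject e y z) =
      ins ?e \<union> (?D \<cdot> ins (?y \<cdot> ?z) \<union> (ins ?y \<cdot> ?D \<cdot> ?z \<union> ?y \<cdot> ?D \<cdot> ins ?z))"
    using bits by (simp add: ins_reject_def lang_ins_lexp ins_conc)
  have conc_Un: "X \<cdot> (Y \<union> Z) = X \<cdot> Y \<union> X \<cdot> Z" for X Y Z :: "nat msym list set"
    by (auto simp: conc_def)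
  have r: "ins (lang n (reject e y z)) = ins ?e \<union> (ins ?D \<cdot> ?y \<cdot> ?z \<union> ?D \<cdot> ins (?y \<cdot> ?z) \<union>
      (ins ?y \<cdot> ?D \<cdot> ?z \<union> (?y \<cdot> ins ?D \<cdot> ?z \<union> ?y \<cdot> ?D \<cdot> ins ?z)))"
    by (simp add: reject_def ins_Un ins_conc conc_Un)
  have "ins ?D \<cdot> ?y \<cdot> ?z \<subseteq> lang n (ins_reject e y z)"
  proof
    fix w assume "w \<in> ins ?D \<cdot> ?y \<cdot> ?z"
    then obtain s us c where s: "w = s @ tallies us @ tallies c" "s \<in> ins ?D" "length us = 2"
      unfolding y z by (auto elim!: concE)
    then obtain a b where us: "us = [a, b]" by (auto simp: numeral_2_eq_2 length_Suc_conv)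
    obtain p q x where pq: "s = p @ [Hash1] @ q" "p @ q = tally x" "x \<noteq> Suc n"
      using s(2) unfolding lang_wrong_input by (auto elim!: insE)
    show "w \<in> lang n (ins_reject e y z)"
    proof (cases "x = b")
      case False
      have m: "tallies (x # a # b # c) \<in> ?e" using e False by blast
      have eq: "p @ (q @ tallies [a, b] @ tallies c) = tallies (x # a # b # c)" using pq(2) by (simp flip: append_assoc)
      have "p @ (q @ tallies [a, b] @ tallies c) \<in> ?e" unfolding eq by (rule m)
      from insI[OF this] show ?thesis unfolding l s(1) us pq(1) by simp
    next
      case True
      have m: "tallies [x, a] \<in> ?y" unfolding y by (intro imageI) simp
      have eq: "p @ (q @ tally a) = tallies [x, a]" using pq(2) by simp
      have 1: "p @ [Hash1] @ (q @ tally a) \<in> ins ?y" by (rule insI) (unfold eq, rule m)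
      have 2: "tally b \<in> ?D" using True pq(3) unfolding lang_wrong_input by blast
      have 3: "tallies c \<in> ?z" unfolding z by simp
      from concI[OF 1 concI[OF 2 3]] show ?thesis unfolding l s(1) us pq(1) by simp
    qed
  qed
  moreover have "?y \<cdot> ins ?D \<cdot> ?z \<subseteq> lang n (ins_reject e y z)"
  proof
    fix w assume "w \<in> ?y \<cdot> ins ?D \<cdot> ?z"
    then obtain s us c where s: "w = tallies us @ s @ tallies c" "s \<in> ins ?D" "length us = 2"
      unfolding y z by (auto elim!: concE)
    then obtain x a where us: "us = [x, a]" by (auto simp: numeral_2_eq_2 length_Suc_conv)
    obtain p q b where pq: "s = p @ [Hash1] @ q" "p @ q = tally b" "b \<noteq> Suc n"
      using s(2) unfolding lang_wrong_input by (auto elim!: insE)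
    show "w \<in> lang n (ins_reject e y z)"
    proof (cases "x = b")
      case False
      have m: "tallies (x # a # b # c) \<in> ?e" using e False by blast
      have eq: "(tallies [x, a] @ p) @ (q @ tallies c) = tallies (x # a # b # c)" by (simp add: pq(2)[symmetric])
      have "(tallies [x, a] @ p) @ (q @ tallies c) \<in> ?e" unfolding eq by (rule m)
      from insI[OF this] show ?thesis unfolding l s(1) us pq(1) by simp
    next
      case True
      have 1: "tally x \<in> ?D" using True pq(3) unfolding lang_wrong_input by blast
      have "(tally a @ p) @ (q @ tallies c) = tallies [a, b] @ tallies c" by (simp add: pq(2)[symmetric])
      moreover have "tallies [a, b] @ tallies c \<in> ?y \<cdot> ?z" unfolding y z by (intro concI imageI) auto
      ultimately have "(tally a @ p) @ (q @ tallies c) \<in> ?y \<cdot> ?z" by (simp only:)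
      from concI[OF 1 insI[OF this]] show ?thesis unfolding l s(1) us pq(1) by simp
    qed
  qed
  ultimately show ?thesis unfolding r l by blast
qed

text \<open>The shift to \<open>Suc m\<close> agrees with the number against which
  \<open>wrong_input\<close> tests.\<close>

lemma certifiable_halting: "certifiable 1 {[Suc m] | m. \<exists>y. computes g [m] y}"
proof -
  have "certifiable (1 + 2) {us. map ((!) us) [0, 1] \<in> {[Suc b, b] | b. True} \<and>
      map ((!) us) [2, 1] \<in> graph g}"
    by (rule certifiable_query[OF certifiable_Suc certifiable_computes[of 1]]) auto
  from certifiable_proj[OF this] show ?thesis
  proof (rule certifiable_cong)
    fix zs :: "nat list" assume "length zs = 1"
    then obtain x where "zs = [x]" by (auto simp: length_Suc_conv)
    moreover have "(\<exists>ys :: nat list. length ys = 2 \<and> P ys) \<longleftrightarrow> (\<exists>a b. P [a, b])" for P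
      by (auto simp: numeral_2_eq_2 length_Suc_conv)
    ultimately show "zs \<in> {zs. \<exists>ys. length ys = 2 \<and>
        zs @ ys \<in> {us. map ((!) us) [0, 1] \<in> {[Suc b, b] | b. True} \<and>
          map ((!) us) [2, 1] \<in> graph g}} \<longleftrightarrow> zs \<in> {[Suc m] | m. \<exists>y. computes g [m] y}"
      by auto
  qed
qed

text \<open>\<open>k\<close> describes the faulty words, and \<open>j\<close> adds to them all
  well-formed certificates preceded by a number. Building \<open>k\<close> into \<open>j\<close>
  makes one inclusion automatic, so equality of the languages amounts to the other
  inclusion.\<close>

lemma halting_as_inclusion:
  obtains k ik j ij where "over k" "over ik" "over j" "over ij"
    "\<And>n. lang n k \<subseteq> lists {Letter 0, Letter 1}" "\<And>n. lang n j \<subseteq> lists {Letter 0, Letter 1}"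
    "\<And>n. lang n ik = ins (lang n k)" "\<And>n. lang n ij = ins (lang n j)"
    "\<And>n. lang n k \<noteq> {}" "\<And>n. lang n k \<subseteq> lang n j"
    "\<And>n. lang n j \<subseteq> lang n k \<longleftrightarrow> \<not> (\<exists>y. computes g [n] y)"
proof -
  define R where "R = {[Suc m] | m. \<exists>y. computes g [m] y}"
  have "certifiable 1 R" unfolding R_def by (rule certifiable_halting)
  then obtain J K where JK: "checker 1 J K"
    "\<And>zs. length zs = 1 \<Longrightarrow> zs \<in> R \<longleftrightarrow> (\<exists>g c. g # zs @ c \<in> J - K)"
    unfolding certifiable_def by blast
  define U where "U = {us :: nat list. length us = 1}"
  \<comment> \<open>In \<open>x # a # b # c\<close>, the part \<open>a # b # c\<close> is a
    certificate with tag \<open>a\<close> and argument \<open>b\<close>, and \<open>x\<close> is the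
    additional copy of the argument. \<open>E\<close> collects the faults that do not involve
    \<open>n\<close>.\<close>
  define E where "E = {x # a # b # c | x a b c. x \<noteq> (b :: nat)} \<union> U \<cdot> K"
  have "{x # a # b # c | x a b c. x \<noteq> (b :: nat)} = {x # t @ [y] | x y t. x \<noteq> y \<and> t \<in> U} \<cdot> UNIV"
    (is "?L = ?R")
  proof (intro equalityI subsetI)
    fix w assume "w \<in> ?L"
    then obtain x a b c where w: "w = (x # [a] @ [b]) @ c" "x \<noteq> b" by auto
    have "[a] \<in> U" by (simp add: U_def)
    with w(2) have "x # [a] @ [b] \<in> {x # t @ [y] | x y t. x \<noteq> y \<and> t \<in> U}" by blast
    then show "w \<in> ?R" unfolding w(1) by (rule concI) simp
  next
    fix w assume "w \<in> ?R"
    then obtain v c where "w = v @ c" "v \<in> {x # t @ [y] | x y t. x \<noteq> y \<and> t \<in> U}"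
      by (rule concE)
    then obtain x t y where w: "w = (x # t @ [y]) @ c" "x \<noteq> y" "t \<in> U" by blast
    then obtain a where "t = [a]" by (auto simp: U_def length_Suc_conv)
    with w show "w \<in> ?L" by auto
  qed
  moreover have cf_lists: "cf_lists U" "cf_lists J" "cf_lists K"
    using JK(1) cf_lists_length[of 1] unfolding checker_def U_def by blast+
  ultimately have "cf_lists E"
    unfolding E_def by (simp only:) (intro cf_lists_Un cf_lists_conc cf_lists_neq cf_lists_UNIV cf_lists(1,3))
  then obtain e where e: "bits e" "\<forall>n. lang n e = tallies ` E" unfolding cf_lists_def by blast
  have "cf_lists (U \<cdot> J)" by (intro cf_lists_conc cf_lists(1,2))
  then obtain d where d: "bits d" "\<forall>n. lang n d = tallies ` (U \<cdot> J)" unfolding cf_lists_def by blast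
  obtain y where y: "bits y" "\<forall>n. lang n y = tallies ` {us. length us = 2}"
    using cf_lists_length[of 2] unfolding cf_lists_def by blast
  obtain z where z: "bits z" "\<forall>n. lang n z = tallies ` UNIV" using cf_lists_UNIV unfolding cf_lists_def by blast
  define k where "k = reject e y z"
  define ik where "ik = ins_reject e y z"
  have over: "over k" "over ik" "over d" "over (ins_lexp d)"
    using e(1) y(1) z(1) d(1)
    by (auto simp: k_def ik_def reject_def ins_reject_def wrong_input_def over_bits over_ins)
  have EK: "tallies ` {x # a # b # c | x a b c. x \<noteq> b} \<subseteq> tallies ` E"
    unfolding E_def by (intro image_mono Un_upper1)
  have ik: "lang n ik = ins (lang n k)" for n
    unfolding k_def ik_def by (rule lang_ins_reject) (use e y z EK in auto)
  \<comment> \<open>\<open>F n\<close> is \<open>lang n k\<close> before the encoding as tallies.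
    The blocks of length 2 skip the tag together with one of the two copies.\<close>
  define F where "F n = E \<union> ({us. length us = 1 \<and> us \<noteq> [Suc n]} \<cdot> {us. length us = 2} \<cdot> UNIV \<union>
    {us. length us = 2} \<cdot> {us. length us = 1 \<and> us \<noteq> [Suc n]} \<cdot> UNIV)" for n
  have w: "lang n wrong_input = tallies ` {us. length us = 1 \<and> us \<noteq> [Suc n]}" for n
    unfolding lang_wrong_input by (auto simp: length_Suc_conv image_def)
  have k: "lang n k = tallies ` F n" for n
    by (simp add: k_def reject_def F_def w e y z image_Un tallies_conc)
  have F: "x # a # b # c \<in> F n \<longleftrightarrow> x \<noteq> b \<or> a # b # c \<in> K \<or> x \<noteq> Suc n \<or> b \<noteq> Suc n" for x a b c n
  proof -
    have "x # a # b # c \<in> U \<cdot> K \<longleftrightarrow> a # b # c \<in> K"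
      using concI[of "[x]" U "a # b # c" K] by (auto simp: U_def length_Suc_conv elim!: concE)
    moreover have "x # a # b # c \<in> {us. length us = 1 \<and> us \<noteq> [Suc n]} \<cdot> {us. length us = 2} \<cdot> UNIV
        \<longleftrightarrow> x \<noteq> Suc n"
      using concI[of "[x]" "{us. length us = 1 \<and> us \<noteq> [Suc n]}" "[a, b] @ c"
          "{us. length us = 2} \<cdot> UNIV"] concI[of "[a, b]" "{us. length us = 2}" c UNIV]
      by (auto simp: length_Suc_conv elim!: concE)
    moreover have "x # a # b # c \<in> {us. length us = 2} \<cdot> {us. length us = 1 \<and> us \<noteq> [Suc n]} \<cdot> UNIV
        \<longleftrightarrow> b \<noteq> Suc n"
      using concI[of "[x, a]" "{us. length us = 2}" "[b] @ c"
          "{us. length us = 1 \<and> us \<noteq> [Suc n]} \<cdot> UNIV"]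
        concI[of "[b]" "{us. length us = 1 \<and> us \<noteq> [Suc n]}" c UNIV]
      by (auto simp: length_Suc_conv numeral_2_eq_2 elim!: concE)
    ultimately show ?thesis by (auto simp: F_def E_def)
  qed
  have iff: "tallies ` (U \<cdot> J) \<subseteq> lang n k \<longleftrightarrow> \<not> (\<exists>y. computes g [n] y)" for n
  proof -
    have "tallies ` (U \<cdot> J) \<subseteq> lang n k \<longleftrightarrow> U \<cdot> J \<subseteq> F n"
      unfolding k by (rule inj_image_subset_iff[OF inj_tallies])
    also have "\<dots> \<longleftrightarrow> (\<forall>a c. a # [Suc n] @ c \<in> J \<longrightarrow> a # [Suc n] @ c \<in> K)"
    proof
      assume sub: "U \<cdot> J \<subseteq> F n"
      show "\<forall>a c. a # [Suc n] @ c \<in> J \<longrightarrow> a # [Suc n] @ c \<in> K"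
      proof (intro allI impI)
        fix a c assume J: "a # [Suc n] @ c \<in> J"
        have "[Suc n] \<in> U" by (simp add: U_def)
        from concI[OF this J] sub have "Suc n # a # Suc n # c \<in> F n" by auto
        then show "a # [Suc n] @ c \<in> K" using F by simp
      qed
    next
      assume all: "\<forall>a c. a # [Suc n] @ c \<in> J \<longrightarrow> a # [Suc n] @ c \<in> K"
      show "U \<cdot> J \<subseteq> F n"
      proof
        fix t assume "t \<in> U \<cdot> J"
        then obtain u v where uv: "t = u @ v" "u \<in> U" "v \<in> J" by (auto elim!: concE)
        obtain x where "u = [x]" using uv(2) by (auto simp: U_def length_Suc_conv)
        moreover have "1 < length v" using JK(1) uv(3) by (auto simp: checker_def)
        then obtain a b c where "v = a # b # c" by (cases v rule: remdups_adj.cases) auto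
        ultimately show "t \<in> F n" using F[of x a b c n] uv all by auto
      qed
    qed
    also have "\<dots> \<longleftrightarrow> [Suc n] \<notin> R" using JK(2)[of "[Suc n]"] by auto
    finally show ?thesis by (simp add: R_def)
  qed
  \<comment> \<open>The copies 0 and 1 differ, so this list is faulty for every \<open>n\<close>. A
    non-empty language is what gives the quotient a zero.\<close>
  have "[0, 0, 1] \<in> E" by (auto simp: E_def)
  then have ne: "lang n k \<noteq> {}" for n unfolding k F_def by blast
  show ?thesis
  proof (rule that[of k ik "Alt k d" "Alt ik (ins_lexp d)"])
    show "lang n k \<subseteq> lists {Letter 0, Letter 1}" for n
      unfolding k using set_tallies by fastforce
    then show "lang n (Alt k d) \<subseteq> lists {Letter 0, Letter 1}" for n
      using bits_lang[OF d(1)] by simp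
    show "lang n (Alt ik (ins_lexp d)) = ins (lang n (Alt k d))" for n
      using ik lang_ins_lexp[OF d(1)] by (simp add: ins_Un)
    show "lang n (Alt k d) \<subseteq> lang n k \<longleftrightarrow> \<not> (\<exists>y. computes g [n] y)" for n
      using iff[of n] d(2) by simp
  qed (use over ik ne in auto)
qed

section \<open>The diagonal argument\<close>

lemma injection_exists:
  assumes "infinite (UNIV :: 's set)"
  obtains \<iota> :: "nat list option \<Rightarrow> 's" where "inj \<iota>"
proof -
  obtain h :: "nat \<Rightarrow> 's" where "inj h"
    using infinite_countable_subset[OF assms] by blast
  then have "inj (h \<circ> (to_nat :: nat list option \<Rightarrow> nat))" by (intro inj_compose) auto
  then show ?thesis by (rule that)
qed

lemma presents_quotient:
  assumes "inj \<iota>" "over e" "over e'" "lang n k \<subseteq> lists (set ltrs)" "lang n k \<noteq> {}"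
    and "lang n ik = ins (lang n k)"
    and "cfg_lang (lexp_cfg s e e' n) = lang n (mult_lexp k ik)"
  shows "presents_interpreted (presentation s e e' n)
    (rees_quotient.quotient \<iota> digits (word_ideal (lang n (ideal_lexp k))))"
proof -
  interpret rees_quotient \<iota> digits "word_ideal (lang n (ideal_lexp k))"
    using assms(1,4,5) by (rule rees_word_ideal)
  have over: "cfg_over (msyms digits) (lexp_cfg s e e' n)" using assms(2,3) by (rule cfg_over_lexp)
  show ?thesis
    unfolding presents_interpreted_def
  proof
    have "nfa_over digits all_words_nfa" by (auto simp: nfa_over_def all_words_nfa_def)
    then show "wf_input (presentation s e e' n)"
      using over by (simp add: wf_input_def presentation_def)
    show "interpreted_wh_structure_for (structure_of (presentation s e e' n)) quotient"
    proof (rule interpreted_quotient)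
      show "context_free_over (msyms digits) (mult_lang (structure_of (presentation s e e' n)))"
        unfolding context_free_over_def structure_of_def presentation_def using over by auto
    qed (use regular_over_words in
        \<open>simp_all add: structure_of_def presentation_def regular_words assms(7)
          lang_mult_lexp[OF assms(4,6)]\<close>)
  qed
qed

theorem theorem5p5:
  assumes "infinite (UNIV :: 's set)" and "infinite (UNIV :: 't set)"
  shows "\<not> (\<exists>f :: recf. \<forall>P\<^sub>1 P\<^sub>2 (S\<^sub>1 :: 's monoid) (S\<^sub>2 :: 't monoid).
           presents_interpreted P\<^sub>1 S\<^sub>1 \<longrightarrow> presents_interpreted P\<^sub>2 S\<^sub>2 \<longrightarrow>
           computes f [input_encode P\<^sub>1, input_encode P\<^sub>2] (if S\<^sub>1 \<cong> S\<^sub>2 then 1 else 0))"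
proof
  assume "\<exists>f :: recf. \<forall>P\<^sub>1 P\<^sub>2 (S\<^sub>1 :: 's monoid) (S\<^sub>2 :: 't monoid).
           presents_interpreted P\<^sub>1 S\<^sub>1 \<longrightarrow> presents_interpreted P\<^sub>2 S\<^sub>2 \<longrightarrow>
           computes f [input_encode P\<^sub>1, input_encode P\<^sub>2] (if S\<^sub>1 \<cong> S\<^sub>2 then 1 else 0)"
  then obtain f where f: "\<And>P\<^sub>1 P\<^sub>2 (S\<^sub>1 :: 's monoid) (S\<^sub>2 :: 't monoid).
      presents_interpreted P\<^sub>1 S\<^sub>1 \<Longrightarrow> presents_interpreted P\<^sub>2 S\<^sub>2 \<Longrightarrow>
      computes f [input_encode P\<^sub>1, input_encode P\<^sub>2] (if S\<^sub>1 \<cong> S\<^sub>2 then 1 else 0)" by blast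
  \<comment> \<open>The elements of the quotients have countably many codes, so either infinite type
    has room for them.\<close>
  obtain \<iota> :: "nat list option \<Rightarrow> 's" where \<iota>: "inj \<iota>" using injection_exists[OF assms(1)] .
  obtain \<kappa> :: "nat list option \<Rightarrow> 't" where \<kappa>: "inj \<kappa>" using injection_exists[OF assms(2)] .
  obtain k ik j ij where over: "over k" "over ik" "over j" "over ij"
    and sub: "\<And>n. lang n k \<subseteq> lists {Letter 0, Letter 1}" "\<And>n. lang n j \<subseteq> lists {Letter 0, Letter 1}"
    and ins: "\<And>n. lang n ik = ins (lang n k)" "\<And>n. lang n ij = ins (lang n j)"
    and ne: "\<And>n. lang n k \<noteq> {}" and kj: "\<And>n. lang n k \<subseteq> lang n j"
    and iff: "\<And>n. lang n j \<subseteq> lang n k \<longleftrightarrow> \<not> (\<exists>y. computes (diagonal_rf f) [n] y)"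
    by (rule halting_as_inclusion[of "diagonal_rf f"]) blast
  define e where "e = mult_lexp k ik"
  define e' where "e' = mult_lexp j ij"
  \<comment> \<open>The diagonal choice: \<open>n\<close> codes the productions common to the two
    grammars that belong to the input \<open>n\<close>. There is no circularity, as \<open>e\<close>
    and \<open>e'\<close> refer to the input only through holes.\<close>
  define n where "n = list_encode (map production_encode (base_prods e e'))"
  define S\<^sub>1 where "S\<^sub>1 = rees_quotient.quotient \<iota> digits (word_ideal (lang n (ideal_lexp k)))"
  define S\<^sub>2 where "S\<^sub>2 = rees_quotient.quotient \<kappa> digits (word_ideal (lang n (ideal_lexp j)))"
  have oe: "over e" "over e'" using over by (simp_all add: e_def e'_def over_mult_lexp)
  have "lists {Letter 0, Letter 1} \<subseteq> lists (set ltrs)" by (auto simp: ltrs_def)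
  then have sub': "lang n k \<subseteq> lists (set ltrs)" "lang n j \<subseteq> lists (set ltrs)"
    using sub by blast+
  have nej: "lang n j \<noteq> {}" using ne kj by blast
  have P\<^sub>1: "presents_interpreted (presentation 0 e e' n) S\<^sub>1"
    unfolding S\<^sub>1_def
    by (rule presents_quotient[OF \<iota> oe sub'(1) ne ins(1)])
      (simp add: lexp_cfg_lang(1) e_def)
  have P\<^sub>2: "presents_interpreted (presentation 1 e e' n) S\<^sub>2"
    unfolding S\<^sub>2_def
    by (rule presents_quotient[OF \<kappa> oe sub'(2) nej ins(2)])
      (simp only: lexp_cfg_lang(2) e'_def)
  have R: "rees_quotient \<iota> digits (word_ideal (lang n (ideal_lexp k)))"
    "rees_quotient \<kappa> digits (word_ideal (lang n (ideal_lexp j)))"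
    using rees_word_ideal \<iota> \<kappa> sub' ne nej by blast+
  have "S\<^sub>1 \<cong> S\<^sub>2 \<longleftrightarrow> lang n j \<subseteq> lang n k"
  proof
    assume "S\<^sub>1 \<cong> S\<^sub>2"
    then have "word_ideal (lang n (ideal_lexp k)) = word_ideal (lang n (ideal_lexp j))"
      using rees_iso_eq[OF R word_ideal_mono[OF kj]] by (simp add: S\<^sub>1_def S\<^sub>2_def)
    then show "lang n j \<subseteq> lang n k" using word_ideal_eqD sub by blast
  next
    assume "lang n j \<subseteq> lang n k"
    then have "word_ideal (lang n (ideal_lexp j)) = word_ideal (lang n (ideal_lexp k))"
      using word_ideal_mono kj by blast
    then show "S\<^sub>1 \<cong> S\<^sub>2" using rees_iso R unfolding S\<^sub>1_def S\<^sub>2_def by simp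
  qed
  \<comment> \<open>For this \<open>n\<close>, the numbers that \<open>diagonal_rf f\<close>
    computes and submits to \<open>f\<close> are the codes of the two presentations, so
    \<open>f\<close> has to answer correctly for \<open>S\<^sub>1\<close> and
    \<open>S\<^sub>2\<close>.\<close>
  moreover have "(\<exists>y. computes (diagonal_rf f) [n] y) \<longleftrightarrow> S\<^sub>1 \<cong> S\<^sub>2"
    by (rule diagonal_halts[OF computes_presentation computes_presentation f[OF P\<^sub>1 P\<^sub>2]])
      (simp_all add: n_def)
  ultimately show False using iff by blast
qed

end
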